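(* Let $L_{\mathrm m}$ be a matter field Lagrangian on an $n$-dimensional space-time $M$, depending on the metric tensor $g$, the matter fields $\varphi$ and their derivatives, with matter field action $S_{\mathrm m,K}=\int_Kd^nx\,\sqrt{|\det g|}\,L_{\mathrm m}$ over compact subsets $K$ of $M$ and with corresponding energy-momentum tensor $T^{\mu\nu}=-2\,\delta L_{\mathrm m}/\delta g_{\mu\nu}$. "On shell", that is, assuming the matter fields to satisfy their equations of motion $\delta L_{\mathrm m}/\delta\varphi^i=0$, the matter field action is locally Weyl invariant if and only if the corresponding energy-momentum tensor is traceless, i.e. $g_{\mu\nu}T^{\mu\nu}=0$.
   Context: **Setting.** $M$ is an oriented $n$-dimensional manifold. The fields are a pseudo-Riemannian metric $g$ on $M$ and matter fields $\varphi=(\varphi^i)$, which are sections of bundles over $M$. $L_{\mathrm m}$ depends on $\varphi$ and its first order partial derivatives and on $g$ and its partial derivatives (up to second order). **Variational derivatives.** $\delta L_{\mathrm m}/\delta\varphi^i$ is the Euler-Lagrange derivative $$\frac{\delta L_{\mathrm m}}{\delta\varphi^i}=\frac{1}{\sqrt{|\det g|}}\left(\frac{\partial(\sqrt{|\det g|}\,L_{\mathrm m})}{\partial\varphi^i}-\partial_\mu\frac{\partial(\sqrt{|\det g|}\,L_{\mathrm m})}{\partial\,\partial_\mu\varphi^i}\right).$$ The energy-momentum tensor $T^{\mu\nu}=-2\,\delta L_{\mathrm m}/\delta g_{\mu\nu}$ is the rank 2 tensor field satisfying $$\delta_g\int_Kd^nx\,\sqrt{|\det g|}\,L_{\mathrm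 m}=-\tfrac12\int_Kd^nx\,\sqrt{|\det g|}\;T^{\mu\nu}\,\delta g_{\mu\nu}$$ for every compact $K\subset M$ and every variation $\delta g_{\mu\nu}$ of the metric with support contained in $K$, the matter fields being held fixed. (For spinor fields, the variation of the metric is implemented by the variation $\delta e^a_\mu=\tfrac12\eta^{ab}e^\nu_b\,\delta g_{\mu\nu}$ of orthonormal frames, where $g_{\mu\nu}=\eta_{ab}e^a_\mu e^b_\nu$ with $\eta$ the standard flat metric, the spinor components being held fixed.) **Local Weyl rescalings** by an arbitrary positive function $\lambda$ on $M$ are the transformations $$g_{\mu\nu}\to\lambda^2g_{\mu\nu},\qquad g^{\mu\nu}\to\lambda^{-2}g^{\mu\nu},\qquad \varphi^i\to\lambda^{-w_i}\varphi^i,$$ where the real number $w_i$ is the Weyl dimension of the field (sections of nonlinear fiber bundles are left invariant). With $\omega=\ln\lambda$, the infinitesimal local Weyl rescaling parametrized by a function $\omega$ on $M$ is $$\delta_\omega g_{\mu\nu}=2\,\omega\,g_{\mu\nu},\qquad \delta_\omega g^{\mu\nu}=-2\,\omega\,g^{\mu\nu},\qquad \delta_\omega\varphi^i=-w_i\,\omega\,\varphi^i .$$ **Local Weyl invariance** of the matter field action means its invariance under local Weyl rescalings; at the infinitesimal level, the variation $\delta_\omega S_{\mathrm m,K}$ over any compact subset $K$ of $M$ induced by the infinitesimal local Weyl rescaling with parameter $\omega$ vanishes, for an arbitrary function $\omega$ on $M$. "On shell" local Weyl invariance means that this invariance is required only when the equations of motion for the matter fields are used.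
   Formalization: Local Weyl invariance is required only for functions ω whose support lies in the compact set K, as for the metric variations defining T; for arbitrary ω boundary terms make the claim false (e.g. a massless scalar φ = x with Weyl dimension 1 in the flat plane). *)

theory Defs
  imports "HOL-Analysis.Analysis"
begin

primrec Ck_on :: "nat \<Rightarrow> 'a::euclidean_space set \<Rightarrow> ('a \<Rightarrow> 'b::real_normed_vector) \<Rightarrow> bool" where
  "Ck_on 0 S f = continuous_on S f"
| "Ck_on (Suc k) S f = ((\<forall>x\<in>S. f differentiable (at x)) \<and>
     (\<forall>v. Ck_on k S (\<lambda>x. frechet_derivative f (at x) v)))"

text \<open>Only used for open sets \<open>S\<close>.\<close>
definition smooth_on :: "'a::euclidean_space set \<Rightarrow> ('a \<Rightarrow> 'b::real_normed_vector) \<Rightarrow> bool" where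
  "smooth_on S f \<longleftrightarrow> (\<forall>k. Ck_on k S f)"

text \<open>
  The space-time is the type \<open>'m\<close>, the total space of the bundle of all matter fields is the
  type \<open>'e\<close>. Both are described by charts indexed by \<open>'c\<close>; the components of a field in the
  chart \<open>\<alpha>\<close> are a function of the chart index and of the point, whose values at points outside
  the domain of the chart are irrelevant.

  The gravitational variable \<open>h\<close> has as components either the metric \<open>g\<^sub>\<mu>\<^sub>\<nu>\<close> or, as needed for
  spinor fields, orthonormal frames \<open>e\<^sup>a\<^sub>\<mu>\<close> (row index \<open>a\<close>, column index \<open>\<mu>\<close>). In the latter case
  \<open>Frame \<eta> \<Lambda>\<close> contains the standard flat metric and the local Lorentz transformations
  \<open>\<Lambda> \<alpha> \<beta>\<close> relating the frames used in the charts \<open>\<beta>\<close> and \<open>\<alpha>\<close>; their action on spinor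
  components is part of the transition functions of the matter bundle.
\<close>

datatype ('c, 'm, 'n::finite) gravity =
    Metric
  | Frame "real^'n^'n" "'c \<Rightarrow> 'c \<Rightarrow> 'm \<Rightarrow> real^'n^'n"

text \<open>
  Coordinates on the space of jets on which a Lagrangian depends:
  \<open>x\<^sup>\<mu>\<close>, \<open>\<phi>\<^sup>i\<close>, \<open>\<partial>\<^sub>\<mu> \<phi>\<^sup>i\<close> (entry \<open>$ i $ \<mu>\<close>), \<open>h\<close>, \<open>\<partial>\<^sub>\<rho> h\<close> (entry \<open>$ \<rho>\<close>) and
  \<open>\<partial>\<^sub>\<rho> \<partial>\<^sub>\<sigma> h\<close> (entry \<open>$ \<rho> $ \<sigma>\<close>).
\<close>

type_synonym ('n, 'k) jet =
  "(real^'n) \<times> (real^'k) \<times> (real^'n^'k) \<times> (real^'n^'n) \<times> (real^'n^'n^'n) \<times> (real^'n^'n^'n^'n)"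

text \<open>
  \<open>lin\<close> is the set of those \<open>i\<close> for which \<open>\<phi>\<^sup>i\<close> is a component of a section of a vector bundle; the
  other \<open>\<phi>\<^sup>i\<close> are local fibre coordinates of a section of a nonlinear fibre bundle.
  \<open>lagr \<alpha>\<close> is the expression of the scalar \<open>L\<^sub>m\<close> in the chart \<open>\<alpha>\<close>.
\<close>

record ('c, 'm, 'n::finite, 'e, 'k::finite) field_theory =
  atlas :: "'c set"
  cdom :: "'c \<Rightarrow> 'm set"
  coord :: "'c \<Rightarrow> 'm \<Rightarrow> real^'n"
  proj :: "'e \<Rightarrow> 'm"
  fdom :: "'c \<Rightarrow> 'e set"
  fcoord :: "'c \<Rightarrow> 'e \<Rightarrow> real^'k"
  lin :: "'k set"
  wdim :: "'k \<Rightarrow> real"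
  grav :: "('c, 'm, 'n) gravity"
  lagr :: "'c \<Rightarrow> ('n, 'k) jet \<Rightarrow> real"


subsection \<open>Space-time\<close>

abbreviation cinv :: "('c, 'm, 'n::finite, 'e, 'k::finite) field_theory \<Rightarrow> 'c \<Rightarrow> real^'n \<Rightarrow> 'm" where
  "cinv T \<alpha> \<equiv> inv_into (cdom T \<alpha>) (coord T \<alpha>)"

text \<open>The partial derivative \<open>\<partial>f/\<partial>x\<^sup>\<mu>\<close> at the point \<open>p\<close> with respect to the chart \<open>\<alpha>\<close>.\<close>
definition pdiff :: "('c, 'm, 'n::finite, 'e, 'k::finite) field_theory \<Rightarrow> 'c \<Rightarrow> 'n \<Rightarrow>
    ('m \<Rightarrow> 'b::real_normed_vector) \<Rightarrow> 'm \<Rightarrow> 'b" where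
  "pdiff T \<alpha> \<mu> f p = frechet_derivative (f \<circ> cinv T \<alpha>) (at (coord T \<alpha> p)) (axis \<mu> 1)"

text \<open>The matrix with entries \<open>\<partial>x\<^sub>\<beta>\<^sup>\<mu>/\<partial>x\<^sub>\<alpha>\<^sup>\<nu>\<close>.\<close>
definition jac :: "('c, 'm, 'n::finite, 'e, 'k::finite) field_theory \<Rightarrow> 'c \<Rightarrow> 'c \<Rightarrow> 'm \<Rightarrow> real^'n^'n" where
  "jac T \<beta> \<alpha> p = (\<chi> \<mu> \<nu>. pdiff T \<alpha> \<nu> (coord T \<beta>) p $ \<mu>)"

definition oriented_manifold ::
    "('c, 'm::{t2_space,second_countable_topology}, 'n::finite, 'e, 'k::finite) field_theory \<Rightarrow> bool" where
  "oriented_manifold T \<longleftrightarrow>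
     (\<Union>\<alpha>\<in>atlas T. cdom T \<alpha>) = UNIV \<and>
     (\<forall>\<alpha>\<in>atlas T. open (cdom T \<alpha>) \<and> open (coord T \<alpha> ` cdom T \<alpha>) \<and>
        homeomorphism (cdom T \<alpha>) (coord T \<alpha> ` cdom T \<alpha>) (coord T \<alpha>) (cinv T \<alpha>)) \<and>
     (\<forall>\<alpha>\<in>atlas T. \<forall>\<beta>\<in>atlas T.
        smooth_on (coord T \<alpha> ` (cdom T \<alpha> \<inter> cdom T \<beta>)) (coord T \<beta> \<circ> cinv T \<alpha>) \<and>
        (\<forall>p \<in> cdom T \<alpha> \<inter> cdom T \<beta>. det (jac T \<beta> \<alpha> p) > 0))"

definition smooth_function :: "('c, 'm, 'n::finite, 'e, 'k::finite) field_theory \<Rightarrow> ('m \<Rightarrow> real) \<Rightarrow> bool" where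
  "smooth_function T f \<longleftrightarrow> (\<forall>\<alpha>\<in>atlas T. smooth_on (coord T \<alpha> ` cdom T \<alpha>) (f \<circ> cinv T \<alpha>))"

definition smooth_components :: "('c, 'm, 'n::finite, 'e, 'k::finite) field_theory \<Rightarrow>
    ('c \<Rightarrow> 'm \<Rightarrow> real^'n^'n) \<Rightarrow> bool" where
  "smooth_components T t \<longleftrightarrow>
     (\<forall>\<alpha>\<in>atlas T. smooth_on (coord T \<alpha> ` cdom T \<alpha>) (t \<alpha> \<circ> cinv T \<alpha>))"

definition symmetric_components :: "('c, 'm, 'n::finite, 'e, 'k::finite) field_theory \<Rightarrow>
    ('c \<Rightarrow> 'm \<Rightarrow> real^'n^'n) \<Rightarrow> bool" where
  "symmetric_components T t \<longleftrightarrow> (\<forall>\<alpha>\<in>atlas T. \<forall>p\<in>cdom T \<alpha>. transpose (t \<alpha> p) = t \<alpha> p)"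

definition covariant_tensor2 :: "('c, 'm, 'n::finite, 'e, 'k::finite) field_theory \<Rightarrow>
    ('c \<Rightarrow> 'm \<Rightarrow> real^'n^'n) \<Rightarrow> bool" where
  "covariant_tensor2 T t \<longleftrightarrow> smooth_components T t \<and>
     (\<forall>\<alpha>\<in>atlas T. \<forall>\<beta>\<in>atlas T. \<forall>p \<in> cdom T \<alpha> \<inter> cdom T \<beta>.
        t \<alpha> p = transpose (jac T \<beta> \<alpha> p) ** t \<beta> p ** jac T \<beta> \<alpha> p)"

definition contravariant_tensor2 :: "('c, 'm, 'n::finite, 'e, 'k::finite) field_theory \<Rightarrow>
    ('c \<Rightarrow> 'm \<Rightarrow> real^'n^'n) \<Rightarrow> bool" where
  "contravariant_tensor2 T t \<longleftrightarrow> smooth_components T t \<and>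
     (\<forall>\<alpha>\<in>atlas T. \<forall>\<beta>\<in>atlas T. \<forall>p \<in> cdom T \<alpha> \<inter> cdom T \<beta>.
        t \<beta> p = jac T \<beta> \<alpha> p ** t \<alpha> p ** transpose (jac T \<beta> \<alpha> p))"

definition tensor_support :: "('c, 'm::topological_space, 'n::finite, 'e, 'k::finite) field_theory \<Rightarrow>
    ('c \<Rightarrow> 'm \<Rightarrow> real^'n^'n) \<Rightarrow> 'm set" where
  "tensor_support T t = closure {p. \<exists>\<alpha>\<in>atlas T. p \<in> cdom T \<alpha> \<and> t \<alpha> p \<noteq> 0}"

text \<open>For a contravariant \<open>s\<close> and a covariant \<open>t\<close> the result does not depend on the chart.\<close>
definition contraction :: "('c, 'm, 'n::finite, 'e, 'k::finite) field_theory \<Rightarrow>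
    ('c \<Rightarrow> 'm \<Rightarrow> real^'n^'n) \<Rightarrow> ('c \<Rightarrow> 'm \<Rightarrow> real^'n^'n) \<Rightarrow> 'm \<Rightarrow> real" where
  "contraction T s t p =
     (let \<alpha> = (SOME \<alpha>. \<alpha> \<in> atlas T \<and> p \<in> cdom T \<alpha>)
      in \<Sum>\<mu>\<in>UNIV. \<Sum>\<nu>\<in>UNIV. s \<alpha> p $ \<mu> $ \<nu> * t \<alpha> p $ \<mu> $ \<nu>)"

text \<open>
  The measure \<open>d\<^sup>nx \<surd>|det g|\<close>: in every chart it has the density \<open>\<surd>|det g|\<close> with respect to
  Lebesgue measure.
\<close>
definition volume :: "('c, 'm::topological_space, 'n::finite, 'e, 'k::finite) field_theory \<Rightarrow>
    ('c \<Rightarrow> 'm \<Rightarrow> real^'n^'n) \<Rightarrow> 'm measure" where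
  "volume T g = (THE M. sets M = sets borel \<and>
     (\<forall>\<alpha>\<in>atlas T. \<forall>B\<in>sets borel. B \<subseteq> cdom T \<alpha> \<longrightarrow>
        emeasure M B =
          (\<integral>\<^sup>+x. ennreal (sqrt \<bar>det (g \<alpha> (cinv T \<alpha> x))\<bar>) * indicator (coord T \<alpha> ` B) x \<partial>lborel)))"


subsection \<open>Matter fields\<close>

definition same_nonlinear :: "('c, 'm, 'n::finite, 'e, 'k::finite) field_theory \<Rightarrow>
    real^'k \<Rightarrow> real^'k \<Rightarrow> bool" where
  "same_nonlinear T u v \<longleftrightarrow> (\<forall>i. i \<notin> lin T \<longrightarrow> u $ i = v $ i)"

definition bcoord :: "('c, 'm, 'n::finite, 'e, 'k::finite) field_theory \<Rightarrow> 'c \<Rightarrow> 'e \<Rightarrow>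
    (real^'n) \<times> (real^'k)" where
  "bcoord T \<alpha> z = (coord T \<alpha> (proj T z), fcoord T \<alpha> z)"

text \<open>
  A bundle over space-time composed of vector bundles and nonlinear fibre bundles, given by
  fibred charts \<open>(x\<^sup>\<mu>, \<phi>\<^sup>i)\<close>. The linear coordinates range over whole vector spaces. Under a change
  of charts, they transform by matrices depending on the base point which do not mix vector bundles
  of different Weyl dimensions; the nonlinear coordinates transform among themselves, and have
  Weyl dimension 0.
\<close>
definition matter_bundle ::
    "('c, 'm::topological_space, 'n::finite, 'e::topological_space, 'k::finite) field_theory \<Rightarrow> bool" where
  "matter_bundle T \<longleftrightarrow>
     (\<Union>\<alpha>\<in>atlas T. fdom T \<alpha>) = UNIV \<and>
     (\<forall>\<alpha>\<in>atlas T. open (fdom T \<alpha>) \<and> open (bcoord T \<alpha> ` fdom T \<alpha>) \<and>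
        proj T ` fdom T \<alpha> \<subseteq> cdom T \<alpha> \<and>
        homeomorphism (fdom T \<alpha>) (bcoord T \<alpha> ` fdom T \<alpha>)
          (bcoord T \<alpha>) (inv_into (fdom T \<alpha>) (bcoord T \<alpha>))) \<and>
     (\<forall>\<alpha>\<in>atlas T. \<forall>\<beta>\<in>atlas T.
        smooth_on (bcoord T \<alpha> ` (fdom T \<alpha> \<inter> fdom T \<beta>))
          (bcoord T \<beta> \<circ> inv_into (fdom T \<alpha>) (bcoord T \<alpha>)) \<and>
        (\<forall>z \<in> fdom T \<alpha> \<inter> fdom T \<beta>. \<forall>v. same_nonlinear T (fcoord T \<alpha> z) v \<longrightarrow>
           (\<exists>z' \<in> fdom T \<alpha> \<inter> fdom T \<beta>. proj T z' = proj T z \<and> fcoord T \<alpha> z' = v)) \<and>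
        (\<exists>A :: 'm \<Rightarrow> real^'k^'k. \<forall>p. 
           (\<forall>i\<in>lin T. \<forall>j. A p $ i $ j \<noteq> 0 \<longrightarrow> j \<in> lin T \<and> wdim T j = wdim T i) \<and>
           (\<forall>z \<in> fdom T \<alpha> \<inter> fdom T \<beta>. proj T z = p \<longrightarrow>
              (\<forall>i\<in>lin T. fcoord T \<beta> z $ i = (A p *v fcoord T \<alpha> z) $ i))) \<and>
        (\<forall>z \<in> fdom T \<alpha> \<inter> fdom T \<beta>. \<forall>z' \<in> fdom T \<alpha> \<inter> fdom T \<beta>.
           proj T z = proj T z' \<and> same_nonlinear T (fcoord T \<alpha> z) (fcoord T \<alpha> z') \<longrightarrow>
           same_nonlinear T (fcoord T \<beta> z) (fcoord T \<beta> z'))) \<and>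
     (\<forall>i. i \<notin> lin T \<longrightarrow> wdim T i = 0)"

definition matter_field ::
    "('c, 'm::topological_space, 'n::finite, 'e::topological_space, 'k::finite) field_theory \<Rightarrow>
     ('m \<Rightarrow> 'e) \<Rightarrow> bool" where
  "matter_field T \<phi> \<longleftrightarrow> continuous_on UNIV \<phi> \<and> (\<forall>p. proj T (\<phi> p) = p) \<and>
     (\<forall>\<alpha>\<in>atlas T. smooth_on (coord T \<alpha> ` {p. \<phi> p \<in> fdom T \<alpha>}) (fcoord T \<alpha> \<circ> \<phi> \<circ> cinv T \<alpha>))"


subsection \<open>Metric and frames\<close>

definition metric_comp :: "('c, 'm, 'n::finite) gravity \<Rightarrow> real^'n^'n \<Rightarrow> real^'n^'n" where
  "metric_comp G h = (case G of Metric \<Rightarrow> h | Frame \<eta> \<Lambda> \<Rightarrow> transpose h ** \<eta> ** h)"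

definition metric_of :: "('c, 'm, 'n::finite, 'e, 'k::finite) field_theory \<Rightarrow>
    ('c \<Rightarrow> 'm \<Rightarrow> real^'n^'n) \<Rightarrow> 'c \<Rightarrow> 'm \<Rightarrow> real^'n^'n" where
  "metric_of T h \<alpha> p = metric_comp (grav T) (h \<alpha> p)"

definition pseudo_riemannian_metric :: "('c, 'm, 'n::finite, 'e, 'k::finite) field_theory \<Rightarrow>
    ('c \<Rightarrow> 'm \<Rightarrow> real^'n^'n) \<Rightarrow> bool" where
  "pseudo_riemannian_metric T g \<longleftrightarrow> covariant_tensor2 T g \<and> symmetric_components T g \<and>
     (\<forall>\<alpha>\<in>atlas T. \<forall>p\<in>cdom T \<alpha>. det (g \<alpha> p) \<noteq> 0)"

definition frame_structure :: "('c, 'm, 'n::finite, 'e, 'k::finite) field_theory \<Rightarrow> bool" where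
  "frame_structure T \<longleftrightarrow> (case grav T of Metric \<Rightarrow> True | Frame \<eta> \<Lambda> \<Rightarrow>
     (\<forall>a b. (a \<noteq> b \<longrightarrow> \<eta> $ a $ b = 0) \<and> \<bar>\<eta> $ a $ a\<bar> = 1) \<and>
     (\<forall>\<alpha>\<in>atlas T. \<forall>\<beta>\<in>atlas T.
        smooth_on (coord T \<alpha> ` (cdom T \<alpha> \<inter> cdom T \<beta>)) (\<Lambda> \<alpha> \<beta> \<circ> cinv T \<alpha>) \<and>
        (\<forall>p \<in> cdom T \<alpha> \<inter> cdom T \<beta>. transpose (\<Lambda> \<alpha> \<beta> p) ** \<eta> ** \<Lambda> \<alpha> \<beta> p = \<eta>)))"

definition gravitational_field :: "('c, 'm, 'n::finite, 'e, 'k::finite) field_theory \<Rightarrow>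
    ('c \<Rightarrow> 'm \<Rightarrow> real^'n^'n) \<Rightarrow> bool" where
  "gravitational_field T h \<longleftrightarrow> pseudo_riemannian_metric T (metric_of T h) \<and>
     (case grav T of Metric \<Rightarrow> True | Frame \<eta> \<Lambda> \<Rightarrow> smooth_components T h \<and>
        (\<forall>\<alpha>\<in>atlas T. \<forall>\<beta>\<in>atlas T. \<forall>p \<in> cdom T \<alpha> \<inter> cdom T \<beta>.
           h \<alpha> p = \<Lambda> \<alpha> \<beta> p ** h \<beta> p ** jac T \<beta> \<alpha> p))"

text \<open>
  The variation of \<open>h\<close> implementing the variation \<open>\<delta>g\<^sub>\<mu>\<^sub>\<nu>\<close> of the metric; for frames this is
  \<open>\<delta>e\<^sup>a\<^sub>\<mu> = 1/2 \<eta>\<^sup>a\<^sup>b e\<^sup>\<nu>\<^sub>b \<delta>g\<^sub>\<mu>\<^sub>\<nu>\<close>.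
\<close>
definition grav_variation :: "('c, 'm, 'n::finite, 'e, 'k::finite) field_theory \<Rightarrow>
    ('c \<Rightarrow> 'm \<Rightarrow> real^'n^'n) \<Rightarrow> ('c \<Rightarrow> 'm \<Rightarrow> real^'n^'n) \<Rightarrow> 'c \<Rightarrow> 'm \<Rightarrow> real^'n^'n" where
  "grav_variation T \<delta>g h \<alpha> p = (case grav T of Metric \<Rightarrow> \<delta>g \<alpha> p | Frame \<eta> \<Lambda> \<Rightarrow>
     (1/2) *\<^sub>R (matrix_inv \<eta> ** transpose (matrix_inv (h \<alpha> p)) ** \<delta>g \<alpha> p))"

definition vary_grav :: "('c, 'm, 'n::finite, 'e, 'k::finite) field_theory \<Rightarrow>
    ('c \<Rightarrow> 'm \<Rightarrow> real^'n^'n) \<Rightarrow> real \<Rightarrow> ('c \<Rightarrow> 'm \<Rightarrow> real^'n^'n) \<Rightarrow> 'c \<Rightarrow> 'm \<Rightarrow> real^'n^'n" where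
  "vary_grav T \<delta>g t h \<alpha> p = h \<alpha> p + t *\<^sub>R grav_variation T \<delta>g h \<alpha> p"


subsection \<open>Lagrangian and action\<close>

definition jet_domain :: "('c, 'm, 'n::finite, 'e, 'k::finite) field_theory \<Rightarrow> 'c \<Rightarrow> ('n, 'k) jet set" where
  "jet_domain T \<alpha> = {(x, u, u1, h, h1, h2). (x, u) \<in> bcoord T \<alpha> ` fdom T \<alpha> \<and> det h \<noteq> 0}"

definition jet_of :: "('c, 'm, 'n::finite, 'e, 'k::finite) field_theory \<Rightarrow>
    ('c \<Rightarrow> 'm \<Rightarrow> real^'n^'n) \<Rightarrow> ('m \<Rightarrow> 'e) \<Rightarrow> 'c \<Rightarrow> 'm \<Rightarrow> ('n, 'k) jet" where
  "jet_of T h \<phi> \<alpha> p =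
     (coord T \<alpha> p,
      fcoord T \<alpha> (\<phi> p),
      (\<chi> i \<mu>. pdiff T \<alpha> \<mu> (fcoord T \<alpha> \<circ> \<phi>) p $ i),
      h \<alpha> p,
      (\<chi> \<rho>. pdiff T \<alpha> \<rho> (h \<alpha>) p),
      (\<chi> \<rho> \<sigma>. pdiff T \<alpha> \<rho> (pdiff T \<alpha> \<sigma> (h \<alpha>)) p))"

text \<open>
  The local expressions of \<open>L\<^sub>m\<close> in different charts define one scalar function on space-time.
\<close>
definition matter_lagrangian ::
    "('c, 'm::topological_space, 'n::finite, 'e::topological_space, 'k::finite) field_theory \<Rightarrow> bool" where
  "matter_lagrangian T \<longleftrightarrow>
     (\<forall>\<alpha>\<in>atlas T. smooth_on (jet_domain T \<alpha>) (lagr T \<alpha>)) \<and>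
     (\<forall>h \<phi>. gravitational_field T h \<and> matter_field T \<phi> \<longrightarrow>
        (\<forall>\<alpha>\<in>atlas T. \<forall>\<beta>\<in>atlas T. \<forall>p. \<phi> p \<in> fdom T \<alpha> \<inter> fdom T \<beta> \<longrightarrow>
           lagr T \<alpha> (jet_of T h \<phi> \<alpha> p) = lagr T \<beta> (jet_of T h \<phi> \<beta> p)))"

definition lagrangian_function :: "('c, 'm, 'n::finite, 'e, 'k::finite) field_theory \<Rightarrow>
    ('c \<Rightarrow> 'm \<Rightarrow> real^'n^'n) \<Rightarrow> ('m \<Rightarrow> 'e) \<Rightarrow> 'm \<Rightarrow> real" where
  "lagrangian_function T h \<phi> p =
     (let \<alpha> = (SOME \<alpha>. \<alpha> \<in> atlas T \<and> \<phi> p \<in> fdom T \<alpha>) in lagr T \<alpha> (jet_of T h \<phi> \<alpha> p))"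

definition action :: "('c, 'm::topological_space, 'n::finite, 'e, 'k::finite) field_theory \<Rightarrow> 'm set \<Rightarrow>
    ('c \<Rightarrow> 'm \<Rightarrow> real^'n^'n) \<Rightarrow> ('m \<Rightarrow> 'e) \<Rightarrow> real" where
  "action T K h \<phi> = (LINT p:K|volume T (metric_of T h). lagrangian_function T h \<phi> p)"

definition lagrangian_density :: "('c, 'm, 'n::finite, 'e, 'k::finite) field_theory \<Rightarrow> 'c \<Rightarrow>
    ('n, 'k) jet \<Rightarrow> real" where
  "lagrangian_density T \<alpha> j =
     (case j of (x, u, u1, h, h1, h2) \<Rightarrow> sqrt \<bar>det (metric_comp (grav T) h)\<bar> * lagr T \<alpha> j)"

text \<open>The variational derivative \<open>\<delta>L\<^sub>m/\<delta>\<phi>\<^sup>i\<close>, in the chart \<open>\<alpha>\<close>.\<close>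
definition euler_lagrange :: "('c, 'm, 'n::finite, 'e, 'k::finite) field_theory \<Rightarrow>
    ('c \<Rightarrow> 'm \<Rightarrow> real^'n^'n) \<Rightarrow> ('m \<Rightarrow> 'e) \<Rightarrow> 'c \<Rightarrow> 'k \<Rightarrow> 'm \<Rightarrow> real" where
  "euler_lagrange T h \<phi> \<alpha> i p =
     1 / sqrt \<bar>det (metric_of T h \<alpha> p)\<bar> *
     (frechet_derivative (lagrangian_density T \<alpha>) (at (jet_of T h \<phi> \<alpha> p))
        (0, axis i 1, 0, 0, 0, 0) -
      (\<Sum>\<mu>\<in>UNIV. pdiff T \<alpha> \<mu>
        (\<lambda>q. frechet_derivative (lagrangian_density T \<alpha>) (at (jet_of T h \<phi> \<alpha> q))
               (0, 0, axis i (axis \<mu> 1), 0, 0, 0)) p))"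

definition on_shell :: "('c, 'm, 'n::finite, 'e, 'k::finite) field_theory \<Rightarrow>
    ('c \<Rightarrow> 'm \<Rightarrow> real^'n^'n) \<Rightarrow> ('m \<Rightarrow> 'e) \<Rightarrow> bool" where
  "on_shell T h \<phi> \<longleftrightarrow>
     (\<forall>\<alpha>\<in>atlas T. \<forall>p i. \<phi> p \<in> fdom T \<alpha> \<longrightarrow> euler_lagrange T h \<phi> \<alpha> i p = 0)"


subsection \<open>Energy-momentum tensor and Weyl rescalings\<close>

text \<open>
  Symmetry is required because variations \<open>\<delta>g\<^sub>\<mu>\<^sub>\<nu>\<close> only determine the symmetric part.
\<close>
definition energy_momentum_tensor ::
    "('c, 'm::topological_space, 'n::finite, 'e, 'k::finite) field_theory \<Rightarrow>
     ('c \<Rightarrow> 'm \<Rightarrow> real^'n^'n) \<Rightarrow> ('m \<Rightarrow> 'e) \<Rightarrow> ('c \<Rightarrow> 'm \<Rightarrow> real^'n^'n) \<Rightarrow> bool" where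
  "energy_momentum_tensor T h \<phi> \<T> \<longleftrightarrow> contravariant_tensor2 T \<T> \<and> symmetric_components T \<T> \<and>
     (\<forall>K \<delta>g. compact K \<and> covariant_tensor2 T \<delta>g \<and> symmetric_components T \<delta>g \<and>
        tensor_support T \<delta>g \<subseteq> K \<longrightarrow>
        ((\<lambda>t. action T K (vary_grav T \<delta>g t h) \<phi>) has_real_derivative
          - (1/2) * (LINT p:K|volume T (metric_of T h). contraction T \<T> \<delta>g p)) (at 0))"

definition traceless :: "('c, 'm, 'n::finite, 'e, 'k::finite) field_theory \<Rightarrow>
    ('c \<Rightarrow> 'm \<Rightarrow> real^'n^'n) \<Rightarrow> ('c \<Rightarrow> 'm \<Rightarrow> real^'n^'n) \<Rightarrow> bool" where
  "traceless T g \<T> \<longleftrightarrow> (\<forall>\<alpha>\<in>atlas T. \<forall>p\<in>cdom T \<alpha>.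
     (\<Sum>\<mu>\<in>UNIV. \<Sum>\<nu>\<in>UNIV. g \<alpha> p $ \<mu> $ \<nu> * \<T> \<alpha> p $ \<mu> $ \<nu>) = 0)"

definition weyl_metric_variation :: "('c, 'm, 'n::finite, 'e, 'k::finite) field_theory \<Rightarrow>
    ('m \<Rightarrow> real) \<Rightarrow> ('c \<Rightarrow> 'm \<Rightarrow> real^'n^'n) \<Rightarrow> 'c \<Rightarrow> 'm \<Rightarrow> real^'n^'n" where
  "weyl_metric_variation T \<omega> h \<alpha> p = (2 * \<omega> p) *\<^sub>R metric_of T h \<alpha> p"

text \<open>
  The section with local components \<open>\<phi>\<^sup>i + t \<delta>\<^sub>\<omega>\<phi>\<^sup>i\<close>, where \<open>\<delta>\<^sub>\<omega>\<phi>\<^sup>i = - w\<^sub>i \<omega> \<phi>\<^sup>i\<close>.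
\<close>
definition weyl_vary_matter :: "('c, 'm, 'n::finite, 'e, 'k::finite) field_theory \<Rightarrow>
    ('m \<Rightarrow> real) \<Rightarrow> real \<Rightarrow> ('m \<Rightarrow> 'e) \<Rightarrow> 'm \<Rightarrow> 'e" where
  "weyl_vary_matter T \<omega> t \<phi> p =
     (let \<alpha> = (SOME \<alpha>. \<alpha> \<in> atlas T \<and> \<phi> p \<in> fdom T \<alpha>);
          u = fcoord T \<alpha> (\<phi> p)
      in THE z. z \<in> fdom T \<alpha> \<and> proj T z = p \<and>
           fcoord T \<alpha> z = (\<chi> i. u $ i + t * (- wdim T i * \<omega> p * u $ i)))"

text \<open>
  As in the definition of the energy-momentum tensor, the support of the variation is contained in
  the compact set; otherwise \<open>\<delta>\<^sub>\<omega>S\<^sub>K\<close> would contain boundary terms on \<open>\<partial>K\<close>.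
\<close>
definition weyl_invariant_at :: "('c, 'm::topological_space, 'n::finite, 'e, 'k::finite) field_theory \<Rightarrow>
    ('c \<Rightarrow> 'm \<Rightarrow> real^'n^'n) \<Rightarrow> ('m \<Rightarrow> 'e) \<Rightarrow> bool" where
  "weyl_invariant_at T h \<phi> \<longleftrightarrow>
     (\<forall>K \<omega>. compact K \<and> smooth_function T \<omega> \<and> closure {p. \<omega> p \<noteq> 0} \<subseteq> K \<longrightarrow>
        ((\<lambda>t. action T K (vary_grav T (weyl_metric_variation T \<omega> h) t h) (weyl_vary_matter T \<omega> t \<phi>))
          has_real_derivative 0) (at 0))"

definition on_shell_weyl_invariant ::
    "('c, 'm::topological_space, 'n::finite, 'e::topological_space, 'k::finite) field_theory \<Rightarrow> bool" where
  "on_shell_weyl_invariant T \<longleftrightarrow>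
     (\<forall>h \<phi>. gravitational_field T h \<and> matter_field T \<phi> \<and> on_shell T h \<phi> \<longrightarrow> weyl_invariant_at T h \<phi>)"

end

theory Submission
  imports Defs
begin

text \<open>
  Under a Weyl rescaling with compactly supported parameter \<open>\<omega>\<close>, the variation of the action splits
  into the one obtained by varying the metric alone, which is \<open>- \<integral> \<omega> g\<^sub>\<mu>\<^sub>\<nu> T\<^sup>\<mu>\<^sup>\<nu>\<close> by the definition of the
  energy-momentum tensor, and the one obtained by varying the matter fields. In a chart the latter
  has the integrand \<open>(\<delta>L/\<delta>\<phi>\<^sup>i) \<delta>\<^sub>\<omega>\<phi>\<^sup>i + \<partial>\<^sub>\<mu>V\<^sup>\<mu>\<close>, where \<open>V\<close> is linear in \<open>\<omega>\<close> and supported where \<open>\<omega>\<close> is; on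
  shell it integrates to 0 after \<open>\<omega>\<close> has been decomposed into functions supported in charts. Hence
  invariance for all \<open>\<omega>\<close> means that the continuous function \<open>g\<^sub>\<mu>\<^sub>\<nu> T\<^sup>\<mu>\<^sup>\<nu>\<close> integrates to 0 against all
  compactly supported \<open>\<omega>\<close>, i.e. vanishes.
\<close>

section \<open>Calculus of \<open>k\<close> times continuously differentiable maps\<close>

text \<open>The derivative of the action along the gravitational variation is supplied by
  \<open>energy_momentum_tensor\<close>, so nothing has to be computed about it. What is
  differentiated under the integral is only the difference of two actions with the same varied
  \<open>h\<close> and different matter fields. Along a Weyl variation \<open>h\<close> is
  multiplied pointwise by \<open>weyl_factor\<close>, for frames too, so both actions are integrals
  over the fixed volume with a common conformal factor. The difference quotient is then dominated by
  means of a local Lipschitz bound for \<open>lagr\<close>, made uniform over \<open>K\<close>.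
  Several global objects (\<open>volume\<close>, \<open>lagrangian_function\<close>,
  \<open>weyl_vary_matter\<close>, \<open>contraction\<close>) are defined by choosing a chart or by
  a uniqueness property, and each must be shown to have the expected expression in every chart. For
  the volume this takes the change of variables formula and a countable atlas, for the matter fields
  the fact that linear transition functions mix only components of equal Weyl dimension. The root of
  the determinant is treated as a C^1 function, which suffices because the momenta are
  differentiated once.\<close>

lemma has_derivative_cong_open:
  assumes "open S" "x \<in> S" "\<And>y. y \<in> S \<Longrightarrow> f y = g y"
  shows "(f has_derivative F) (at x) \<longleftrightarrow> (g has_derivative F) (at x)"
proof
  show "(g has_derivative F) (at x)" if "(f has_derivative F) (at x)"
    using that assms by (rule has_derivative_transform_within_open)
  show "(f has_derivative F) (at x)" if "(g has_derivative F) (at x)"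
    using that assms(1,2) assms(3)[symmetric] by (rule has_derivative_transform_within_open)
qed

lemma frechet_derivative_cong_open:
  assumes "open S" "x \<in> S" "\<And>y. y \<in> S \<Longrightarrow> f y = g y"
  shows "frechet_derivative f (at x) = frechet_derivative g (at x)"
  using has_derivative_cong_open[OF assms(1,2), of f g] assms(3) by (simp add: frechet_derivative_def)

lemma differentiable_cong_open:
  assumes "open S" "x \<in> S" "\<And>y. y \<in> S \<Longrightarrow> f y = g y"
  shows "f differentiable (at x) \<longleftrightarrow> g differentiable (at x)"
  using has_derivative_cong_open[OF assms(1,2), of f g] assms(3) by (simp add: differentiable_def)

lemma Ck_on_cong:
  assumes "open S" "\<And>x. x \<in> S \<Longrightarrow> f x = g x" "Ck_on k S f"
  shows "Ck_on k S g"
  using assms(2,3)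
proof (induction k arbitrary: f g)
  case 0
  then show ?case by (simp cong: continuous_on_cong)
next
  case (Suc k)
  have "Ck_on k S (\<lambda>x. frechet_derivative g (at x) v)" for v
  proof (rule Suc.IH)
    show "frechet_derivative f (at x) v = frechet_derivative g (at x) v" if "x \<in> S" for x
      using frechet_derivative_cong_open[OF assms(1) that Suc.prems(1)] by simp
  qed (use Suc.prems in auto)
  moreover have "g differentiable (at x)" if "x \<in> S" for x
    using differentiable_cong_open[OF assms(1) that, of f g] Suc.prems that by auto
  ultimately show ?case by simp
qed

lemma Ck_on_imp_continuous_on: "Ck_on k S f \<Longrightarrow> continuous_on S f"
  by (cases k) (auto intro!: differentiable_imp_continuous_on simp: differentiable_on_def differentiable_at_withinI)

lemma Ck_on_Suc_imp: "Ck_on (Suc k) S f \<Longrightarrow> Ck_on k S f"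
proof (induction k arbitrary: f)
  case 0
  then show ?case
    by (metis Ck_on.simps(1) Ck_on_imp_continuous_on)
next
  case (Suc k)
  have "Ck_on k S (\<lambda>x. frechet_derivative f (at x) v)" for v
    using Suc by (metis Ck_on.simps(2))
  then show ?case using Suc.prems by simp
qed

lemma Ck_on_subset: "Ck_on k S f \<Longrightarrow> T \<subseteq> S \<Longrightarrow> Ck_on k T f"
  by (induction k arbitrary: f) (auto intro: continuous_on_subset)

lemma Ck_on_local:
  assumes "\<And>x. x \<in> S \<Longrightarrow> \<exists>U. open U \<and> x \<in> U \<and> Ck_on k U f"
  shows "Ck_on k S f"
  using assms
proof (induction k arbitrary: f)
  case 0
  then show ?case
    by (metis Ck_on.simps(1) continuous_at_imp_continuous_on continuous_on_eq_continuous_at)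
next
  case (Suc k)
  have "f differentiable (at x)" if "x \<in> S" for x
    using Suc.prems[OF that] by auto
  moreover have "Ck_on k S (\<lambda>x. frechet_derivative f (at x) v)" for v
    by (rule Suc.IH) (use Suc.prems in fastforce)
  ultimately show ?case by simp
qed

text \<open>Lets an induction on \<open>k\<close> use any explicit formula \<open>F\<close> for the
  derivative in place of \<open>frechet_derivative\<close>; most closure lemmas below take their
  induction step this way.\<close>

lemma Ck_on_SucI:
  assumes "open S" "\<And>x. x \<in> S \<Longrightarrow> (f has_derivative F x) (at x)" "\<And>v. Ck_on k S (\<lambda>x. F x v)"
  shows "Ck_on (Suc k) S f"
proof -
  have eq: "F x = frechet_derivative f (at x)" if "x \<in> S" for x
    using frechet_derivative_at assms(2)[OF that] .
  have "Ck_on k S (\<lambda>x. frechet_derivative f (at x) v)" for v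
    by (rule Ck_on_cong[OF assms(1) _ assms(3)[of v]]) (use eq in auto)
  moreover have "f differentiable (at x)" if "x \<in> S" for x
    using assms(2)[OF that] by (auto simp: differentiable_def)
  ultimately show ?thesis by simp
qed

lemma Ck_on_SucD:
  assumes "Ck_on (Suc k) S f"
  shows "x \<in> S \<Longrightarrow> (f has_derivative frechet_derivative f (at x)) (at x)"
    and "Ck_on k S (\<lambda>x. frechet_derivative f (at x) v)"
  using assms frechet_derivative_works by auto

lemma Ck_on_const: "Ck_on k S (\<lambda>_. c)"
  by (induction k arbitrary: c) (auto simp: frechet_derivative_const)

lemma Ck_on_bounded_linear:
  assumes "bounded_linear L" "open S"
  shows "Ck_on k S L"
proof (cases k)
  case 0
  then show ?thesis using assms by (simp add: linear_continuous_on)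
next
  case (Suc m)
  have "Ck_on (Suc m) S L"
    by (rule Ck_on_SucI[OF assms(2), where F = "\<lambda>_. L"])
      (auto intro: bounded_linear_imp_has_derivative assms Ck_on_const)
  then show ?thesis using Suc by simp
qed

lemma Ck_on_linear_compose:
  assumes "bounded_linear L" "open S" "Ck_on k S f"
  shows "Ck_on k S (\<lambda>x. L (f x))"
  using assms(3)
proof (induction k arbitrary: f)
  case 0
  then show ?case
    using bounded_linear.continuous_on[OF assms(1)] by auto
next
  case (Suc k)
  show ?case
    by (rule Ck_on_SucI[OF assms(2), where F = "\<lambda>x v. L (frechet_derivative f (at x) v)"])
      (auto intro!: bounded_linear.has_derivative[OF assms(1)] Ck_on_SucD[OF Suc.prems] Suc.IH)
qed

lemma Ck_on_add:
  assumes "open S" "Ck_on k S f" "Ck_on k S g"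
  shows "Ck_on k S (\<lambda>x. f x + g x)"
  using assms(2,3)
proof (induction k arbitrary: f g)
  case 0
  then show ?case by (auto intro: continuous_intros)
next
  case (Suc k)
  show ?case
    by (rule Ck_on_SucI[OF assms(1), where F = "\<lambda>x v. frechet_derivative f (at x) v + frechet_derivative g (at x) v"])
      (auto intro!: has_derivative_add Ck_on_SucD[OF Suc.prems(1)] Ck_on_SucD[OF Suc.prems(2)] Suc.IH)
qed

lemma Ck_on_sum:
  assumes "open S" "\<And>i. i \<in> I \<Longrightarrow> Ck_on k S (f i)"
  shows "Ck_on k S (\<lambda>x. \<Sum>i\<in>I. f i x)"
  using assms(2)
proof (induction I rule: infinite_finite_induct)
  case (insert i I)
  have "Ck_on k S (\<lambda>x. f i x + (\<Sum>i\<in>I. f i x))"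
    by (intro Ck_on_add assms(1) insert.IH insert.prems) auto
  then show ?case using insert.hyps by simp
qed (simp_all add: Ck_on_const)

text \<open>The Leibniz rule gives two terms of the same bilinear shape, one factor differentiated
  and the other lowered from \<open>Suc k\<close> to \<open>k\<close>, so the induction closes.
  Scaling, products and inner products are instances.\<close>

lemma Ck_on_bilinear:
  assumes "bounded_bilinear B" "open S" "Ck_on k S f" "Ck_on k S g"
  shows "Ck_on k S (\<lambda>x. B (f x) (g x))"
  using assms(3,4)
proof (induction k arbitrary: f g)
  case 0
  then show ?case
    using bounded_bilinear.continuous_on[OF assms(1)] by auto
next
  case (Suc k)
  note f = Ck_on_SucD[OF Suc.prems(1)] and g = Ck_on_SucD[OF Suc.prems(2)]
  show ?case
  proof (rule Ck_on_SucI[OF assms(2), where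
          F = "\<lambda>x v. B (f x) (frechet_derivative g (at x) v) + B (frechet_derivative f (at x) v) (g x)"])
    show "((\<lambda>x. B (f x) (g x)) has_derivative
        (\<lambda>v. B (f x) (frechet_derivative g (at x) v) + B (frechet_derivative f (at x) v) (g x))) (at x)"
      if "x \<in> S" for x
      by (rule bounded_bilinear.FDERIV[OF assms(1) f(1)[OF that] g(1)[OF that]])
    show "Ck_on k S (\<lambda>x. B (f x) (frechet_derivative g (at x) v) + B (frechet_derivative f (at x) v) (g x))" for v
      by (rule Ck_on_add[OF assms(2)
            Suc.IH[OF Ck_on_Suc_imp[OF Suc.prems(1)] g(2)] Suc.IH[OF f(2) Ck_on_Suc_imp[OF Suc.prems(2)]]])
  qed
qed

lemmas Ck_on_scaleR = Ck_on_bilinear[OF bounded_bilinear_scaleR]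
lemmas Ck_on_mult = Ck_on_bilinear[OF bounded_bilinear_mult]

lemma Ck_on_prod:
  fixes f :: "'i \<Rightarrow> 'a::euclidean_space \<Rightarrow> real"
  assumes "open S" "\<And>i. i \<in> I \<Longrightarrow> Ck_on k S (f i)"
  shows "Ck_on k S (\<lambda>x. \<Prod>i\<in>I. f i x)"
  using assms(2)
proof (induction I rule: infinite_finite_induct)
  case (insert i I)
  have "Ck_on k S (\<lambda>x. f i x * (\<Prod>i\<in>I. f i x))"
    by (intro Ck_on_mult assms(1) insert.IH insert.prems) auto
  then show ?case using insert.hyps by simp
qed (simp_all add: Ck_on_const)

lemma linear_eq_sum_Basis:
  fixes L :: "'a::euclidean_space \<Rightarrow> 'b::real_vector"
  assumes lin: "linear L"
  shows "L v = (\<Sum>b\<in>Basis. (v \<bullet> b) *\<^sub>R L b)"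
proof -
  have "L v = L (\<Sum>b\<in>Basis. (v \<bullet> b) *\<^sub>R b)"
    by (simp add: euclidean_representation)
  also have "\<dots> = (\<Sum>b\<in>Basis. (v \<bullet> b) *\<^sub>R L b)"
    by (simp add: linear_sum[OF lin] linear_cmul[OF lin])
  finally show ?thesis .
qed

text \<open>\<open>Ck_on\<close> differentiates in fixed directions, whereas the chain rule
  evaluates the derivative of \<open>f\<close> in a direction that moves with \<open>x\<close>.
  Expanding this direction over \<open>Basis\<close> leaves derivatives of \<open>f\<close> in fixed
  directions, composed with \<open>g\<close>, to which the induction hypothesis applies.\<close>

lemma Ck_on_compose:
  fixes g :: "'a::euclidean_space \<Rightarrow> 'b::euclidean_space" and f :: "'b \<Rightarrow> 'c::real_normed_vector"
  assumes "open S" "open U" "g ` S \<subseteq> U" "Ck_on k U f" "Ck_on k S g"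
  shows "Ck_on k S (\<lambda>x. f (g x))"
  using assms(4,5)
proof (induction k arbitrary: f)
  case 0
  then show ?case using assms(3) by (auto intro: continuous_on_compose2)
next
  case (Suc k)
  define F where "F x v = (\<Sum>b\<in>Basis. (frechet_derivative g (at x) v \<bullet> b) *\<^sub>R frechet_derivative f (at (g x)) b)"
    for x v
  show ?case
  proof (rule Ck_on_SucI[OF assms(1), where F = F])
    fix x assume x: "x \<in> S"
    have "(f has_derivative frechet_derivative f (at (g x))) (at (g x))"
      by (rule Ck_on_SucD(1)[OF Suc.prems(1)]) (use x assms(3) in auto)
    from diff_chain_at[OF Ck_on_SucD(1)[OF Suc.prems(2) x] this]
    have *: "(f \<circ> g has_derivative frechet_derivative f (at (g x)) \<circ> frechet_derivative g (at x)) (at x)" .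
    have lin: "linear (frechet_derivative f (at (g x)))"
      by (rule linear_frechet_derivative) (use x assms(3) Suc.prems(1) in auto)
    have "frechet_derivative f (at (g x)) w = (\<Sum>b\<in>Basis. (w \<bullet> b) *\<^sub>R frechet_derivative f (at (g x)) b)" for w
      by (rule linear_eq_sum_Basis[OF lin])
    then have "frechet_derivative f (at (g x)) \<circ> frechet_derivative g (at x) = F x"
      unfolding F_def o_def by (intro ext)
    with * show "((\<lambda>x. f (g x)) has_derivative F x) (at x)"
      by (simp add: o_def)
  next
    fix v
    show "Ck_on k S (\<lambda>x. F x v)"
      unfolding F_def
      by (intro Ck_on_sum Ck_on_scaleR assms(1) Suc.IH Ck_on_linear_compose[OF bounded_linear_inner_left]
          Ck_on_SucD[OF Suc.prems(1)] Ck_on_SucD[OF Suc.prems(2)] Ck_on_Suc_imp[OF Suc.prems(2)])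
  qed
qed

text \<open>The derivative of \<open>inverse\<close> is a constant times a product of two copies of
  \<open>inverse\<close>, so the induction feeds on itself.\<close>

lemma Ck_on_inverse: "Ck_on k {0<..} (inverse :: real \<Rightarrow> real)"
proof (induction k)
  case 0
  then show ?case by (auto intro!: continuous_intros)
next
  case (Suc k)
  show ?case
  proof (rule Ck_on_SucI[where F = "\<lambda>x v. - (inverse x * v * inverse x)"])
    show "(inverse has_derivative (\<lambda>v. - (inverse x * v * inverse x))) (at x)" if "x \<in> {0<..}" for x :: real
      using has_derivative_inverse'[of x] that by auto
    show "Ck_on k {0<..} (\<lambda>x. - (inverse x * v * inverse x))" for v :: real
      by (rule Ck_on_cong[OF _ _ Ck_on_scaleR[OF _ Ck_on_const[of _ _ "-v"] Ck_on_mult[OF _ Suc Suc]]]) auto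
  qed auto
qed

lemma Ck_on_vec_lambda:
  fixes f :: "'n::finite \<Rightarrow> 'a::euclidean_space \<Rightarrow> 'b::euclidean_space"
  assumes "open S" "\<And>i. Ck_on k S (f i)"
  shows "Ck_on k S (\<lambda>x. \<chi> i. f i x)"
proof -
  have lin: "bounded_linear (\<lambda>y::'b. axis i y :: 'b^'n)" for i
    unfolding linear_conv_bounded_linear[symmetric] by (rule linearI) (auto simp: vec_eq_iff axis_def)
  have "Ck_on k S (\<lambda>x. \<Sum>i\<in>UNIV. axis i (f i x) :: 'b^'n)"
    by (intro Ck_on_sum Ck_on_linear_compose[OF lin] assms)
  moreover have "(\<Sum>i\<in>UNIV. axis i (f i x)) = (\<chi> i. f i x)" for x
    by (auto simp: vec_eq_iff axis_def if_distrib sum.delta cong: if_cong)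
  ultimately show ?thesis by simp
qed

lemma Ck_on_Pair:
  fixes f :: "'a::euclidean_space \<Rightarrow> 'b::euclidean_space" and g :: "'a \<Rightarrow> 'c::euclidean_space"
  assumes "open S" "Ck_on k S f" "Ck_on k S g"
  shows "Ck_on k S (\<lambda>x. (f x, g x))"
proof -
  have "Ck_on k S (\<lambda>x. (f x, 0) + (0, g x))"
    by (intro Ck_on_add Ck_on_linear_compose[of "\<lambda>y. (y, 0)"] Ck_on_linear_compose[of "\<lambda>y. (0, y)"] assms
        bounded_linear_Pair bounded_linear_ident bounded_linear_zero)
  then show ?thesis by simp
qed

lemma Ck_on_nth:
  fixes f :: "'a::euclidean_space \<Rightarrow> 'b::euclidean_space^'n::finite"
  assumes "open S" "Ck_on k S f"
  shows "Ck_on k S (\<lambda>x. f x $ i)"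
  by (rule Ck_on_linear_compose[OF bounded_linear_vec_nth assms])

lemma Ck_on_det:
  fixes f :: "'a::euclidean_space \<Rightarrow> real^'n^'n::finite"
  assumes "open S" "Ck_on k S f"
  shows "Ck_on k S (\<lambda>x. det (f x))"
  unfolding det_def
  by (intro Ck_on_sum Ck_on_mult Ck_on_prod Ck_on_const Ck_on_nth assms)

text \<open>Away from 0 the sign is locally constant, so the derivative is
  \<open>sgn x / (2 * sqrt \<bar>x\<bar>)\<close>. Both signs are covered because the determinant of
  a metric may be negative.\<close>

lemma C1_sqrt_abs: "Ck_on 1 (- {0}) (\<lambda>x. sqrt \<bar>x\<bar>)"
proof -
  have "Ck_on (Suc 0) (- {0}) (\<lambda>x. sqrt \<bar>x\<bar>)"
  proof (rule Ck_on_SucI[where F = "\<lambda>x v. (sgn x / (2 * sqrt \<bar>x\<bar>)) * v"])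
    fix x :: real assume x: "x \<in> - {0}"
    have "(abs has_real_derivative sgn x) (at x)"
    proof (cases "0 < x")
      case True
      then show ?thesis
        using has_field_derivative_transform_within_open[OF DERIV_ident open_greaterThan[of 0], of x abs]
        by auto
    next
      case False
      then show ?thesis
        using has_field_derivative_transform_within_open[OF DERIV_minus[OF DERIV_ident] open_lessThan[of 0], of x abs] x
        by auto
    qed
    then have "((\<lambda>x. sqrt \<bar>x\<bar>) has_real_derivative (inverse (sqrt \<bar>x\<bar>) / 2 * sgn x)) (at x)"
      by (intro DERIV_chain2[OF DERIV_real_sqrt]) (use x in auto)
    moreover have "inverse (sqrt \<bar>x\<bar>) / 2 * sgn x = sgn x / (2 * sqrt \<bar>x\<bar>)"
      by (simp add: field_simps)
    ultimately show "((\<lambda>x. sqrt \<bar>x\<bar>) has_derivative (*) (sgn x / (2 * sqrt \<bar>x\<bar>))) (at x)"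
      by (simp only: has_field_derivative_def)
  next
    show "Ck_on 0 (- {0}) (\<lambda>x. sgn x / (2 * sqrt \<bar>x\<bar>) * v)" for v :: real
      by (auto intro!: continuous_intros)
  qed auto
  then show ?thesis by simp
qed

section \<open>Closure properties of smooth maps\<close>

lemma smooth_onD: "smooth_on S f \<Longrightarrow> Ck_on k S f"
  by (simp add: smooth_on_def)

lemma smooth_on_imp_continuous_on: "smooth_on S f \<Longrightarrow> continuous_on S f"
  using Ck_on_imp_continuous_on smooth_onD by blast

lemma smooth_on_frechet_derivative:
  "smooth_on S f \<Longrightarrow> smooth_on S (\<lambda>x. frechet_derivative f (at x) v)"
  unfolding smooth_on_def by (metis Ck_on.simps(2))

lemma smooth_on_has_derivative:
  "smooth_on S f \<Longrightarrow> x \<in> S \<Longrightarrow> (f has_derivative frechet_derivative f (at x)) (at x)"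
  using Ck_on_SucD(1) smooth_onD by blast

lemma smooth_on_cong:
  "open S \<Longrightarrow> (\<And>x. x \<in> S \<Longrightarrow> f x = g x) \<Longrightarrow> smooth_on S f \<Longrightarrow> smooth_on S g"
  unfolding smooth_on_def using Ck_on_cong by blast

lemma smooth_on_subset: "smooth_on S f \<Longrightarrow> T \<subseteq> S \<Longrightarrow> smooth_on T f"
  unfolding smooth_on_def using Ck_on_subset by blast

lemma smooth_on_local:
  assumes "\<And>x. x \<in> S \<Longrightarrow> \<exists>U. open U \<and> x \<in> U \<and> smooth_on U f"
  shows "smooth_on S f"
  unfolding smooth_on_def by (meson Ck_on_local assms smooth_onD)

lemma smooth_on_scaleR:
  "open S \<Longrightarrow> smooth_on S f \<Longrightarrow> smooth_on S g \<Longrightarrow> smooth_on S (\<lambda>x. f x *\<^sub>R g x)"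
  unfolding smooth_on_def by (simp add: Ck_on_scaleR)

lemma smooth_on_mult:
  fixes f g :: "'a::euclidean_space \<Rightarrow> real"
  shows "open S \<Longrightarrow> smooth_on S f \<Longrightarrow> smooth_on S g \<Longrightarrow> smooth_on S (\<lambda>x. f x * g x)"
  unfolding smooth_on_def by (simp add: Ck_on_mult)

lemma smooth_on_add:
  "open S \<Longrightarrow> smooth_on S f \<Longrightarrow> smooth_on S g \<Longrightarrow> smooth_on S (\<lambda>x. f x + g x)"
  unfolding smooth_on_def by (simp add: Ck_on_add)

lemma smooth_on_const: "smooth_on S (\<lambda>_. c)"
  unfolding smooth_on_def by (simp add: Ck_on_const)

lemma smooth_on_sum:
  "open S \<Longrightarrow> (\<And>i. i \<in> I \<Longrightarrow> smooth_on S (f i)) \<Longrightarrow> smooth_on S (\<lambda>x. \<Sum>i\<in>I. f i x)"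
  unfolding smooth_on_def by (simp add: Ck_on_sum)

lemma smooth_on_compose:
  fixes g :: "'a::euclidean_space \<Rightarrow> 'b::euclidean_space"
  assumes "open S" "open U" "g ` S \<subseteq> U" "smooth_on U f" "smooth_on S g"
  shows "smooth_on S (\<lambda>x. f (g x))"
  unfolding smooth_on_def by (rule allI, rule Ck_on_compose[OF assms(1-3) smooth_onD[OF assms(4)] smooth_onD[OF assms(5)]])

lemma smooth_on_vec_lambda:
  fixes f :: "'n::finite \<Rightarrow> 'a::euclidean_space \<Rightarrow> 'b::euclidean_space"
  shows "open S \<Longrightarrow> (\<And>i. smooth_on S (f i)) \<Longrightarrow> smooth_on S (\<lambda>x. \<chi> i. f i x)"
  unfolding smooth_on_def by (simp add: Ck_on_vec_lambda)

lemma smooth_on_nth: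
  fixes f :: "'a::euclidean_space \<Rightarrow> 'b::euclidean_space^'n::finite"
  shows "open S \<Longrightarrow> smooth_on S f \<Longrightarrow> smooth_on S (\<lambda>x. f x $ i)"
  unfolding smooth_on_def by (simp add: Ck_on_nth)

lemma smooth_on_inverse:
  fixes f :: "'a::euclidean_space \<Rightarrow> real"
  assumes "open S" "smooth_on S f" "\<And>x. x \<in> S \<Longrightarrow> 0 < f x"
  shows "smooth_on S (\<lambda>x. inverse (f x))"
  unfolding smooth_on_def
  by (rule allI, rule Ck_on_compose[OF assms(1) open_greaterThan _ Ck_on_inverse smooth_onD[OF assms(2)]])
    (use assms(3) in auto)


section \<open>Bump functions\<close>

text \<open>The power \<open>m\<close> makes the family closed under differentiation;
  \<open>m = 0\<close> is the classical flat function \<open>exp (- 1 / x)\<close>.\<close>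

definition flat_exp :: "nat \<Rightarrow> real \<Rightarrow> real" where
  "flat_exp m x = (if 0 < x then inverse x ^ m * exp (- inverse x) else 0)"

lemma flat_exp_tendsto_0: "((\<lambda>x. inverse x ^ m * exp (- inverse x)) \<longlongrightarrow> 0) (at_right (0::real))"
proof -
  have "((\<lambda>y. y ^ m / exp y) \<longlongrightarrow> 0) (at_top :: real filter)"
    by (rule tendsto_power_div_exp_0)
  from filterlim_compose[OF this filterlim_inverse_at_top_right]
  show ?thesis by (simp add: exp_minus field_simps)
qed

text \<open>The derivative is a combination of members of the same family, which gives smoothness by
  induction. At the origin the difference quotient from the right is
  \<open>flat_exp (m + 1)\<close>, which tends to 0 because the exponential beats every
  power.\<close>

lemma flat_exp_DERIV: "(flat_exp m has_real_derivative (flat_exp (m + 2) x - m * flat_exp (m + 1) x)) (at x)"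
proof (cases x "0::real" rule: linorder_cases)
  case less
  have "((\<lambda>_. 0) has_real_derivative 0) (at x)" by simp
  then have "(flat_exp m has_real_derivative 0) (at x)"
    by (rule has_field_derivative_transform_within_open[where S = "{..<0}"]) (use less in \<open>auto simp: flat_exp_def\<close>)
  then show ?thesis using less by (simp add: flat_exp_def)
next
  case greater
  have "((\<lambda>x. inverse x ^ m * exp (- inverse x)) has_real_derivative
      (inverse x ^ m * (exp (- inverse x) * inverse x ^ 2) +
       (of_nat m * (- (inverse x ^ 2)) * inverse x ^ (m - 1)) * exp (- inverse x))) (at x)"
    using greater by (auto intro!: derivative_eq_intros simp: power2_eq_square)
  moreover have "(inverse x ^ m * (exp (- inverse x) * inverse x ^ 2) +
       (of_nat m * (- (inverse x ^ 2)) * inverse x ^ (m - 1)) * exp (- inverse x)) =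
     flat_exp (m + 2) x - m * flat_exp (m + 1) x"
    using greater by (cases m) (auto simp: flat_exp_def power2_eq_square power_add algebra_simps)
  ultimately have "((\<lambda>x. inverse x ^ m * exp (- inverse x)) has_real_derivative
      (flat_exp (m + 2) x - m * flat_exp (m + 1) x)) (at x)" by simp
  then show ?thesis
    by (rule has_field_derivative_transform_within_open[where S = "{0<..}"]) (use greater in \<open>auto simp: flat_exp_def\<close>)
next
  case equal
  have "((\<lambda>h. flat_exp m h / h) \<longlongrightarrow> 0) (at 0)"
  proof (rule filterlim_split_at)
    show "((\<lambda>h. flat_exp m h / h) \<longlongrightarrow> 0) (at_left 0)"
      by (rule Lim_transform_eventually[OF tendsto_const])
        (auto simp: eventually_at_filter flat_exp_def intro!: always_eventually)
    have "eventually (\<lambda>h. inverse h ^ (m + 1) * exp (- inverse h) = flat_exp m h / h) (at_right (0::real))"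
      by (auto simp: eventually_at_filter flat_exp_def field_simps intro!: always_eventually)
    then show "((\<lambda>h. flat_exp m h / h) \<longlongrightarrow> 0) (at_right 0)"
      by (rule Lim_transform_eventually[OF flat_exp_tendsto_0])
  qed
  then show ?thesis
    using equal by (simp add: has_field_derivative_iff flat_exp_def)
qed

lemma Ck_on_flat_exp: "Ck_on k UNIV (flat_exp m)"
proof (induction k arbitrary: m)
  case 0
  show ?case
    using DERIV_isCont[OF flat_exp_DERIV] by (auto intro: continuous_at_imp_continuous_on)
next
  case (Suc k)
  show ?case
  proof (rule Ck_on_SucI[where F = "\<lambda>x v. (flat_exp (m + 2) x - m * flat_exp (m + 1) x) * v"])
    show "(flat_exp m has_derivative (*) (flat_exp (m + 2) x - m * flat_exp (m + 1) x)) (at x)" for x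
      using flat_exp_DERIV[of m x] by (simp add: has_field_derivative_def)
    show "Ck_on k UNIV (\<lambda>x. (flat_exp (m + 2) x - m * flat_exp (m + 1) x) * v)" for v
      by (rule Ck_on_cong[OF _ _ Ck_on_add[OF _
              Ck_on_mult[OF _ Ck_on_const[of _ _ v] Suc[of "m + 2"]]
              Ck_on_mult[OF _ Ck_on_const[of _ _ "- m * v"] Suc[of "m + 1"]]]])
        (auto simp: algebra_simps)
  qed auto
qed

text \<open>The squared distance is used because, unlike the distance, it is smooth at the centre;
  for \<open>r > 0\<close> the value is positive exactly on the open ball.\<close>

definition bump :: "'a::euclidean_space \<Rightarrow> real \<Rightarrow> 'a \<Rightarrow> real" where
  "bump a r x = flat_exp 0 (r\<^sup>2 - (x - a) \<bullet> (x - a))"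

lemma smooth_on_bump: "smooth_on UNIV (bump a r)"
proof -
  have "Ck_on k UNIV (\<lambda>x. r\<^sup>2 - (x - a) \<bullet> (x - a))" for k
  proof -
    have d: "Ck_on k UNIV (\<lambda>x. x + (- a))"
      by (intro Ck_on_add Ck_on_const Ck_on_bounded_linear bounded_linear_ident) auto
    have "Ck_on k UNIV (\<lambda>x. r\<^sup>2 + (-1) *\<^sub>R ((x + (- a)) \<bullet> (x + (- a))))"
      by (intro Ck_on_add Ck_on_const Ck_on_scaleR Ck_on_bilinear[OF bounded_bilinear_inner] d) auto
    then show ?thesis by simp
  qed
  from Ck_on_compose[OF open_UNIV open_UNIV subset_UNIV Ck_on_flat_exp this]
  show ?thesis
    unfolding smooth_on_def bump_def by (rule allI)
qed

lemma bump_nonneg: "0 \<le> bump a r x"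
  by (simp add: bump_def flat_exp_def)

lemma bump_pos_iff: 
  assumes "0 < r"
  shows "0 < bump a r x \<longleftrightarrow> x \<in> ball a r"
proof -
  have "(norm (x - a))\<^sup>2 < r\<^sup>2 \<longleftrightarrow> norm (x - a) < r"
    using assms by (metis norm_ge_zero less_eq_real_def power2_less_imp_less power_strict_mono zero_less_numeral)
  then show ?thesis
    by (simp add: bump_def flat_exp_def dist_norm norm_minus_commute[of a x] flip: power2_norm_eq_inner)
qed

lemma bump_eq_0_iff: "0 < r \<Longrightarrow> bump a r x = 0 \<longleftrightarrow> x \<notin> ball a r"
  using bump_pos_iff[of r a x] bump_nonneg[of a r x] by linarith


section \<open>Change of variables for nonnegative integrals\<close>

text \<open>
  The change of variables theorem of the library requires a well-ordered index type. An arbitrary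
  finite index type is given a well-ordered copy.
\<close>
typedef 'a ordered = "UNIV :: 'a set"
  morphisms base_of Ordered ..

text \<open>Any injection into the naturals gives a well-order on the copy by pulling back; no
  particular numbering is meant.\<close>

definition enumerate_type :: "'a::finite \<Rightarrow> nat" where
  "enumerate_type = (SOME f. inj f)"

lemma inj_enumerate_type: "inj enumerate_type"
proof -
  have "\<exists>f :: 'a \<Rightarrow> nat. inj f"
    using finite_imp_inj_to_nat_seg[of "UNIV :: 'a set"] by auto
  then show ?thesis
    unfolding enumerate_type_def by (rule someI_ex)
qed

instantiation ordered :: (finite) wellorder
begin

definition less_eq_ordered :: "'a ordered \<Rightarrow> 'a ordered \<Rightarrow> bool" where
  "x \<le> y \<longleftrightarrow> enumerate_type (base_of x) \<le> enumerate_type (base_of y)"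

definition less_ordered :: "'a ordered \<Rightarrow> 'a ordered \<Rightarrow> bool" where
  "x < y \<longleftrightarrow> enumerate_type (base_of x) < enumerate_type (base_of y)"

instance
proof
  fix x y :: "'a ordered"
  show "x = y" if "x \<le> y" "y \<le> x"
    using that inj_enumerate_type by (auto simp: less_eq_ordered_def base_of_inject dest!: antisym injD)
next
  fix P :: "'a ordered \<Rightarrow> bool" and a
  assume step: "\<And>x. (\<And>y. y < x \<Longrightarrow> P y) \<Longrightarrow> P x"
  show "P a"
    by (induction "enumerate_type (base_of a)" arbitrary: a rule: less_induct)
      (auto simp: less_ordered_def intro: step)
qed (auto simp: less_eq_ordered_def less_ordered_def)

end

lemma all_ordered: "(\<forall>i. Q i) \<longleftrightarrow> (\<forall>j. Q (Ordered j))"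
  by (metis base_of_inverse)

lemma bij_base_of: "bij base_of"
  by (metis Ordered_inverse UNIV_I base_of_inverse bij_iff)

instance ordered :: (finite) finite
proof
  have "range (Ordered :: 'a \<Rightarrow> _) = UNIV"
    by (metis Ordered_inverse UNIV_I base_of_inverse surjI)
  then show "finite (UNIV :: 'a ordered set)"
    by (metis finite finite_imageI)
qed

text \<open>Conjugation with \<open>f\<close> is a sign-preserving bijection between the
  permutations of the two index types, so the two Leibniz sums agree term by term.\<close>

lemma det_reindex:
  fixes A :: "real^'n::finite^'n" and f :: "'m::finite \<Rightarrow> 'n"
  assumes "bij f"
  shows "det (\<chi> i j. A $ f i $ f j) = det A"
proof -
  have f: "bij_betw f UNIV UNIV" "inj f" and f': "bij_betw (inv f) UNIV UNIV"
    using assms bij_imp_bij_inv bij_is_inj by auto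
  show ?thesis
    unfolding det_def
  proof (rule sum.reindex_bij_witness[where i = "map_permutation UNIV (inv f)" and j = "map_permutation UNIV f"];
      (unfold mem_Collect_eq)?)
    fix p :: "'m \<Rightarrow> 'm" assume p: "p permutes UNIV"
    show "map_permutation UNIV (inv f) (map_permutation UNIV f p) = p"
      by (rule map_permutation_compose_inv[OF f(1) p]) (simp add: f(2))
    show "map_permutation UNIV f p permutes UNIV"
      by (rule map_permutation_permutes[OF f(1) p])
    have "(\<Prod>i\<in>UNIV. A $ i $ map_permutation UNIV f p i) =
        (\<Prod>k\<in>UNIV. A $ f k $ map_permutation UNIV f p (f k))"
      by (rule prod.reindex_bij_betw[OF f(1), symmetric])
    also have "\<dots> = (\<Prod>k\<in>UNIV. (\<chi> i j. A $ f i $ f j) $ k $ p k)"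
      by (simp add: map_permutation_apply[OF f(2)])
    finally show "of_int (sign (map_permutation UNIV f p)) * (\<Prod>i\<in>UNIV. A $ i $ map_permutation UNIV f p i) =
        of_int (sign p) * (\<Prod>i\<in>UNIV. (\<chi> i j. A $ f i $ f j) $ i $ p i)"
      by (simp add: sign_map_permutation[OF f(2) p])
  next
    fix q :: "'n \<Rightarrow> 'n" assume q: "q permutes UNIV"
    show "map_permutation UNIV f (map_permutation UNIV (inv f) q) = q"
      by (rule map_permutation_compose_inv[OF f' q]) (simp add: assms bij_is_surj surj_f_inv_f)
    show "map_permutation UNIV (inv f) q permutes UNIV"
      by (rule map_permutation_permutes[OF f' q])
  qed
qed

definition relabel :: "real^'n::finite \<Rightarrow> real^'n ordered" where
  "relabel x = (\<chi> i. x $ base_of i)"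

definition unlabel :: "real^'n ordered \<Rightarrow> real^'n::finite" where
  "unlabel y = (\<chi> i. y $ Ordered i)"

lemma unlabel_relabel [simp]: "unlabel (relabel x) = x"
  by (simp add: relabel_def unlabel_def vec_eq_iff Ordered_inverse)

lemma relabel_unlabel [simp]: "relabel (unlabel y) = y"
  by (simp add: relabel_def unlabel_def vec_eq_iff base_of_inverse)

lemma bounded_linear_relabel: "bounded_linear relabel"
  unfolding linear_conv_bounded_linear[symmetric]
  by (rule linearI) (auto simp: vec_eq_iff relabel_def)

lemma bounded_linear_unlabel: "bounded_linear unlabel"
  unfolding linear_conv_bounded_linear[symmetric]
  by (rule linearI) (auto simp: vec_eq_iff unlabel_def)

lemma relabel_measurable [measurable]: "relabel \<in> borel_measurable borel"
  by (intro borel_measurable_continuous_onI linear_continuous_on bounded_linear_relabel)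

lemma unlabel_measurable [measurable]: "unlabel \<in> borel_measurable borel"
  by (intro borel_measurable_continuous_onI linear_continuous_on bounded_linear_unlabel)

lemma prod_Basis_cart: "(\<Prod>b\<in>Basis. v \<bullet> b) = (\<Prod>i\<in>UNIV. v $ i)" for v :: "real^'n::finite"
proof -
  have B: "Basis = range (\<lambda>i. axis i 1 :: real^'n)"
    by (auto simp: Basis_vec_def)
  have "inj (\<lambda>i. axis i 1 :: real^'n)"
    by (auto simp: inj_on_def axis_eq_axis)
  then show ?thesis
    unfolding B by (subst prod.reindex) (auto simp: inner_axis)
qed

text \<open>Lebesgue measure is characterised by its values on boxes, and relabelling the
  coordinates turns a box into a box with the same edge lengths.\<close>

lemma distr_relabel: "distr lborel borel (relabel :: real^'n::finite \<Rightarrow> _) = lborel"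
proof (rule lborel_eqI[symmetric])
  fix l u :: "real^'n ordered" assume lu: "\<And>b. b \<in> Basis \<Longrightarrow> l \<bullet> b \<le> u \<bullet> b"
  have le: "l $ i \<le> u $ i" for i
    using lu[of "axis i 1"] by (simp add: inner_axis axis_in_Basis_iff)
  have "relabel -` box l u = box (unlabel l) (unlabel u)"
    by (auto simp: mem_box_cart relabel_def unlabel_def all_ordered Ordered_inverse)
  then have "emeasure (distr lborel borel relabel) (box l u) = emeasure lborel (box (unlabel l) (unlabel u))"
    by (subst emeasure_distr) auto
  also have "\<dots> = (\<Prod>b\<in>Basis. (unlabel u - unlabel l) \<bullet> b)"
    by (rule emeasure_lborel_box) (auto simp: Basis_vec_def inner_axis unlabel_def le)
  also have "\<dots> = (\<Prod>b\<in>Basis. (u - l) \<bullet> b)"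
    unfolding prod_Basis_cart
    by (subst prod.reindex_bij_betw[OF bij_base_of, symmetric]) (simp add: unlabel_def base_of_inverse)
  finally show "emeasure (distr lborel borel relabel) (box l u) = (\<Prod>b\<in>Basis. (u - l) \<bullet> b)" .
qed simp

text \<open>The matrix of the conjugated map is the old one with both indices renamed by
  \<open>base_of\<close>.\<close>

lemma det_matrix_relabel:
  fixes L :: "real^'n::finite \<Rightarrow> real^'n"
  shows "det (matrix (relabel \<circ> L \<circ> unlabel)) = det (matrix L)"
proof -
  have ax: "unlabel (axis j 1) = axis (base_of j) 1" for j :: "'n ordered"
    by (auto simp: vec_eq_iff unlabel_def axis_def Ordered_inverse base_of_inverse)
  have "matrix (relabel \<circ> L \<circ> unlabel) = (\<chi> i j. matrix L $ base_of i $ base_of j)"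
    by (simp add: matrix_def relabel_def ax)
  then show ?thesis
    by (simp add: det_reindex[OF bij_base_of])
qed

text \<open>The change of variables theorem invoked here speaks about absolutely integrable
  functions, while these nonnegative integrals may be infinite. \<open>S\<close> is therefore cut
  into countably many bounded pieces on which the transformed integrand is bounded, and the results
  are summed.\<close>

lemma nn_integral_change_of_variables_wellorder:
  fixes g :: "real^'n::{finite,wellorder} \<Rightarrow> real^'n::_" and f :: "real^'n::_ \<Rightarrow> real"
  assumes S: "S \<in> sets borel"
    and der: "\<And>x. x \<in> S \<Longrightarrow> (g has_derivative g' x) (at x)"
    and inj: "inj_on g S"
    and nonneg: "\<And>y. 0 \<le> f y"
    and meas: "(\<lambda>x. indicator S x * (\<bar>det (matrix (g' x))\<bar> * f (g x))) \<in> borel_measurable borel"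
  shows "(\<integral>\<^sup>+y. ennreal (f y) * indicator (g ` S) y \<partial>lborel) =
    (\<integral>\<^sup>+x. ennreal (\<bar>det (matrix (g' x))\<bar> * f (g x)) * indicator S x \<partial>lborel)"
proof -
  define h where "h x = indicator S x * (\<bar>det (matrix (g' x))\<bar> * f (g x))" for x
  have h[measurable]: "h \<in> borel_measurable borel" using meas by (simp add: h_def[abs_def])
  have h0: "0 \<le> h x" for x using nonneg by (simp add: h_def)
  \<comment> \<open>On \<open>P m\<close> the sum \<open>norm x + h x\<close> is below
    \<open>m + 1\<close>; this single bound makes the piece bounded and the integrand integrable on
    it.\<close>
  define P where "P m = {x \<in> S. nat \<lfloor>norm x + h x\<rfloor> = m}" for m
  have P[measurable]: "P m \<in> sets borel" for m
    unfolding P_def using S by measurable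
  have PS: "P m \<subseteq> S" for m by (auto simp: P_def)
  have un: "(\<Union>m. P m) = S" by (auto simp: P_def)
  have disj: "disjoint_family P" by (auto simp: disjoint_family_on_def P_def)
  have disj': "disjoint_family (\<lambda>m. g ` P m)"
    using disj inj PS unfolding disjoint_family_on_def by (auto dest!: inj_onD)
  \<comment> \<open>On the image of a piece the integrand is obtained as measurable with respect to
    \<open>lebesgue\<close>; nonnegative integrals over it agree with those over
    \<open>lborel\<close>.\<close>
  have piece: "(\<lambda>y. ennreal (f y) * indicator (g ` P m) y) \<in> borel_measurable lebesgue \<and>
     (\<integral>\<^sup>+y. ennreal (f y) * indicator (g ` P m) y \<partial>lebesgue) =
     (\<integral>\<^sup>+x. ennreal (h x) * indicator (P m) x \<partial>lebesgue)" for m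
  proof -
    have bnd: "norm x + h x < real (m + 1)" if "x \<in> P m" for x
    proof -
      have "norm x + h x < real_of_int \<lfloor>norm x + h x\<rfloor> + 1" by linarith
      also have "\<dots> = real (nat \<lfloor>norm x + h x\<rfloor>) + 1" using h0[of x] by simp
      finally show ?thesis using that by (simp add: P_def)
    qed
    have bdd: "bounded (P m)"
    proof (rule boundedI)
      fix x assume "x \<in> P m"
      then show "norm x \<le> real (m + 1)" using bnd[of x] h0[of x] by linarith
    qed
    have lm: "P m \<in> lmeasurable"
      using bdd P by (intro bounded_set_imp_lmeasurable) auto
    \<comment> \<open>The invoked theorem is about vector-valued functions, so \<open>f\<close> is
      regarded as a function with values in \<open>real^1\<close>.\<close>
    have "(\<lambda>x. \<bar>det (matrix (g' x))\<bar> *\<^sub>R (vec (f (g x)) :: real^1)) absolutely_integrable_on P m \<longleftrightarrow>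
        (\<lambda>x. h x) absolutely_integrable_on P m"
    proof -
      have "(\<lambda>x. \<bar>det (matrix (g' x))\<bar> *\<^sub>R (vec (f (g x)) :: real^1)) absolutely_integrable_on P m \<longleftrightarrow>
        (\<lambda>x. vec (h x) :: real^1) absolutely_integrable_on P m"
        by (rule set_integrable_cong) (use PS[of m] in \<open>auto simp: h_def vec_eq_iff subset_iff indicator_def\<close>)
      then show ?thesis by (simp add: absolutely_integrable_on_1_iff)
    qed
    moreover have hint: "h absolutely_integrable_on P m"
    proof (rule measurable_bounded_by_integrable_imp_absolutely_integrable)
      show "h \<in> borel_measurable (lebesgue_on (P m))"
        by (intro measurable_restrict_space1 measurable_completion) simp
      show "(\<lambda>x. real (m + 1)) integrable_on P m"
        using lm by (simp add: integrable_on_const)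
      show "norm (h x) \<le> real (m + 1)" if "x \<in> P m" for x
        unfolding real_norm_def using bnd[OF that] h0[of x] norm_ge_zero[of x] by linarith
    qed (use lm in auto)
    ultimately have "(\<lambda>x. \<bar>det (matrix (g' x))\<bar> *\<^sub>R (vec (f (g x)) :: real^1)) absolutely_integrable_on P m"
      by simp
    then have "(\<lambda>y. vec (f y) :: real^1) absolutely_integrable_on g ` P m \<and>
        integral (g ` P m) (\<lambda>y. vec (f y) :: real^1) =
        integral (P m) (\<lambda>x. \<bar>det (matrix (g' x))\<bar> *\<^sub>R (vec (f (g x)) :: real^1))"
      by (subst has_absolute_integral_change_of_variables[symmetric, where g' = g'])
        (use lm inj PS der in \<open>auto intro: has_derivative_at_withinI inj_on_subset\<close>)
    moreover have "integral (P m) (\<lambda>x. \<bar>det (matrix (g' x))\<bar> *\<^sub>R (vec (f (g x)) :: real^1)) =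
        integral (P m) (\<lambda>x. vec (h x))"
      by (rule integral_cong) (use PS[of m] in \<open>auto simp: h_def vec_eq_iff subset_iff indicator_def\<close>)
    ultimately have f: "f absolutely_integrable_on g ` P m" and eq: "integral (g ` P m) f = integral (P m) h"
      using hint by (auto simp: absolutely_integrable_on_1_iff integral_on_1_eq vec_eq_iff)
    have "(\<integral>\<^sup>+y. ennreal (f y) * indicator (g ` P m) y \<partial>lebesgue) =
        (\<integral>\<^sup>+y. ennreal (indicator (g ` P m) y *\<^sub>R f y) \<partial>lebesgue)"
      by (intro nn_integral_cong) (auto simp: indicator_def)
    also have "\<dots> = ennreal (LINT y:g ` P m|lebesgue. f y)"
      using f nonneg unfolding set_integrable_def set_lebesgue_integral_def
      by (intro nn_integral_eq_integral) auto
    also have "\<dots> = ennreal (LINT x:P m|lebesgue. h x)"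
      using eq by (simp add: set_lebesgue_integral_eq_integral f hint)
    also have "\<dots> = (\<integral>\<^sup>+x. ennreal (indicator (P m) x *\<^sub>R h x) \<partial>lebesgue)"
      using hint h0 unfolding set_integrable_def set_lebesgue_integral_def
      by (intro nn_integral_eq_integral[symmetric]) auto
    also have "\<dots> = (\<integral>\<^sup>+x. ennreal (h x) * indicator (P m) x \<partial>lebesgue)"
      by (intro nn_integral_cong) (auto simp: indicator_def)
    finally have "(\<integral>\<^sup>+y. ennreal (f y) * indicator (g ` P m) y \<partial>lebesgue) =
     (\<integral>\<^sup>+x. ennreal (h x) * indicator (P m) x \<partial>lebesgue)" .
    moreover have "(\<lambda>y. ennreal (indicator (g ` P m) y *\<^sub>R f y)) \<in> borel_measurable lebesgue"
      using f unfolding set_integrable_def by (intro measurable_compose[OF _ measurable_ennreal]) auto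
    moreover have "(\<lambda>y. ennreal (indicator (g ` P m) y *\<^sub>R f y)) = (\<lambda>y. ennreal (f y) * indicator (g ` P m) y)"
      by (auto simp: indicator_def)
    ultimately show ?thesis by simp
  qed
  have "(\<integral>\<^sup>+y. ennreal (f y) * indicator (g ` S) y \<partial>lborel) =
      (\<integral>\<^sup>+y. ennreal (f y) * indicator (\<Union>m. g ` P m) y \<partial>lebesgue)"
    by (simp add: nn_integral_completion un image_UN[symmetric])
  also have "\<dots> = (\<integral>\<^sup>+y. (\<Sum>m. ennreal (f y) * indicator (g ` P m) y) \<partial>lebesgue)"
    by (intro nn_integral_cong) (simp add: suminf_indicator[OF disj', symmetric])
  also have "\<dots> = (\<Sum>m. \<integral>\<^sup>+y. ennreal (f y) * indicator (g ` P m) y \<partial>lebesgue)"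
    by (rule nn_integral_suminf) (use piece in auto)
  also have "\<dots> = (\<Sum>m. \<integral>\<^sup>+x. ennreal (h x) * indicator (P m) x \<partial>lborel)"
    using piece by (simp add: nn_integral_completion)
  also have "\<dots> = (\<integral>\<^sup>+x. (\<Sum>m. ennreal (h x) * indicator (P m) x) \<partial>lborel)"
    by (rule nn_integral_suminf[symmetric]) auto
  also have "\<dots> = (\<integral>\<^sup>+x. ennreal (h x) * indicator S x \<partial>lborel)"
    by (intro nn_integral_cong) (simp add: suminf_indicator[OF disj] un)
  also have "\<dots> = (\<integral>\<^sup>+x. ennreal (\<bar>det (matrix (g' x))\<bar> * f (g x)) * indicator S x \<partial>lborel)"
    by (intro nn_integral_cong) (auto simp: h_def indicator_def)
  finally show ?thesis .
qed

text \<open>Conjugation with \<open>relabel\<close> reduces the claim to the well-ordered index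
  type: Lebesgue measure is carried to Lebesgue measure and the Jacobian determinant is unchanged.
  The hypothesis \<open>f\<close> makes the left integrand Borel, as transporting its integral
  requires.\<close>

lemma nn_integral_change_of_variables:
  fixes g :: "real^'n::finite \<Rightarrow> real^'n" and f :: "real^'n \<Rightarrow> real"
  assumes S: "S \<in> sets borel"
    and der: "\<And>x. x \<in> S \<Longrightarrow> (g has_derivative g' x) (at x)"
    and inj: "inj_on g S"
    and nonneg: "\<And>y. 0 \<le> f y"
    and f: "(\<lambda>y. indicator (g ` S) y * f y) \<in> borel_measurable borel"
    and meas: "(\<lambda>x. indicator S x * (\<bar>det (matrix (g' x))\<bar> * f (g x))) \<in> borel_measurable borel"
  shows "(\<integral>\<^sup>+y. ennreal (f y) * indicator (g ` S) y \<partial>lborel) =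
    (\<integral>\<^sup>+x. ennreal (\<bar>det (matrix (g' x))\<bar> * f (g x)) * indicator S x \<partial>lborel)"
proof -
  define G where "G = relabel \<circ> g \<circ> unlabel"
  define G' where "G' y = relabel \<circ> g' (unlabel y) \<circ> unlabel" for y
  define U where "U = relabel ` S"
  have U: "U = unlabel -` S" unfolding U_def by (auto simp: image_iff) (metis relabel_unlabel)
  have mem: "relabel x \<in> U \<longleftrightarrow> x \<in> S" for x by (simp add: U)
  have memG: "relabel x \<in> G ` U \<longleftrightarrow> x \<in> g ` S" for x
    unfolding G_def U_def by (auto simp: image_iff) (metis unlabel_relabel)
  have Ub: "U \<in> sets borel"
    using measurable_sets[OF unlabel_measurable, of S] S by (simp add: U)
  have ind: "indicator U y = (indicator S (unlabel y) :: real)" "indicator (G ` U) y = (indicator (g ` S) (unlabel y) :: real)" for y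
    using mem[of "unlabel y"] memG[of "unlabel y"] by (simp_all add: indicator_def)
  have iU: "(indicator U (relabel x) :: ennreal) = indicator S x" 
    "(indicator (G ` U) (relabel x) :: ennreal) = indicator (g ` S) x" for x
    using mem[of x] memG[of x] by (simp_all add: indicator_def)
  have Gr: "unlabel (G (relabel x)) = g x" for x by (simp add: G_def)
  have det: "det (matrix (G' y)) = det (matrix (g' (unlabel y)))" for y
    unfolding G'_def by (rule det_matrix_relabel)
  have *: "(\<integral>\<^sup>+y. ennreal (f (unlabel y)) * indicator (G ` U) y \<partial>lborel) =
      (\<integral>\<^sup>+y. ennreal (\<bar>det (matrix (G' y))\<bar> * f (unlabel (G y))) * indicator U y \<partial>lborel)"
  proof (rule nn_integral_change_of_variables_wellorder[OF Ub])
    fix y assume "y \<in> U"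
    then have "(g has_derivative g' (unlabel y)) (at (unlabel y))" by (intro der) (simp add: U)
    then have "((\<lambda>y. g (unlabel y)) has_derivative (\<lambda>v. g' (unlabel y) (unlabel v))) (at y)"
      by (rule has_derivative_compose[OF bounded_linear_imp_has_derivative[OF bounded_linear_unlabel], rotated])
    from bounded_linear.has_derivative[OF bounded_linear_relabel this]
    show "(G has_derivative G' y) (at y)"
      by (simp add: G_def G'_def o_def)
  next
    show "inj_on G U"
      unfolding G_def U_def using inj by (auto simp: inj_on_def) (metis unlabel_relabel)
    have "(\<lambda>y. (\<lambda>x. indicator S x * (\<bar>det (matrix (g' x))\<bar> * f (g x))) (unlabel y)) \<in> borel_measurable borel"
      by (rule measurable_compose[OF unlabel_measurable meas])
    then show "(\<lambda>y. indicator U y * (\<bar>det (matrix (G' y))\<bar> * f (unlabel (G y)))) \<in> borel_measurable borel"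
      by (simp add: ind det G_def)
  qed (rule nonneg)
  have push: "(\<integral>\<^sup>+y. F y \<partial>lborel) = (\<integral>\<^sup>+x. F (relabel x) \<partial>lborel)" if "F \<in> borel_measurable borel" for F :: "real^'n ordered \<Rightarrow> ennreal"
    using nn_integral_distr[of "relabel :: real^'n \<Rightarrow> _" lborel borel F] that by (simp add: distr_relabel)
  have m1: "(\<lambda>y. ennreal (f (unlabel y)) * indicator (G ` U) y) \<in> borel_measurable borel"
  proof -
    have "(\<lambda>y. ennreal ((\<lambda>y. indicator (g ` S) y * f y) (unlabel y))) \<in> borel_measurable borel"
      by (intro measurable_compose[OF _ measurable_ennreal] measurable_compose[OF unlabel_measurable f])
    moreover have "(\<lambda>y. ennreal ((\<lambda>y. indicator (g ` S) y * f y) (unlabel y))) =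
        (\<lambda>y. ennreal (f (unlabel y)) * indicator (G ` U) y)"
      using memG[of "unlabel _"] by (auto simp: indicator_def fun_eq_iff)
    ultimately show ?thesis by simp
  qed
  have m2: "(\<lambda>y. ennreal (\<bar>det (matrix (G' y))\<bar> * f (unlabel (G y))) * indicator U y) \<in> borel_measurable borel"
  proof -
    have "(\<lambda>y. ennreal ((\<lambda>x. indicator S x * (\<bar>det (matrix (g' x))\<bar> * f (g x))) (unlabel y))) \<in> borel_measurable borel"
      by (intro measurable_compose[OF _ measurable_ennreal] measurable_compose[OF unlabel_measurable meas])
    moreover have "(\<lambda>y. ennreal ((\<lambda>x. indicator S x * (\<bar>det (matrix (g' x))\<bar> * f (g x))) (unlabel y))) =
        (\<lambda>y. ennreal (\<bar>det (matrix (G' y))\<bar> * f (unlabel (G y))) * indicator U y)"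
      using mem[of "unlabel _"] by (auto simp: indicator_def fun_eq_iff det G_def)
    ultimately show ?thesis by simp
  qed
  show ?thesis
    using * unfolding push[OF m1] push[OF m2] by (simp add: iU det Gr)
qed


section \<open>Integrals of derivatives of compactly supported functions\<close>

lemma integral_lborel_translate:
  fixes f :: "'a::euclidean_space \<Rightarrow> real"
  assumes [measurable]: "f \<in> borel_measurable borel"
  shows "(LINT x|lborel. f (x + c)) = (LINT x|lborel. f x)"
  using integral_distr[of "(+) c" lborel borel f] by (simp add: lborel_distr_plus add.commute)

lemma integrable_lborel_compact_support:
  fixes f :: "'a::euclidean_space \<Rightarrow> real"
  assumes "compact C" "continuous_on UNIV f" "\<And>x. x \<notin> C \<Longrightarrow> f x = 0"
  shows "integrable lborel f"
proof -
  have "integrable lborel (\<lambda>x. indicator C x *\<^sub>R f x)"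
    by (rule borel_integrable_compact) (use assms in \<open>auto intro: continuous_on_subset\<close>)
  moreover have "(\<lambda>x. indicator C x *\<^sub>R f x) = f"
    using assms(3) by (auto simp: indicator_def fun_eq_iff)
  ultimately show ?thesis by simp
qed

text \<open>
  By translation invariance the difference quotients of \<open>f\<close> have integral 0.
\<close>
lemma integral_directional_derivative_eq_0:
  fixes f :: "'a::euclidean_space \<Rightarrow> real"
  assumes C: "compact C" and der: "\<And>x. (f has_derivative f' x) (at x)"
    and cont: "continuous_on UNIV (\<lambda>x. f' x v)" and supp: "\<And>x. x \<notin> C \<Longrightarrow> f x = 0"
  shows "has_bochner_integral lborel (\<lambda>x. f' x v) 0"
proof -
  have fc: "continuous_on UNIV f"
    using der by (auto intro!: continuous_at_imp_continuous_on has_derivative_continuous)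
  have fm[measurable]: "f \<in> borel_measurable borel" and [measurable]: "(\<lambda>x. f' x v) \<in> borel_measurable borel"
    using fc cont by (auto intro: borel_measurable_continuous_onI)
  have f'0: "f' x v = 0" if "x \<notin> C" for x
  proof -
    have "(f has_derivative (\<lambda>_. 0)) (at x)"
      by (rule has_derivative_transform_within_open[OF has_derivative_const open_Compl[OF compact_imp_closed[OF C]]])
        (use that supp in auto)
    then show ?thesis using has_derivative_unique der by metis
  qed
  obtain B where B: "\<And>x. x \<in> C \<Longrightarrow> \<bar>f' x v\<bar> \<le> B"
    using compact_imp_bounded[OF compact_continuous_image[OF continuous_on_subset[OF cont] C]]
    unfolding bounded_iff by auto
  have B': "\<bar>f' x v\<bar> \<le> \<bar>B\<bar>" for x
    using B[of x] f'0[of x] by (cases "x \<in> C") auto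
  obtain R where R: "C \<subseteq> cball 0 R"
    using bounded_subset_ballD[OF compact_imp_bounded[OF C]] ball_subset_cball subset_trans by metis
  have diff: "\<bar>f (x + t *\<^sub>R v) - f x\<bar> \<le> \<bar>B\<bar> * t" if "0 < t" for t x
  proof -
    have "((\<lambda>s. f (x + s *\<^sub>R v)) has_real_derivative f' (x + s *\<^sub>R v) v) (at s)" for s
    proof -
      have "((\<lambda>s. x + s *\<^sub>R v) has_derivative (\<lambda>h. h *\<^sub>R v)) (at s)"
        by (auto intro!: derivative_eq_intros)
      from has_derivative_compose[OF this der]
      have "((\<lambda>s. f (x + s *\<^sub>R v)) has_derivative (\<lambda>h. f' (x + s *\<^sub>R v) (h *\<^sub>R v))) (at s)" .
      moreover have "f' (x + s *\<^sub>R v) (h *\<^sub>R v) = f' (x + s *\<^sub>R v) v * h" for h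
        using linear_cmul[OF has_derivative_linear[OF der]] by (simp add: mult.commute)
      ultimately show ?thesis by (simp add: has_field_derivative_def)
    qed
    from MVT2[OF that this] obtain z where "f (x + t *\<^sub>R v) - f x = t * f' (x + z *\<^sub>R v) v"
      by auto
    then show ?thesis using B'[of "x + z *\<^sub>R v"] that by (simp add: abs_mult mult.commute mult_left_mono)
  qed
  define t where "t n = inverse (real (Suc n))" for n
  have t: "0 < t n" "t n \<le> 1" for n by (auto simp: t_def field_simps)
  define s where "s n x = (f (x + t n *\<^sub>R v) - f x) / t n" for n x
  have int: "integrable lborel f"
    by (rule integrable_lborel_compact_support[OF C fc supp])
  have int': "integrable lborel (\<lambda>x. f (x + c))" for c
  proof (rule integrable_lborel_compact_support)
    show "compact ((\<lambda>x. x - c) ` C)"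
      by (intro compact_continuous_image C continuous_intros)
    show "continuous_on UNIV (\<lambda>x. f (x + c))"
      by (rule continuous_on_compose2[OF fc]) (auto intro!: continuous_intros)
    show "f (x + c) = 0" if "x \<notin> (\<lambda>x. x - c) ` C" for x
      using that by (intro supp) (auto simp: image_iff)
  qed
  have s0: "(LINT x|lborel. s n x) = 0" for n
    unfolding s_def using integral_lborel_translate[OF fm] int int' by simp
  \<comment> \<open>Since \<open>t n \<le> 1\<close>, the difference quotients all vanish outside
    the ball of radius \<open>R + norm v\<close>; inside it \<open>diff\<close> bounds them by the
    constant \<open>\<bar>B\<bar>\<close>. This gives the majorant.\<close>
  have "(\<lambda>n. LINT x|lborel. s n x) \<longlonglongrightarrow> (LINT x|lborel. f' x v)"
  proof (rule integral_dominated_convergence[where w = "\<lambda>x. indicator (cball 0 (R + norm v)) x *\<^sub>R \<bar>B\<bar>"])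
    show "integrable lborel (\<lambda>x::'a. indicator (cball 0 (R + norm v)) x *\<^sub>R \<bar>B\<bar>)"
      by (rule borel_integrable_compact) auto
    show "AE x in lborel. (\<lambda>n. s n x) \<longlonglongrightarrow> f' x v"
    proof (rule AE_I2)
      fix x
      have "((\<lambda>u. (f (x + u *\<^sub>R v) - f x) / u) \<longlongrightarrow> f' x v) (at 0)"
      proof -
        have "((\<lambda>u. x + u *\<^sub>R v) has_derivative (\<lambda>h. h *\<^sub>R v)) (at 0)"
          by (auto intro!: derivative_eq_intros)
        from has_derivative_compose[OF this, of f "f' x"]
        have "((\<lambda>u. f (x + u *\<^sub>R v)) has_derivative (\<lambda>h. f' x (h *\<^sub>R v))) (at 0)" using der by simp
        moreover have "f' x (h *\<^sub>R v) = f' x v * h" for h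
          using linear_cmul[OF has_derivative_linear[OF der]] by (simp add: mult.commute)
        ultimately have "((\<lambda>u. f (x + u *\<^sub>R v)) has_real_derivative f' x v) (at 0)"
          by (simp add: has_field_derivative_def)
        then show ?thesis by (simp add: has_field_derivative_iff)
      qed
      moreover have "filterlim t (at 0) sequentially"
        unfolding t_def filterlim_at using LIMSEQ_inverse_real_of_nat by (auto intro: always_eventually)
      ultimately show "(\<lambda>n. s n x) \<longlonglongrightarrow> f' x v"
        unfolding s_def by (rule filterlim_compose)
    qed
    show "AE x in lborel. norm (s n x) \<le> indicator (cball 0 (R + norm v)) x *\<^sub>R \<bar>B\<bar>" for n
    proof (rule AE_I2)
      fix x
      show "norm (s n x) \<le> indicator (cball 0 (R + norm v)) x *\<^sub>R \<bar>B\<bar>"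
      proof (cases "x \<in> cball 0 (R + norm v)")
        case True
        then show ?thesis
          using diff[of "t n" x] t[of n] by (simp add: s_def field_simps)
      next
        case False
        have "norm x \<le> norm (x + t n *\<^sub>R v) + norm (t n *\<^sub>R v)"
          using norm_triangle_ineq4[of "x + t n *\<^sub>R v" "t n *\<^sub>R v"] by simp
        moreover have "norm (t n *\<^sub>R v) \<le> norm v"
          using t[of n] by (simp add: mult_left_le_one_le)
        ultimately have "x \<notin> C" "x + t n *\<^sub>R v \<notin> C"
          using False R by (auto simp: subset_iff) (smt (verit) norm_ge_zero)
        then show ?thesis by (simp add: s_def supp)
      qed
    qed
  qed (auto simp: s_def)
  then have "(LINT x|lborel. f' x v) = 0"
    unfolding s0 using LIMSEQ_const_iff by metis
  moreover have "integrable lborel (\<lambda>x. f' x v)"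
    by (rule integrable_lborel_compact_support[OF C cont f'0])
  ultimately show ?thesis by (simp add: has_bochner_integral_iff)
qed


section \<open>The volume measure\<close>

locale spacetime =
  fixes T :: "('c, 'm::{t2_space,second_countable_topology}, 'n::finite, 'e, 'k::finite) field_theory"
  assumes oriented: "oriented_manifold T"
begin

definition crange :: "'c \<Rightarrow> (real^'n) set" where
  "crange \<alpha> = coord T \<alpha> ` cdom T \<alpha>"

lemma ex_chart: "\<exists>\<alpha>\<in>atlas T. p \<in> cdom T \<alpha>"
  using oriented unfolding oriented_manifold_def by blast

context
  fixes \<alpha> assumes \<alpha>: "\<alpha> \<in> atlas T"
begin

lemma open_cdom: "open (cdom T \<alpha>)" and open_crange: "open (crange \<alpha>)"
  and chart_homeomorphism: "homeomorphism (cdom T \<alpha>) (crange \<alpha>) (coord T \<alpha>) (cinv T \<alpha>)"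
  using oriented \<alpha> unfolding oriented_manifold_def crange_def by auto

lemma cinv_coord: "p \<in> cdom T \<alpha> \<Longrightarrow> cinv T \<alpha> (coord T \<alpha> p) = p"
  using chart_homeomorphism by (auto simp: homeomorphism_def)

lemma coord_cinv: "x \<in> crange \<alpha> \<Longrightarrow> coord T \<alpha> (cinv T \<alpha> x) = x"
  using chart_homeomorphism by (auto simp: homeomorphism_def)

lemma coord_in_crange: "p \<in> cdom T \<alpha> \<Longrightarrow> coord T \<alpha> p \<in> crange \<alpha>"
  by (simp add: crange_def)

lemma cinv_in_cdom: "x \<in> crange \<alpha> \<Longrightarrow> cinv T \<alpha> x \<in> cdom T \<alpha>"
  using chart_homeomorphism by (auto simp: homeomorphism_def)

lemma continuous_on_coord: "continuous_on (cdom T \<alpha>) (coord T \<alpha>)"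
  and continuous_on_cinv: "continuous_on (crange \<alpha>) (cinv T \<alpha>)"
  using chart_homeomorphism by (auto simp: homeomorphism_def)

lemma inj_on_coord: "inj_on (coord T \<alpha>) (cdom T \<alpha>)"
  by (metis cinv_coord inj_on_def)

text \<open>Rewrites images under the chart as preimages under its inverse, so that openness and
  measurability of images follow from the continuity of \<open>cinv\<close>.\<close>

lemma coord_image_eq: "U \<subseteq> cdom T \<alpha> \<Longrightarrow> coord T \<alpha> ` U = crange \<alpha> \<inter> cinv T \<alpha> -` U"
  using cinv_coord coord_cinv coord_in_crange by (force simp: image_iff)

lemma open_coord_image: "open U \<Longrightarrow> U \<subseteq> cdom T \<alpha> \<Longrightarrow> open (coord T \<alpha> ` U)"
  using continuous_openin_preimage_gen[OF continuous_on_cinv, of U] open_crange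
  by (simp add: coord_image_eq openin_open_eq)

lemma open_cinv_image: 
  assumes "open V" "V \<subseteq> crange \<alpha>"
  shows "open (cinv T \<alpha> ` V)"
proof -
  have "cinv T \<alpha> ` V = cdom T \<alpha> \<inter> coord T \<alpha> -` V"
    using assms cinv_coord coord_cinv cinv_in_cdom by (force simp: image_iff)
  then show ?thesis
    using continuous_openin_preimage_gen[OF continuous_on_coord assms(1)] open_cdom
    by (simp add: openin_open_eq)
qed

lemma borel_coord_image: 
  assumes "B \<in> sets borel" "B \<subseteq> cdom T \<alpha>"
  shows "coord T \<alpha> ` B \<in> sets borel"
proof -
  have "cinv T \<alpha> \<in> borel_measurable (restrict_space borel (crange \<alpha>))"
    by (rule borel_measurable_continuous_on_restrict[OF continuous_on_cinv])
  from measurable_sets[OF this assms(1)] 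
  have "cinv T \<alpha> -` B \<inter> crange \<alpha> \<in> sets (restrict_space borel (crange \<alpha>))"
    by (simp add: space_restrict_space)
  then have "cinv T \<alpha> -` B \<inter> crange \<alpha> \<in> sets borel"
    using open_crange by (subst (asm) sets_restrict_space_iff) auto
  then show ?thesis using coord_image_eq[OF assms(2)] by (simp add: Int_commute)
qed

end

lemma smooth_transition:
  assumes "\<alpha> \<in> atlas T" "\<beta> \<in> atlas T"
  shows "smooth_on (coord T \<alpha> ` (cdom T \<alpha> \<inter> cdom T \<beta>)) (coord T \<beta> \<circ> cinv T \<alpha>)"
  using oriented assms unfolding oriented_manifold_def by auto

definition chart_density :: "('c \<Rightarrow> 'm \<Rightarrow> real^'n^'n) \<Rightarrow> 'c \<Rightarrow> real^'n \<Rightarrow> real" where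
  "chart_density g \<alpha> x = sqrt \<bar>det (g \<alpha> (cinv T \<alpha> x))\<bar>"

lemma chart_density_nonneg: "0 \<le> chart_density g \<alpha> x"
  by (simp add: chart_density_def)

lemma chart_density_pos:
  assumes "pseudo_riemannian_metric T g" "\<alpha> \<in> atlas T" "x \<in> crange \<alpha>"
  shows "0 < chart_density g \<alpha> x"
  using assms cinv_in_cdom by (auto simp: chart_density_def pseudo_riemannian_metric_def)

lemma smooth_on_metric:
  assumes "pseudo_riemannian_metric T g" "\<alpha> \<in> atlas T"
  shows "smooth_on (crange \<alpha>) (\<lambda>x. g \<alpha> (cinv T \<alpha> x))"
  using assms
  by (auto simp: pseudo_riemannian_metric_def covariant_tensor2_def smooth_components_def crange_def o_def)

lemma C1_chart_density:
  assumes "pseudo_riemannian_metric T g" "\<alpha> \<in> atlas T"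
  shows "Ck_on 1 (crange \<alpha>) (chart_density g \<alpha>)"
proof -
  have "Ck_on 1 (crange \<alpha>) (\<lambda>x. det (g \<alpha> (cinv T \<alpha> x)))"
    by (intro Ck_on_det smooth_onD smooth_on_metric assms open_crange)
  moreover have "(\<lambda>x. det (g \<alpha> (cinv T \<alpha> x))) ` crange \<alpha> \<subseteq> - {0}"
    using assms cinv_in_cdom[OF assms(2)] by (auto simp: pseudo_riemannian_metric_def)
  ultimately show ?thesis
    unfolding chart_density_def[abs_def]
    by (intro Ck_on_compose[OF open_crange[OF assms(2)] _ _ C1_sqrt_abs]) auto
qed

lemma continuous_on_chart_density:
  "pseudo_riemannian_metric T g \<Longrightarrow> \<alpha> \<in> atlas T \<Longrightarrow> continuous_on (crange \<alpha>) (chart_density g \<alpha>)"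
  using C1_chart_density Ck_on_imp_continuous_on by blast

lemma measurable_chart_density:
  assumes "pseudo_riemannian_metric T g" "\<alpha> \<in> atlas T" "S \<in> sets borel" "S \<subseteq> crange \<alpha>"
  shows "(\<lambda>x. indicator S x * chart_density g \<alpha> x) \<in> borel_measurable borel"
  using borel_measurable_continuous_on_indicator[OF assms(3)
      continuous_on_subset[OF continuous_on_chart_density[OF assms(1,2)] assms(4)]] by simp

text \<open>The value that the definition of \<open>volume\<close> prescribes for a Borel set inside
  the chart.\<close>

definition chart_volume :: "('c \<Rightarrow> 'm \<Rightarrow> real^'n^'n) \<Rightarrow> 'c \<Rightarrow> 'm set \<Rightarrow> ennreal" where
  "chart_volume g \<alpha> B = (\<integral>\<^sup>+x. ennreal (chart_density g \<alpha> x) * indicator (coord T \<alpha> ` B) x \<partial>lborel)"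

text \<open>Taking determinants in the transformation law of \<open>g\<close> shows that the density
  picks up exactly the absolute Jacobian determinant of the transition map, which is the factor in
  the change of variables formula.\<close>

lemma chart_volume_eq:
  assumes g: "pseudo_riemannian_metric T g" and \<alpha>: "\<alpha> \<in> atlas T" and \<beta>: "\<beta> \<in> atlas T"
    and B: "B \<in> sets borel" "B \<subseteq> cdom T \<alpha>" "B \<subseteq> cdom T \<beta>"
  shows "chart_volume g \<alpha> B = chart_volume g \<beta> B"
proof -
  let ?S = "coord T \<alpha> ` B"
  let ?\<tau> = "coord T \<beta> \<circ> cinv T \<alpha>"
  have im: "?\<tau> ` ?S = coord T \<beta> ` B"
    using cinv_coord[OF \<alpha>] B by (force simp: image_iff)
  have SX: "?S \<subseteq> crange \<alpha>" "coord T \<beta> ` B \<subseteq> crange \<beta>"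
    using B by (auto simp: crange_def)
  have jac: "\<bar>det (matrix (frechet_derivative ?\<tau> (at x)))\<bar> * chart_density g \<beta> (?\<tau> x) = chart_density g \<alpha> x"
    if "x \<in> ?S" for x
  proof -
    from that obtain p where p: "p \<in> B" "x = coord T \<alpha> p" by auto
    then have pd: "p \<in> cdom T \<alpha>" "p \<in> cdom T \<beta>" using B by auto
    have J: "matrix (frechet_derivative ?\<tau> (at x)) = jac T \<beta> \<alpha> p"
      by (simp add: matrix_def jac_def pdiff_def p)
    have "g \<alpha> p = transpose (jac T \<beta> \<alpha> p) ** g \<beta> p ** jac T \<beta> \<alpha> p"
      using g \<alpha> \<beta> pd unfolding pseudo_riemannian_metric_def covariant_tensor2_def by blast
    then have "det (g \<alpha> p) = (det (jac T \<beta> \<alpha> p))\<^sup>2 * det (g \<beta> p)"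
      by (simp add: det_mul det_transpose power2_eq_square)
    then have "sqrt \<bar>det (g \<alpha> p)\<bar> = \<bar>det (jac T \<beta> \<alpha> p)\<bar> * sqrt \<bar>det (g \<beta> p)\<bar>"
      by (simp add: abs_mult real_sqrt_mult)
    then show ?thesis
      unfolding J by (simp add: chart_density_def p(2) cinv_coord \<alpha> \<beta> pd)
  qed
  have eq: "(\<lambda>x. indicator ?S x * (\<bar>det (matrix (frechet_derivative ?\<tau> (at x)))\<bar> * chart_density g \<beta> (?\<tau> x))) =
      (\<lambda>x. indicator ?S x * chart_density g \<alpha> x)"
    using jac by (auto simp: indicator_def fun_eq_iff)
  have "chart_volume g \<beta> B = (\<integral>\<^sup>+y. ennreal (chart_density g \<beta> y) * indicator (?\<tau> ` ?S) y \<partial>lborel)"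
    by (simp only: chart_volume_def im)
  also have "\<dots> = (\<integral>\<^sup>+x. ennreal (\<bar>det (matrix (frechet_derivative ?\<tau> (at x)))\<bar> * chart_density g \<beta> (?\<tau> x)) *
      indicator ?S x \<partial>lborel)"
  proof (rule nn_integral_change_of_variables)
    show "?S \<in> sets borel" by (rule borel_coord_image[OF \<alpha> B(1,2)])
    show "(?\<tau> has_derivative frechet_derivative ?\<tau> (at x)) (at x)" if "x \<in> ?S" for x
      by (rule smooth_on_has_derivative[OF smooth_transition[OF \<alpha> \<beta>]]) (use that B in auto)
    show "inj_on ?\<tau> ?S"
      using B inj_onD[OF inj_on_coord[OF \<beta>]]
      by (auto simp: inj_on_def subset_iff cinv_coord[OF \<alpha>] intro!: arg_cong[where f = "coord T \<alpha>"])
    show "(\<lambda>y. indicator (?\<tau> ` ?S) y * chart_density g \<beta> y) \<in> borel_measurable borel"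
      unfolding im by (intro measurable_chart_density g \<beta> borel_coord_image B SX)
    show "(\<lambda>x. indicator ?S x * (\<bar>det (matrix (frechet_derivative ?\<tau> (at x)))\<bar> * chart_density g \<beta> (?\<tau> x))) \<in> borel_measurable borel"
      unfolding eq by (intro measurable_chart_density g \<alpha> borel_coord_image B SX)
  qed (rule chart_density_nonneg)
  also have "\<dots> = chart_volume g \<alpha> B"
    unfolding chart_volume_def
  proof (intro nn_integral_cong)
    show "ennreal (\<bar>det (matrix (frechet_derivative ?\<tau> (at x)))\<bar> * chart_density g \<beta> (?\<tau> x)) * indicator ?S x =
        ennreal (chart_density g \<alpha> x) * indicator ?S x" for x
      by (cases "x \<in> ?S") (simp_all only: jac indicator_def mult_zero_right if_False if_True simp_thms of_bool_def)
  qed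
  finally show ?thesis by simp
qed

text \<open>Injectivity of the chart keeps the coordinate images disjoint, so the sum can be taken
  under the Lebesgue integral.\<close>

lemma chart_volume_suminf:
  assumes g: "pseudo_riemannian_metric T g" and \<alpha>: "\<alpha> \<in> atlas T"
    and B: "\<And>i. B i \<in> sets borel" "\<And>i. B i \<subseteq> cdom T \<alpha>" "disjoint_family B"
  shows "(\<Sum>i. chart_volume g \<alpha> (B i)) = chart_volume g \<alpha> (\<Union>i. B i)"
proof -
  have disj: "disjoint_family (\<lambda>i. coord T \<alpha> ` B i)"
    using B(3) inj_on_image_Int[OF inj_on_coord[OF \<alpha>] B(2) B(2)] unfolding disjoint_family_on_def
    by (metis image_empty)
  have m: "(\<lambda>x. ennreal (chart_density g \<alpha> x) * indicator (coord T \<alpha> ` B i) x) \<in> borel_measurable lborel" for i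
  proof -
    have "(\<lambda>x. ennreal (indicator (coord T \<alpha> ` B i) x * chart_density g \<alpha> x)) \<in> borel_measurable lborel"
      using measurable_chart_density[OF g \<alpha> borel_coord_image[OF \<alpha> B(1,2)]] B(2)
      by (intro measurable_compose[OF _ measurable_ennreal]) (auto simp: crange_def)
    moreover have "(\<lambda>x. ennreal (indicator (coord T \<alpha> ` B i) x * chart_density g \<alpha> x)) =
        (\<lambda>x. ennreal (chart_density g \<alpha> x) * indicator (coord T \<alpha> ` B i) x)"
      by (auto simp: indicator_def fun_eq_iff)
    ultimately show ?thesis by simp
  qed
  have "(\<Sum>i. chart_volume g \<alpha> (B i)) =
      (\<integral>\<^sup>+x. (\<Sum>i. ennreal (chart_density g \<alpha> x) * indicator (coord T \<alpha> ` B i) x) \<partial>lborel)"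
    unfolding chart_volume_def by (rule nn_integral_suminf[symmetric]) (rule m)
  also have "\<dots> = chart_volume g \<alpha> (\<Union>i. B i)"
    unfolding chart_volume_def image_UN by (intro nn_integral_cong) (simp add: suminf_indicator[OF disj])
  finally show ?thesis .
qed

section \<open>Existence and uniqueness of the volume measure\<close>

lemma ex_countable_atlas: "\<exists>a :: nat \<Rightarrow> 'c. (\<forall>n. a n \<in> atlas T) \<and> (\<Union>n. cdom T (a n)) = UNIV"
proof -
  obtain F where F: "F \<subseteq> cdom T ` atlas T" "countable F" "\<Union>F = \<Union>(cdom T ` atlas T)"
    using Lindelof[of "cdom T ` atlas T"] open_cdom by auto
  have U: "\<Union>(cdom T ` atlas T) = UNIV"
    using ex_chart by auto
  then have ne: "F \<noteq> {}" using F(3) by auto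
  have "\<forall>n. \<exists>\<alpha>\<in>atlas T. cdom T \<alpha> = from_nat_into F n"
    using from_nat_into[OF ne] F(1) by blast
  then obtain a where a: "\<And>n. a n \<in> atlas T" "\<And>n. cdom T (a n) = from_nat_into F n"
    by metis
  have "(\<Union>n. cdom T (a n)) = \<Union>F"
    unfolding a(2) using range_from_nat_into[OF ne F(2)] by simp
  then show ?thesis using a(1) F(3) U by auto
qed

definition countable_atlas :: "nat \<Rightarrow> 'c" where
  "countable_atlas = (SOME a. (\<forall>n. a n \<in> atlas T) \<and> (\<Union>n. cdom T (a n)) = UNIV)"

lemma countable_atlas: "countable_atlas n \<in> atlas T" "(\<Union>n. cdom T (countable_atlas n)) = UNIV"
  using someI_ex[OF ex_countable_atlas] unfolding countable_atlas_def by auto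

text \<open>A countable Borel partition of space-time, each part inside one chart: the charts are
  glued along it without counting overlaps twice.\<close>

definition piece :: "nat \<Rightarrow> 'm set" where
  "piece = disjointed (\<lambda>n. cdom T (countable_atlas n))"

lemma piece: "piece n \<subseteq> cdom T (countable_atlas n)" "piece n \<in> sets borel"
  "disjoint_family piece" "(\<Union>n. piece n) = UNIV"
proof -
  have "range (\<lambda>n. cdom T (countable_atlas n)) \<subseteq> sets borel"
    using open_cdom countable_atlas by auto
  from sets.range_disjointed_sets[OF this] show "piece n \<in> sets borel"
    by (auto simp: piece_def)
  show "piece n \<subseteq> cdom T (countable_atlas n)"
    unfolding piece_def by (rule disjointed_subset)
qed (simp_all add: piece_def disjoint_family_disjointed UN_disjointed_eq countable_atlas(2))

text \<open>The property singled out by the definite description in \<open>volume\<close>.\<close>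

definition is_volume :: "('c \<Rightarrow> 'm \<Rightarrow> real^'n^'n) \<Rightarrow> 'm measure \<Rightarrow> bool" where
  "is_volume g M \<longleftrightarrow> sets M = sets borel \<and>
    (\<forall>\<alpha>\<in>atlas T. \<forall>B\<in>sets borel. B \<subseteq> cdom T \<alpha> \<longrightarrow> emeasure M B = chart_volume g \<alpha> B)"

text \<open>A Borel set is the disjoint union of its intersections with the pieces, and each of
  these lies in a chart, where the value is prescribed.\<close>

lemma is_volume_unique:
  assumes "is_volume g M" "is_volume g M'"
  shows "M = M'"
proof (rule measure_eqI)
  show "sets M = sets M'" using assms by (simp add: is_volume_def)
  fix B assume "B \<in> sets M"
  then have B: "B \<in> sets borel" using assms by (simp add: is_volume_def)
  have d: "disjoint_family (\<lambda>n. B \<inter> piece n)" and u: "(\<Union>n. B \<inter> piece n) = B"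
    using piece(3,4) by (auto simp: disjoint_family_on_def)
  have "emeasure N B = (\<Sum>n. chart_volume g (countable_atlas n) (B \<inter> piece n))" if "is_volume g N" for N
  proof -
    have "emeasure N B = (\<Sum>n. emeasure N (B \<inter> piece n))"
      using that B piece(2) by (subst suminf_emeasure[OF _ d, unfolded u]) (auto simp: is_volume_def)
    also have "\<dots> = (\<Sum>n. chart_volume g (countable_atlas n) (B \<inter> piece n))"
      using that B piece(1,2) countable_atlas(1) unfolding is_volume_def
      by (intro suminf_cong) (metis le_infI2 sets.Int)
    finally show ?thesis .
  qed
  then show "emeasure M B = emeasure M' B" using assms by simp
qed

text \<open>The measure is glued from the chart values on the pieces. Agreement of
  \<open>chart_volume\<close> on overlaps then gives the prescribed value in every chart of the
  atlas, not only in the countably many used for gluing.\<close>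

lemma ex_volume:
  assumes g: "pseudo_riemannian_metric T g"
  shows "\<exists>M. is_volume g M"
proof -
  define \<mu> where "\<mu> B = (\<Sum>n. chart_volume g (countable_atlas n) (B \<inter> piece n))" for B
  define M where "M = measure_of UNIV (sets borel) \<mu>"
  have [simp]: "chart_volume g \<alpha> {} = 0" for \<alpha> by (simp add: chart_volume_def)
  have "countably_additive (sets borel) \<mu>"
  proof (rule countably_additiveI)
    fix A :: "nat \<Rightarrow> 'm set" assume A: "range A \<subseteq> sets borel" "disjoint_family A"
    \<comment> \<open>One of the two infinite sums is read as an integral over the counting measure,
      so that \<open>nn_integral_suminf\<close> exchanges them.\<close>
    have "(\<Sum>i. \<mu> (A i)) = (\<integral>\<^sup>+i. (\<Sum>n. chart_volume g (countable_atlas n) (A i \<inter> piece n)) \<partial>count_space UNIV)"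
      by (simp add: nn_integral_count_space_nat \<mu>_def)
    also have "\<dots> = (\<Sum>n. \<integral>\<^sup>+i. chart_volume g (countable_atlas n) (A i \<inter> piece n) \<partial>count_space UNIV)"
      by (rule nn_integral_suminf) simp
    also have "\<dots> = (\<Sum>n. \<Sum>i. chart_volume g (countable_atlas n) (A i \<inter> piece n))"
      by (simp add: nn_integral_count_space_nat)
    also have "\<dots> = (\<Sum>n. chart_volume g (countable_atlas n) (\<Union>i. A i \<inter> piece n))"
    proof (intro suminf_cong chart_volume_suminf[OF g])
      show "A i \<inter> piece n \<in> sets borel" for i n using A(1) piece(2) by auto
      show "A i \<inter> piece n \<subseteq> cdom T (countable_atlas n)" for i n using piece(1) by auto
      show "disjoint_family (\<lambda>i. A i \<inter> piece n)" for n using A(2) by (auto simp: disjoint_family_on_def)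
    qed (rule countable_atlas)
    also have "\<dots> = \<mu> (\<Union>i. A i)" by (simp add: \<mu>_def)
    finally show "(\<Sum>i. \<mu> (A i)) = \<mu> (\<Union>i. A i)" .
  qed
  moreover have "positive (sets borel) \<mu>"
    by (simp add: positive_def \<mu>_def)
  moreover have "sigma_algebra UNIV (sets (borel :: 'm measure))"
    using sets.sigma_algebra_axioms[of "borel :: 'm measure"] by simp
  ultimately have em: "emeasure M B = \<mu> B" if "B \<in> sets borel" for B
    unfolding M_def using that by (intro emeasure_measure_of_sigma)
  have "sets M = sets borel"
    unfolding M_def using sets.sigma_sets_eq[of "borel :: 'm measure"] by (simp add: sets_measure_of_conv)
  moreover have "\<mu> B = chart_volume g \<alpha> B"
    if \<alpha>: "\<alpha> \<in> atlas T" and B: "B \<in> sets borel" "B \<subseteq> cdom T \<alpha>" for \<alpha> B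
  proof -
    have d: "disjoint_family (\<lambda>n. B \<inter> piece n)" and u: "(\<Union>n. B \<inter> piece n) = B"
      using piece(3,4) by (auto simp: disjoint_family_on_def)
    have "\<mu> B = (\<Sum>n. chart_volume g \<alpha> (B \<inter> piece n))"
      unfolding \<mu>_def
      by (intro suminf_cong chart_volume_eq[OF g countable_atlas(1) \<alpha>]) (use B piece in auto)
    also have "\<dots> = chart_volume g \<alpha> (\<Union>n. B \<inter> piece n)"
      by (rule chart_volume_suminf[OF g \<alpha> _ _ d]) (use B piece in auto)
    finally show ?thesis by (simp only: u)
  qed
  ultimately show ?thesis
    using em unfolding is_volume_def by metis
qed

lemma is_volume_volume:
  assumes "pseudo_riemannian_metric T g"
  shows "is_volume g (volume T g)"
proof -
  have eq: "volume T g = (THE M. is_volume g M)"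
    unfolding volume_def is_volume_def chart_volume_def chart_density_def ..
  show ?thesis
    unfolding eq using ex_volume[OF assms] is_volume_unique by (metis theI')
qed

lemma volume_eqI: "pseudo_riemannian_metric T g \<Longrightarrow> is_volume g M \<Longrightarrow> volume T g = M"
  using is_volume_unique is_volume_volume by blast

section \<open>Integrals over the volume measure in charts\<close>

context
  fixes g assumes g: "pseudo_riemannian_metric T g"
begin

lemma sets_volume [simp, measurable_cong]: "sets (volume T g) = sets borel"
  using is_volume_volume[OF g] by (simp add: is_volume_def)

lemma space_volume [simp]: "space (volume T g) = UNIV"
  using sets_eq_imp_space_eq[OF sets_volume] by simp

lemma emeasure_volume:
  "\<alpha> \<in> atlas T \<Longrightarrow> B \<in> sets borel \<Longrightarrow> B \<subseteq> cdom T \<alpha> \<Longrightarrow> emeasure (volume T g) B = chart_volume g \<alpha> B"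
  using is_volume_volume[OF g] by (simp add: is_volume_def)

text \<open>A constant value outside the range of the chart makes the inverse chart a Borel map on
  the whole coordinate space, along which measures can be pushed forward.\<close>

definition total_cinv :: "'c \<Rightarrow> real^'n \<Rightarrow> 'm" where
  "total_cinv \<alpha> x = (if x \<in> crange \<alpha> then cinv T \<alpha> x else undefined)"

lemma total_cinv_measurable:
  assumes "\<alpha> \<in> atlas T"
  shows "total_cinv \<alpha> \<in> measurable borel borel"
proof -
  have "(\<lambda>x. if x \<in> crange \<alpha> then cinv T \<alpha> x else undefined) \<in> measurable borel borel"
    using open_crange[OF assms] borel_measurable_continuous_on_restrict[OF continuous_on_cinv[OF assms]]
    by (subst measurable_If_restrict_space_iff) auto
  then show ?thesis by (simp add: total_cinv_def[abs_def])
qed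

text \<open>Both measures take the prescribed chart value on every Borel set. From here integrals
  over a chart, nonnegative or real, become Lebesgue integrals by the rules for
  \<open>density\<close> and \<open>distr\<close>.\<close>

lemma volume_restrict_chart:
  assumes \<alpha>: "\<alpha> \<in> atlas T" and U: "U \<in> sets borel" "U \<subseteq> cdom T \<alpha>"
  shows "density (volume T g) (\<lambda>p. ennreal (indicator U p)) =
    distr (density lborel (\<lambda>x. ennreal (indicator (coord T \<alpha> ` U) x * chart_density g \<alpha> x))) borel (total_cinv \<alpha>)"
    (is "?L = distr ?D borel _")
proof (rule measure_eqI)
  note [measurable] = total_cinv_measurable[OF \<alpha>] U(1) borel_coord_image[OF \<alpha> U]
  have CX: "coord T \<alpha> ` U \<subseteq> crange \<alpha>" using U by (auto simp: crange_def)
  have [measurable]: "(\<lambda>x. indicator (coord T \<alpha> ` U) x * chart_density g \<alpha> x) \<in> borel_measurable borel"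
    by (rule measurable_chart_density[OF g \<alpha> borel_coord_image[OF \<alpha> U] CX])
  fix B assume "B \<in> sets ?L"
  then have B[measurable]: "B \<in> sets borel" by simp
  have "emeasure ?L B = emeasure (volume T g) (B \<inter> U)"
    by (subst emeasure_density) (auto simp: nn_integral_indicator[symmetric] simp del: nn_integral_indicator
      intro!: nn_integral_cong split: split_indicator)
  also have "\<dots> = chart_volume g \<alpha> (B \<inter> U)"
    by (rule emeasure_volume[OF \<alpha>]) (use U in auto)
  also have "\<dots> = (\<integral>\<^sup>+x. ennreal (indicator (coord T \<alpha> ` U) x * chart_density g \<alpha> x) * indicator (total_cinv \<alpha> -` B) x \<partial>lborel)"
    unfolding chart_volume_def
  proof (intro nn_integral_cong)
    fix x
    have "x \<in> coord T \<alpha> ` (B \<inter> U) \<longleftrightarrow> x \<in> coord T \<alpha> ` U \<and> total_cinv \<alpha> x \<in> B"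
      using CX U cinv_coord[OF \<alpha>] coord_cinv[OF \<alpha>] by (auto simp: total_cinv_def image_iff subset_iff)
    then show "ennreal (chart_density g \<alpha> x) * indicator (coord T \<alpha> ` (B \<inter> U)) x =
        ennreal (indicator (coord T \<alpha> ` U) x * chart_density g \<alpha> x) * indicator (total_cinv \<alpha> -` B) x"
      by (auto simp: indicator_def)
  qed
  also have "\<dots> = emeasure ?D (total_cinv \<alpha> -` B)"
    using measurable_sets[OF total_cinv_measurable[OF \<alpha>] B] by (subst emeasure_density) auto
  also have "\<dots> = emeasure (distr ?D borel (total_cinv \<alpha>)) B"
    by (subst emeasure_distr) auto
  finally show "emeasure ?L B = emeasure (distr ?D borel (total_cinv \<alpha>)) B" .
qed simp

lemma nn_integral_volume_chart:
  assumes \<alpha>: "\<alpha> \<in> atlas T" and U: "U \<in> sets borel" "U \<subseteq> cdom T \<alpha>"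
    and F[measurable]: "F \<in> borel_measurable borel"
  shows "(\<integral>\<^sup>+p. F p * indicator U p \<partial>volume T g) =
    (\<integral>\<^sup>+x. ennreal (chart_density g \<alpha> x) * F (cinv T \<alpha> x) * indicator (coord T \<alpha> ` U) x \<partial>lborel)"
proof -
  note [measurable] = total_cinv_measurable[OF \<alpha>] U(1) borel_coord_image[OF \<alpha> U]
  have CX: "coord T \<alpha> ` U \<subseteq> crange \<alpha>" using U by (auto simp: crange_def)
  have [measurable]: "(\<lambda>x. indicator (coord T \<alpha> ` U) x * chart_density g \<alpha> x) \<in> borel_measurable borel"
    by (rule measurable_chart_density[OF g \<alpha> borel_coord_image[OF \<alpha> U] CX])
  have "(\<integral>\<^sup>+p. F p * indicator U p \<partial>volume T g) = (\<integral>\<^sup>+p. F p \<partial>density (volume T g) (\<lambda>p. ennreal (indicator U p)))"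
    by (subst nn_integral_density) (auto intro!: nn_integral_cong simp: mult.commute split: split_indicator)
  also have "\<dots> = (\<integral>\<^sup>+x. ennreal (indicator (coord T \<alpha> ` U) x * chart_density g \<alpha> x) * F (total_cinv \<alpha> x) \<partial>lborel)"
    unfolding volume_restrict_chart[OF \<alpha> U]
    by (subst nn_integral_distr, simp, simp, subst nn_integral_density) auto
  also have "\<dots> = (\<integral>\<^sup>+x. ennreal (chart_density g \<alpha> x) * F (cinv T \<alpha> x) * indicator (coord T \<alpha> ` U) x \<partial>lborel)"
    using CX by (intro nn_integral_cong) (auto simp: indicator_def total_cinv_def subset_iff)
  finally show ?thesis .
qed

lemma integral_volume_chart:
  fixes F :: "'m \<Rightarrow> real"
  assumes \<alpha>: "\<alpha> \<in> atlas T" and U: "U \<in> sets borel" "U \<subseteq> cdom T \<alpha>"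
    and F[measurable]: "F \<in> borel_measurable borel"
  shows "(LINT p|volume T g. indicator U p * F p) =
    (LINT x|lborel. indicator (coord T \<alpha> ` U) x * chart_density g \<alpha> x * F (cinv T \<alpha> x))"
proof -
  note [measurable] = total_cinv_measurable[OF \<alpha>] U(1) borel_coord_image[OF \<alpha> U]
  have CX: "coord T \<alpha> ` U \<subseteq> crange \<alpha>" using U by (auto simp: crange_def)
  have [measurable]: "(\<lambda>x. indicator (coord T \<alpha> ` U) x * chart_density g \<alpha> x) \<in> borel_measurable borel"
    by (rule measurable_chart_density[OF g \<alpha> borel_coord_image[OF \<alpha> U] CX])
  have "(LINT p|volume T g. indicator U p * F p) = (LINT p|density (volume T g) (\<lambda>p. ennreal (indicator U p)). F p)"
    by (subst integral_density) auto
  also have "\<dots> = (LINT x|lborel. (indicator (coord T \<alpha> ` U) x * chart_density g \<alpha> x) *\<^sub>R F (total_cinv \<alpha> x))"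
    unfolding volume_restrict_chart[OF \<alpha> U]
    by (subst integral_distr, simp, simp, subst integral_density) (auto simp: chart_density_nonneg)
  also have "\<dots> = (LINT x|lborel. indicator (coord T \<alpha> ` U) x * chart_density g \<alpha> x * F (cinv T \<alpha> x))"
    using CX by (intro Bochner_Integration.integral_cong) (auto simp: indicator_def total_cinv_def subset_iff)
  finally show ?thesis .
qed

text \<open>A closed coordinate ball inside the chart range is compact, so the continuous density is
  bounded on it.\<close>

lemma ex_finite_volume_nhd: "\<exists>U. open U \<and> p \<in> U \<and> emeasure (volume T g) U < \<infinity>"
proof -
  obtain \<alpha> where \<alpha>: "\<alpha> \<in> atlas T" "p \<in> cdom T \<alpha>" using ex_chart by blast
  obtain r where r: "0 < r" "cball (coord T \<alpha> p) r \<subseteq> crange \<alpha>"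
    using open_crange[OF \<alpha>(1)] coord_in_crange[OF \<alpha>] open_contains_cball by blast
  let ?b = "ball (coord T \<alpha> p) r" let ?c = "cball (coord T \<alpha> p) r"
  define U where "U = cinv T \<alpha> ` ?b"
  have bX: "?b \<subseteq> crange \<alpha>" using r ball_subset_cball by blast
  have U: "open U" "U \<subseteq> cdom T \<alpha>" "p \<in> U"
    using open_cinv_image[OF \<alpha>(1) _ bX] bX cinv_in_cdom[OF \<alpha>(1)] cinv_coord[OF \<alpha>] r(1)
    unfolding U_def by (auto simp: image_iff) (metis centre_in_ball)
  have im: "coord T \<alpha> ` U = ?b"
    unfolding U_def using bX coord_cinv[OF \<alpha>(1)] by (force simp: image_iff subset_iff)
  obtain B where "\<forall>y\<in>chart_density g \<alpha> ` ?c. norm y \<le> B"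
    using compact_imp_bounded[OF compact_continuous_image[OF continuous_on_subset[OF continuous_on_chart_density[OF g \<alpha>(1)] r(2)] compact_cball]]
    unfolding bounded_iff by blast
  then have B: "\<bar>chart_density g \<alpha> x\<bar> \<le> B" if "x \<in> ?c" for x
    using that by auto
  have "emeasure (volume T g) U = chart_volume g \<alpha> U"
    by (rule emeasure_volume[OF \<alpha>(1)]) (use U in auto)
  also have "\<dots> \<le> (\<integral>\<^sup>+x. ennreal B * indicator ?c x \<partial>lborel)"
    unfolding chart_volume_def im
    by (intro nn_integral_mono) (use B in \<open>auto simp: indicator_def abs_le_iff intro!: ennreal_leI\<close>)
  also have "\<dots> = ennreal B * emeasure lborel ?c"
    by (subst nn_integral_cmult_indicator) auto
  also have "\<dots> < \<infinity>"
    using emeasure_bounded_finite[of ?c] by (simp add: ennreal_mult_less_top)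
  finally show ?thesis using U by auto
qed

lemma emeasure_volume_compact:
  assumes "compact K"
  shows "emeasure (volume T g) K < \<infinity>"
proof -
  have "\<forall>p. \<exists>U. open U \<and> p \<in> U \<and> emeasure (volume T g) U < \<infinity>"
    using ex_finite_volume_nhd by blast
  from choice[OF this] obtain U where U: "\<And>p. open (U p)" "\<And>p. p \<in> U p" "\<And>p. emeasure (volume T g) (U p) < \<infinity>"
    by auto
  obtain C where C: "finite C" "K \<subseteq> (\<Union>p\<in>C. U p)"
    by (rule compactE_image[OF assms, of UNIV U]) (use U(1) in \<open>auto intro: U(2)\<close>)
  have "emeasure (volume T g) K \<le> emeasure (volume T g) (\<Union>p\<in>C. U p)"
    by (rule emeasure_mono[OF C(2)]) (use U(1) in \<open>auto intro: borel_open\<close>)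
  also have "\<dots> \<le> (\<Sum>p\<in>C. emeasure (volume T g) (U p))"
    by (rule emeasure_subadditive_finite[OF C(1)]) (use U(1) in auto)
  also have "\<dots> < \<infinity>" using C(1) U(3) by (simp add: ennreal_sum_less_top)
  finally show ?thesis .
qed

lemma integrable_volume_compact:
  fixes F :: "'m \<Rightarrow> real"
  assumes K: "compact K" and F[measurable]: "F \<in> borel_measurable borel" and B: "\<And>p. p \<in> K \<Longrightarrow> \<bar>F p\<bar> \<le> B"
  shows "integrable (volume T g) (\<lambda>p. indicator K p * F p)"
proof -
  have [measurable]: "K \<in> sets borel" using compact_imp_closed[OF K] by auto
  have "integrable (volume T g) (\<lambda>p. indicator K p * \<bar>B\<bar>)"
    using emeasure_volume_compact[OF K] by (intro integrable_mult_left integrable_real_indicator) auto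
  then show ?thesis
    by (rule Bochner_Integration.integrable_bound) (use B in \<open>force simp: indicator_def\<close>)+
qed

text \<open>The density is strictly positive on the chart range and a nonempty open set is not
  Lebesgue null. The fundamental lemma rests on this.\<close>

lemma emeasure_volume_open_pos:
  assumes "open U" "p \<in> U"
  shows "0 < emeasure (volume T g) U"
proof -
  obtain \<alpha> where \<alpha>: "\<alpha> \<in> atlas T" "p \<in> cdom T \<alpha>" using ex_chart by blast
  let ?V = "U \<inter> cdom T \<alpha>" let ?W = "coord T \<alpha> ` (U \<inter> cdom T \<alpha>)"
  have V: "open ?V" using assms(1) open_cdom[OF \<alpha>(1)] by auto
  have W: "open ?W" using open_coord_image[OF \<alpha>(1) V] by auto
  have WX: "?W \<subseteq> crange \<alpha>" by (auto simp: crange_def)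
  have meas: "(\<lambda>x. ennreal (chart_density g \<alpha> x) * indicator ?W x) \<in> borel_measurable lborel"
  proof -
    have "(\<lambda>x. ennreal (indicator ?W x * chart_density g \<alpha> x)) \<in> borel_measurable lborel"
      using measurable_chart_density[OF g \<alpha>(1) _ WX] W by (intro measurable_compose[OF _ measurable_ennreal]) auto
    moreover have "(\<lambda>x. ennreal (indicator ?W x * chart_density g \<alpha> x)) =
        (\<lambda>x. ennreal (chart_density g \<alpha> x) * indicator ?W x)"
      by (auto simp: indicator_def fun_eq_iff)
    ultimately show ?thesis by simp
  qed
  have "chart_volume g \<alpha> ?V \<noteq> 0"
  proof
    assume "chart_volume g \<alpha> ?V = 0"
    then have "AE x in lborel. ennreal (chart_density g \<alpha> x) * indicator ?W x = 0"
      unfolding chart_volume_def by (subst (asm) nn_integral_0_iff_AE[OF meas])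
    then have "AE x in lborel. x \<notin> ?W"
      by eventually_elim (use chart_density_pos[OF g \<alpha>(1)] WX in \<open>force simp: indicator_def\<close>)
    then have "?W \<in> null_sets lborel"
      using W by (subst (asm) AE_iff_null_sets[symmetric]) auto
    then have "negligible ?W"
      by (simp add: negligible_iff_null_sets null_sets_completionI)
    then show False using open_not_negligible[OF W] assms(2) \<alpha>(2) by auto
  qed
  then have "0 < emeasure (volume T g) ?V"
    using emeasure_volume[OF \<alpha>(1), of ?V] V by (auto simp: zero_less_iff_neq_zero)
  also have "\<dots> \<le> emeasure (volume T g) U"
    by (rule emeasure_mono) (use assms(1) in auto)
  finally show ?thesis .
qed

end

lemma det_scaleR: "det (c *\<^sub>R A) = c ^ CARD('n) * det A" for A :: "real^'n^'n"
proof -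
  have "c *\<^sub>R A = (\<chi> i. c *s A $ i)"
    by (simp add: vec_eq_iff)
  then show ?thesis
    using det_rows_mul[of "\<lambda>_. c" "\<lambda>i. A $ i"] by simp
qed

text \<open>The determinant is homogeneous of degree \<open>CARD('n)\<close>, so a conformal factor
  \<open>s\<close> multiplies the density by \<open>sqrt (s p ^ CARD('n))\<close> in every chart,
  and uniqueness of the volume does the rest.\<close>

lemma volume_scale:
  assumes g: "pseudo_riemannian_metric T g" and g': "pseudo_riemannian_metric T g'"
    and s: "continuous_on UNIV s" "\<And>p. 0 < s p"
    and eq: "\<And>\<alpha> p. \<alpha> \<in> atlas T \<Longrightarrow> p \<in> cdom T \<alpha> \<Longrightarrow> g' \<alpha> p = s p *\<^sub>R g \<alpha> p"
  shows "volume T g' = density (volume T g) (\<lambda>p. ennreal (sqrt (s p ^ CARD('n))))"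
proof (rule volume_eqI[OF g'])
  let ?r = "\<lambda>p. sqrt (s p ^ CARD('n))"
  have [measurable]: "s \<in> borel_measurable borel"
    by (rule borel_measurable_continuous_onI[OF s(1)])
  note [simp] = sets_volume[OF g]
  have [measurable_cong]: "sets (volume T g) = sets borel" by simp
  have "emeasure (density (volume T g) (\<lambda>p. ennreal (?r p))) B = chart_volume g' \<alpha> B"
    if \<alpha>: "\<alpha> \<in> atlas T" and B: "B \<in> sets borel" "B \<subseteq> cdom T \<alpha>" for \<alpha> B
  proof -
    have "emeasure (density (volume T g) (\<lambda>p. ennreal (?r p))) B =
        (\<integral>\<^sup>+p. ennreal (?r p) * indicator B p \<partial>volume T g)"
      using B by (subst emeasure_density) auto
    also have "\<dots> = (\<integral>\<^sup>+x. ennreal (chart_density g \<alpha> x) * ennreal (?r (cinv T \<alpha> x)) * indicator (coord T \<alpha> ` B) x \<partial>lborel)"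
      by (rule nn_integral_volume_chart[OF g \<alpha> B]) measurable
    also have "\<dots> = chart_volume g' \<alpha> B"
      unfolding chart_volume_def
    proof (intro nn_integral_cong)
      fix x
      have "chart_density g' \<alpha> x = chart_density g \<alpha> x * ?r (cinv T \<alpha> x)" if x: "x \<in> coord T \<alpha> ` B"
      proof -
        from x B have p: "cinv T \<alpha> x \<in> cdom T \<alpha>" using cinv_coord[OF \<alpha>] by auto
        show ?thesis
          unfolding chart_density_def eq[OF \<alpha> p] det_scaleR
          using s(2)[of "cinv T \<alpha> x"] by (simp add: abs_mult real_sqrt_mult)
      qed
      then show "ennreal (chart_density g \<alpha> x) * ennreal (?r (cinv T \<alpha> x)) * indicator (coord T \<alpha> ` B) x =
          ennreal (chart_density g' \<alpha> x) * indicator (coord T \<alpha> ` B) x"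
        by (auto simp: indicator_def ennreal_mult' chart_density_nonneg)
    qed
    finally show ?thesis .
  qed
  then show "is_volume g' (density (volume T g) (\<lambda>p. ennreal (?r p)))"
    by (simp add: is_volume_def)
qed

end


section \<open>Smooth functions on space-time\<close>

lemma continuous_on_UNIV_local:
  fixes f :: "'a::t2_space \<Rightarrow> 'b::topological_space"
  assumes "\<And>p. \<exists>U. open U \<and> p \<in> U \<and> continuous_on U f"
  shows "continuous_on UNIV f"
proof -
  have "isCont f p" for p
    using assms[of p] continuous_on_eq_continuous_at by blast
  then show ?thesis by (simp add: continuous_at_imp_continuous_on)
qed

context spacetime
begin

lemma smooth_functionD: 
  "smooth_function T f \<Longrightarrow> \<alpha> \<in> atlas T \<Longrightarrow> smooth_on (crange \<alpha>) (\<lambda>x. f (cinv T \<alpha> x))"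
  by (simp add: smooth_function_def crange_def o_def)

text \<open>Smoothness is demanded in every chart; one chart near each point is enough because the
  transition maps are smooth.\<close>

lemma smooth_functionI:
  assumes "\<And>p. \<exists>\<alpha>\<in>atlas T. \<exists>U. open U \<and> p \<in> U \<and> U \<subseteq> cdom T \<alpha> \<and> smooth_on (coord T \<alpha> ` U) (\<lambda>x. f (cinv T \<alpha> x))"
  shows "smooth_function T f"
  unfolding smooth_function_def
proof
  fix \<beta> assume \<beta>: "\<beta> \<in> atlas T"
  show "smooth_on (coord T \<beta> ` cdom T \<beta>) (f \<circ> cinv T \<beta>)"
  proof (rule smooth_on_local)
    fix x assume "x \<in> coord T \<beta> ` cdom T \<beta>"
    then obtain p where p: "p \<in> cdom T \<beta>" "x = coord T \<beta> p" by blast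
    obtain \<alpha> U where \<alpha>: "\<alpha> \<in> atlas T" and U: "open U" "p \<in> U" "U \<subseteq> cdom T \<alpha>"
      and f: "smooth_on (coord T \<alpha> ` U) (\<lambda>x. f (cinv T \<alpha> x))"
      using assms by blast
    let ?V = "coord T \<beta> ` (U \<inter> cdom T \<beta>)"
    have V: "open ?V"
      by (rule open_coord_image[OF \<beta>]) (use U open_cdom[OF \<beta>] in auto)
    have "smooth_on ?V (\<lambda>y. f (cinv T \<alpha> ((coord T \<alpha> \<circ> cinv T \<beta>) y)))"
    proof (rule smooth_on_compose[OF V open_coord_image[OF \<alpha> U(1,3)] _ f])
      show "(coord T \<alpha> \<circ> cinv T \<beta>) ` ?V \<subseteq> coord T \<alpha> ` U"
        by (auto simp: cinv_coord[OF \<beta>])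
      show "smooth_on ?V (coord T \<alpha> \<circ> cinv T \<beta>)"
        by (rule smooth_on_subset[OF smooth_transition[OF \<beta> \<alpha>]]) (use U in auto)
    qed
    then have "smooth_on ?V (f \<circ> cinv T \<beta>)"
      by (rule smooth_on_cong[OF V, rotated]) (use U in \<open>auto simp: cinv_coord[OF \<alpha>] cinv_coord[OF \<beta>] subset_iff\<close>)
    then show "\<exists>V. open V \<and> x \<in> V \<and> smooth_on V (f \<circ> cinv T \<beta>)"
      using V U p by blast
  qed
qed

lemma continuous_on_chart_pullback:
  assumes \<alpha>: "\<alpha> \<in> atlas T" and U: "U \<subseteq> cdom T \<alpha>" and F: "continuous_on (coord T \<alpha> ` U) F"
    and eq: "\<And>p. p \<in> U \<Longrightarrow> f p = F (coord T \<alpha> p)"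
  shows "continuous_on U f"
proof -
  have "continuous_on U (\<lambda>p. F (coord T \<alpha> p))"
    by (rule continuous_on_compose2[OF F continuous_on_subset[OF continuous_on_coord[OF \<alpha>] U]]) auto
  then show ?thesis
    using eq by (simp cong: continuous_on_cong)
qed

lemma smooth_function_continuous:
  assumes "smooth_function T f"
  shows "continuous_on UNIV f"
proof (rule continuous_on_UNIV_local)
  fix p
  obtain \<alpha> where \<alpha>: "\<alpha> \<in> atlas T" "p \<in> cdom T \<alpha>" using ex_chart by blast
  have "continuous_on (cdom T \<alpha>) f"
    by (rule continuous_on_chart_pullback[OF \<alpha>(1) subset_refl, where F = "\<lambda>x. f (cinv T \<alpha> x)"])
      (use smooth_on_imp_continuous_on[OF smooth_functionD[OF assms \<alpha>(1)]] in
        \<open>auto simp: crange_def cinv_coord[OF \<alpha>(1)]\<close>)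
  then show "\<exists>U. open U \<and> p \<in> U \<and> continuous_on U f"
    using \<alpha> open_cdom by blast
qed

lemma smooth_function_mult:
  assumes "smooth_function T f" "smooth_function T g"
  shows "smooth_function T (\<lambda>p. f p * g p)"
  unfolding smooth_function_def crange_def[symmetric] o_def
  by (intro ballI smooth_on_mult open_crange smooth_functionD assms)

lemma smooth_function_const: "smooth_function T (\<lambda>_. c)"
  by (simp add: smooth_function_def o_def smooth_on_const)

lemma smooth_function_sum:
  assumes "\<And>i. i \<in> I \<Longrightarrow> smooth_function T (f i)"
  shows "smooth_function T (\<lambda>p. \<Sum>i\<in>I. f i p)"
  unfolding smooth_function_def crange_def[symmetric] o_def
  by (intro ballI smooth_on_sum open_crange smooth_functionD assms)

text \<open>Off the closed set \<open>S\<close> the quotient is 0 whatever its denominator, and near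
  a point of \<open>S\<close> the denominator stays positive by continuity. Either way there is a
  neighbourhood on which the quotient is smooth.\<close>

lemma smooth_function_divide:
  assumes f: "smooth_function T f" and g: "smooth_function T g"
    and S: "closed S" "\<And>p. p \<notin> S \<Longrightarrow> f p = 0" "\<And>p. p \<in> S \<Longrightarrow> 0 < g p"
  shows "smooth_function T (\<lambda>p. f p / g p)"
proof (rule smooth_functionI)
  fix p
  obtain \<alpha> where \<alpha>: "\<alpha> \<in> atlas T" "p \<in> cdom T \<alpha>" using ex_chart by blast
  have "\<exists>U. open U \<and> p \<in> U \<and> U \<subseteq> cdom T \<alpha> \<and> smooth_on (coord T \<alpha> ` U) (\<lambda>x. f (cinv T \<alpha> x) / g (cinv T \<alpha> x))"
  proof (cases "p \<in> S")
    case True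
    let ?U = "cdom T \<alpha> \<inter> {p. 0 < g p}"
    have U: "open ?U"
      by (intro open_Int open_cdom \<alpha> open_Collect_less smooth_function_continuous[OF g] continuous_on_const)
    have X: "open (coord T \<alpha> ` ?U)" by (rule open_coord_image[OF \<alpha>(1) U]) auto
    have sub: "coord T \<alpha> ` ?U \<subseteq> crange \<alpha>" by (auto simp: crange_def)
    have "smooth_on (coord T \<alpha> ` ?U) (\<lambda>x. f (cinv T \<alpha> x) * inverse (g (cinv T \<alpha> x)))"
      by (intro smooth_on_mult X smooth_on_inverse smooth_on_subset[OF smooth_functionD[OF f \<alpha>(1)] sub]
          smooth_on_subset[OF smooth_functionD[OF g \<alpha>(1)] sub])
        (auto simp: cinv_coord[OF \<alpha>(1)])
    then show ?thesis
      using U \<alpha>(2) S(3)[OF True] by (intro exI[of _ ?U]) (auto simp: divide_inverse)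
  next
    case False
    let ?U = "cdom T \<alpha> - S"
    have U: "open ?U" by (intro open_Diff open_cdom \<alpha> S)
    have X: "open (coord T \<alpha> ` ?U)" by (rule open_coord_image[OF \<alpha>(1) U]) auto
    have "smooth_on (coord T \<alpha> ` ?U) (\<lambda>x. f (cinv T \<alpha> x) / g (cinv T \<alpha> x))"
      by (rule smooth_on_cong[OF X _ smooth_on_const[of _ 0]]) (auto simp: cinv_coord[OF \<alpha>(1)] S(2))
    then show ?thesis
      using U \<alpha>(2) False by (intro exI[of _ ?U]) auto
  qed
  then show "\<exists>\<alpha>\<in>atlas T. \<exists>U. open U \<and> p \<in> U \<and> U \<subseteq> cdom T \<alpha> \<and>
      smooth_on (coord T \<alpha> ` U) (\<lambda>x. f (cinv T \<alpha> x) / g (cinv T \<alpha> x))"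
    using \<alpha>(1) by blast
qed

text \<open>A Euclidean bump is pulled back along a chart and extended by 0. It vanishes off a
  compact subset of the chart, which is closed because the space is Hausdorff, so the extension is
  also smooth at points outside the chart.\<close>

lemma ex_bump_function:
  assumes U: "open U" "p \<in> U"
  obtains \<psi> C where "smooth_function T \<psi>" "\<And>q. 0 \<le> \<psi> q" "0 < \<psi> p" "compact C" "C \<subseteq> U"
    "\<And>q. q \<notin> C \<Longrightarrow> \<psi> q = 0"
proof -
  obtain \<alpha> where \<alpha>: "\<alpha> \<in> atlas T" "p \<in> cdom T \<alpha>" using ex_chart by blast
  let ?V = "U \<inter> cdom T \<alpha>"
  have V: "open ?V" using U open_cdom[OF \<alpha>(1)] by auto
  have "open (coord T \<alpha> ` ?V)" by (rule open_coord_image[OF \<alpha>(1) V]) auto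
  moreover have "coord T \<alpha> p \<in> coord T \<alpha> ` ?V" using U \<alpha> by auto
  ultimately obtain r where r: "0 < r" "cball (coord T \<alpha> p) r \<subseteq> coord T \<alpha> ` ?V"
    by (meson open_contains_cball)
  have rX: "cball (coord T \<alpha> p) r \<subseteq> crange \<alpha>" using r(2) by (auto simp: crange_def)
  define C where "C = cinv T \<alpha> ` cball (coord T \<alpha> p) r"
  define \<psi> where "\<psi> q = (if q \<in> cdom T \<alpha> then bump (coord T \<alpha> p) r (coord T \<alpha> q) else 0)" for q
  have C: "compact C"
    unfolding C_def
    by (rule compact_continuous_image[OF continuous_on_subset[OF continuous_on_cinv[OF \<alpha>(1)] rX] compact_cball])
  have CV: "C \<subseteq> ?V"
  proof
    fix q assume "q \<in> C"
    then obtain x where x: "x \<in> cball (coord T \<alpha> p) r" "q = cinv T \<alpha> x" unfolding C_def by blast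
    then obtain q' where "q' \<in> ?V" "x = coord T \<alpha> q'" using r(2) by blast
    then show "q \<in> ?V" using x(2) cinv_coord[OF \<alpha>(1)] by auto
  qed
  have zero: "\<psi> q = 0" if "q \<notin> C" for q
  proof (cases "q \<in> cdom T \<alpha>")
    case True
    have "coord T \<alpha> q \<notin> cball (coord T \<alpha> p) r"
      using that cinv_coord[OF \<alpha>(1) True] unfolding C_def by (metis image_eqI)
    then have "coord T \<alpha> q \<notin> ball (coord T \<alpha> p) r"
      using ball_subset_cball by blast
    then show ?thesis using bump_eq_0_iff[OF r(1)] by (auto simp: \<psi>_def)
  qed (simp add: \<psi>_def)
  have "smooth_function T \<psi>"
  proof (rule smooth_functionI)
    fix q
    show "\<exists>\<beta>\<in>atlas T. \<exists>W. open W \<and> q \<in> W \<and> W \<subseteq> cdom T \<beta> \<and> smooth_on (coord T \<beta> ` W) (\<lambda>x. \<psi> (cinv T \<beta> x))"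
    proof (cases "q \<in> cdom T \<alpha>")
      case True
      have "smooth_on (coord T \<alpha> ` cdom T \<alpha>) (\<lambda>x. \<psi> (cinv T \<alpha> x))"
        by (rule smooth_on_cong[OF _ _ smooth_on_subset[OF smooth_on_bump[of "coord T \<alpha> p" r] subset_UNIV]])
          (use open_crange[OF \<alpha>(1)] in \<open>auto simp: \<psi>_def crange_def cinv_coord[OF \<alpha>(1)]\<close>)
      then show ?thesis using \<alpha>(1) open_cdom[OF \<alpha>(1)] True by blast
    next
      case False
      then have q: "q \<notin> C" using CV by auto
      obtain \<beta> where \<beta>: "\<beta> \<in> atlas T" "q \<in> cdom T \<beta>" using ex_chart by blast
      let ?W = "cdom T \<beta> - C"
      have W: "open ?W" by (intro open_Diff open_cdom \<beta> compact_imp_closed C)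
      have X: "open (coord T \<beta> ` ?W)" by (rule open_coord_image[OF \<beta>(1) W]) auto
      have "smooth_on (coord T \<beta> ` ?W) (\<lambda>x. \<psi> (cinv T \<beta> x))"
        by (rule smooth_on_cong[OF X _ smooth_on_const[of _ 0]]) (auto simp: cinv_coord[OF \<beta>(1)] zero)
      then show ?thesis using \<beta> W q by (intro bexI[OF _ \<beta>(1)] exI[of _ ?W]) auto
    qed
  qed
  moreover have "0 \<le> \<psi> q" for q by (simp add: \<psi>_def bump_nonneg)
  moreover have "0 < \<psi> p" using \<alpha>(2) r(1) by (simp add: \<psi>_def bump_pos_iff)
  ultimately show ?thesis
    using that C CV zero by blast
qed

end


section \<open>Jets\<close>

text \<open>The jet of a variation, whose component along the base coordinates vanishes.\<close>
definition jet_var :: "(real^'n::finite \<Rightarrow> real^'k::finite) \<Rightarrow> (real^'n \<Rightarrow> real^'n^'n) \<Rightarrow> real^'n \<Rightarrow> ('n, 'k) jet" where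
  "jet_var u h x =
     (0, u x, (\<chi> i \<mu>. frechet_derivative u (at x) (axis \<mu> 1) $ i), h x,
      (\<chi> \<rho>. frechet_derivative h (at x) (axis \<rho> 1)),
      (\<chi> \<rho> \<sigma>. frechet_derivative (\<lambda>y. frechet_derivative h (at y) (axis \<sigma> 1)) (at x) (axis \<rho> 1)))"

lemma jet_var_cong:
  assumes X: "open X" "x \<in> X" and u: "\<And>y. y \<in> X \<Longrightarrow> u y = u' y" and h: "\<And>y. y \<in> X \<Longrightarrow> h y = h' y"
  shows "jet_var u h x = jet_var u' h' x"
proof -
  have 1: "frechet_derivative u (at x) = frechet_derivative u' (at x)"
    by (rule frechet_derivative_cong_open[OF X u])
  have 2: "frechet_derivative h (at y) = frechet_derivative h' (at y)" if "y \<in> X" for y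
    by (rule frechet_derivative_cong_open[OF X(1) that h])
  have "frechet_derivative (\<lambda>y. frechet_derivative h (at y) v) (at x) =
      frechet_derivative (\<lambda>y. frechet_derivative h' (at y) v) (at x)" for v
    by (rule frechet_derivative_cong_open[OF X]) (simp add: 2)
  then show ?thesis
    by (simp add: jet_var_def 1 2[OF X(2)] u[OF X(2)] h[OF X(2)])
qed

lemma frechet_derivative_add_scaleR:
  assumes "smooth_on X f" "smooth_on X g" "x \<in> X"
  shows "frechet_derivative (\<lambda>y. f y + t *\<^sub>R g y) (at x) =
    (\<lambda>v. frechet_derivative f (at x) v + t *\<^sub>R frechet_derivative g (at x) v)"
  by (rule frechet_derivative_at[symmetric])
    (intro has_derivative_add has_derivative_scaleR_right smooth_on_has_derivative[OF assms(1,3)]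
      smooth_on_has_derivative[OF assms(2,3)])

text \<open>Every slot is linear in the pair of functions, the coordinate slot being 0. Smoothness
  is what allows the derivatives to be distributed over the sum.\<close>

lemma jet_var_add_scaleR:
  assumes X: "open X" "x \<in> X" and u: "smooth_on X u" "smooth_on X u'" and h: "smooth_on X h" "smooth_on X h'"
  shows "jet_var (\<lambda>y. u y + t *\<^sub>R u' y) (\<lambda>y. h y + t *\<^sub>R h' y) x = jet_var u h x + t *\<^sub>R jet_var u' h' x"
proof -
  have "frechet_derivative (\<lambda>y. frechet_derivative (\<lambda>y. h y + t *\<^sub>R h' y) (at y) v) (at x) =
      frechet_derivative (\<lambda>y. frechet_derivative h (at y) v + t *\<^sub>R frechet_derivative h' (at y) v) (at x)" for v
    by (rule frechet_derivative_cong_open[OF X]) (simp add: frechet_derivative_add_scaleR[OF h])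
  moreover have "frechet_derivative (\<lambda>y. frechet_derivative h (at y) v + t *\<^sub>R frechet_derivative h' (at y) v) (at x) =
      (\<lambda>w. frechet_derivative (\<lambda>y. frechet_derivative h (at y) v) (at x) w +
        t *\<^sub>R frechet_derivative (\<lambda>y. frechet_derivative h' (at y) v) (at x) w)" for v
    by (rule frechet_derivative_add_scaleR[OF _ _ X(2)]) (intro smooth_on_frechet_derivative h)+
  ultimately show ?thesis
    by (simp add: jet_var_def frechet_derivative_add_scaleR[OF u X(2)] frechet_derivative_add_scaleR[OF h X(2)] vec_eq_iff)
qed

lemma smooth_on_Pair:
  fixes f :: "'a::euclidean_space \<Rightarrow> 'b::euclidean_space" and g :: "'a \<Rightarrow> 'c::euclidean_space"
  shows "open S \<Longrightarrow> smooth_on S f \<Longrightarrow> smooth_on S g \<Longrightarrow> smooth_on S (\<lambda>x. (f x, g x))"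
  unfolding smooth_on_def by (simp add: Ck_on_Pair)

lemma smooth_on_jet_var:
  assumes X: "open X" and u: "smooth_on X u" and h: "smooth_on X h"
  shows "smooth_on X (jet_var u h)"
  unfolding jet_var_def[abs_def]
  by (intro smooth_on_Pair smooth_on_vec_lambda smooth_on_nth smooth_on_const X u h
      smooth_on_frechet_derivative)

text \<open>The part of a jet that \<open>jet_var\<close> omits: the coordinates of the point stay
  fixed when the fields vary.\<close>

definition base_jet :: "real^'n::finite \<Rightarrow> ('n, 'k::finite) jet" where
  "base_jet x = (x, 0, 0, 0, 0, 0)"

lemma smooth_on_base_jet: "open X \<Longrightarrow> smooth_on X base_jet"
  unfolding base_jet_def[abs_def]
  by (intro smooth_on_Pair smooth_on_const) (auto simp: smooth_on_def Ck_on_bounded_linear bounded_linear_ident)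

lemma open_jet_domain:
  fixes T :: "('c, 'm, 'n::finite, 'e, 'k::finite) field_theory"
  assumes "open (bcoord T \<alpha> ` fdom T \<alpha>)"
  shows "open (jet_domain T \<alpha>)"
proof -
  have eq: "jet_domain T \<alpha> = (\<lambda>j. (fst j, fst (snd j))) -` (bcoord T \<alpha> ` fdom T \<alpha>) \<inter>
      (\<lambda>j. det (fst (snd (snd (snd j))))) -` (- {0})"
    by (auto simp: jet_domain_def)
  have "Ck_on 0 UNIV (\<lambda>A :: real^'n^'n. det A)"
    by (intro Ck_on_det Ck_on_bounded_linear bounded_linear_ident open_UNIV)
  then have "continuous_on UNIV (\<lambda>A :: real^'n^'n. det A)" by simp
  then have "continuous_on UNIV (\<lambda>j :: ('n, 'k) jet. det (fst (snd (snd (snd j)))))"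
    by (rule continuous_on_compose2) (auto intro!: continuous_intros)
  then show ?thesis
    unfolding eq by (intro open_Int open_vimage assms) (auto intro!: continuous_intros)
qed


section \<open>Matter fields and their Weyl variations\<close>

lemma scaleR_matrix_mult:
  fixes A B :: "real^'n::finite^'n"
  shows "(c *\<^sub>R A) ** B = c *\<^sub>R (A ** B)" and "A ** (c *\<^sub>R B) = c *\<^sub>R (A ** B)"
  by (simp_all add: matrix_matrix_mult_def vec_eq_iff sum_distrib_left algebra_simps)

lemma matrix_inv_cancel:
  fixes A :: "real^'n::finite^'n"
  assumes "invertible A"
  shows "A ** matrix_inv A = mat 1" and "matrix_inv A ** A = mat 1"
  using someI_ex[OF assms[unfolded invertible_def]] by (simp_all add: matrix_inv_def)

locale matter_theory = spacetime T
  for T :: "('c, 'm::{t2_space,second_countable_topology}, 'n::finite,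
    'e::topological_space, 'k::finite) field_theory" +
  assumes fibred: "matter_bundle T"
    and frame: "frame_structure T"
    and lagrangian: "matter_lagrangian T"
begin

lemma ex_fibred_chart: "\<exists>\<alpha>\<in>atlas T. z \<in> fdom T \<alpha>"
proof -
  have "(\<Union>\<alpha>\<in>atlas T. fdom T \<alpha>) = UNIV"
    using fibred unfolding matter_bundle_def by (elim conjE)
  then show ?thesis by auto
qed

lemma wdim_nonlinear: "i \<notin> lin T \<Longrightarrow> wdim T i = 0"
proof -
  have "\<forall>i. i \<notin> lin T \<longrightarrow> wdim T i = 0"
    using fibred unfolding matter_bundle_def by (elim conjE)
  then show "i \<notin> lin T \<Longrightarrow> wdim T i = 0" by auto
qed

lemma fibred_chart:
  assumes "\<alpha> \<in> atlas T"
  shows open_fdom: "open (fdom T \<alpha>)" and open_bcoord_image: "open (bcoord T \<alpha> ` fdom T \<alpha>)"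
    and proj_in_cdom: "z \<in> fdom T \<alpha> \<Longrightarrow> proj T z \<in> cdom T \<alpha>"
    and fibred_chart_homeomorphism: "homeomorphism (fdom T \<alpha>) (bcoord T \<alpha> ` fdom T \<alpha>)
          (bcoord T \<alpha>) (inv_into (fdom T \<alpha>) (bcoord T \<alpha>))"
proof -
  have "\<forall>\<alpha>\<in>atlas T. open (fdom T \<alpha>) \<and> open (bcoord T \<alpha> ` fdom T \<alpha>) \<and> proj T ` fdom T \<alpha> \<subseteq> cdom T \<alpha> \<and>
        homeomorphism (fdom T \<alpha>) (bcoord T \<alpha> ` fdom T \<alpha>) (bcoord T \<alpha>) (inv_into (fdom T \<alpha>) (bcoord T \<alpha>))"
    using fibred unfolding matter_bundle_def by (elim conjE)
  from bspec[OF this assms] show "open (fdom T \<alpha>)" "open (bcoord T \<alpha> ` fdom T \<alpha>)" "z \<in> fdom T \<alpha> \<Longrightarrow> proj T z \<in> cdom T \<alpha>"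
    "homeomorphism (fdom T \<alpha>) (bcoord T \<alpha> ` fdom T \<alpha>) (bcoord T \<alpha>) (inv_into (fdom T \<alpha>) (bcoord T \<alpha>))"
    by auto
qed

lemma fibre_eqI:
  assumes "\<alpha> \<in> atlas T" "z \<in> fdom T \<alpha>" "z' \<in> fdom T \<alpha>" "proj T z = proj T z'" "fcoord T \<alpha> z = fcoord T \<alpha> z'"
  shows "z = z'"
proof -
  have "inv_into (fdom T \<alpha>) (bcoord T \<alpha>) (bcoord T \<alpha> z) = z" "inv_into (fdom T \<alpha>) (bcoord T \<alpha>) (bcoord T \<alpha> z') = z'"
    using fibred_chart_homeomorphism[OF assms(1)] assms(2,3) unfolding homeomorphism_def by auto
  moreover have "bcoord T \<alpha> z = bcoord T \<alpha> z'" using assms(4,5) by (simp add: bcoord_def)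
  ultimately show ?thesis by metis
qed

lemma fibred_transition:
  assumes "\<alpha> \<in> atlas T" "\<beta> \<in> atlas T"
  shows "z \<in> fdom T \<alpha> \<inter> fdom T \<beta> \<Longrightarrow> same_nonlinear T (fcoord T \<alpha> z) v \<Longrightarrow>
      \<exists>z' \<in> fdom T \<alpha> \<inter> fdom T \<beta>. proj T z' = proj T z \<and> fcoord T \<alpha> z' = v" (is "_ \<Longrightarrow> _ \<Longrightarrow> ?extend")
    and "\<exists>A :: 'm \<Rightarrow> real^'k^'k. \<forall>p.
       (\<forall>i\<in>lin T. \<forall>j. A p $ i $ j \<noteq> 0 \<longrightarrow> j \<in> lin T \<and> wdim T j = wdim T i) \<and>
       (\<forall>z \<in> fdom T \<alpha> \<inter> fdom T \<beta>. proj T z = p \<longrightarrow>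
          (\<forall>i\<in>lin T. fcoord T \<beta> z $ i = (A p *v fcoord T \<alpha> z) $ i))" (is ?linear)
    and "z \<in> fdom T \<alpha> \<inter> fdom T \<beta> \<Longrightarrow> z' \<in> fdom T \<alpha> \<inter> fdom T \<beta> \<Longrightarrow> proj T z = proj T z' \<Longrightarrow>
      same_nonlinear T (fcoord T \<alpha> z) (fcoord T \<alpha> z') \<Longrightarrow> same_nonlinear T (fcoord T \<beta> z) (fcoord T \<beta> z')"
      (is "_ \<Longrightarrow> _ \<Longrightarrow> _ \<Longrightarrow> _ \<Longrightarrow> ?nonlinear")
proof -
  have *: "\<forall>\<alpha>\<in>atlas T. \<forall>\<beta>\<in>atlas T.
        smooth_on (bcoord T \<alpha> ` (fdom T \<alpha> \<inter> fdom T \<beta>))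
          (bcoord T \<beta> \<circ> inv_into (fdom T \<alpha>) (bcoord T \<alpha>)) \<and>
        (\<forall>z \<in> fdom T \<alpha> \<inter> fdom T \<beta>. \<forall>v. same_nonlinear T (fcoord T \<alpha> z) v \<longrightarrow>
           (\<exists>z' \<in> fdom T \<alpha> \<inter> fdom T \<beta>. proj T z' = proj T z \<and> fcoord T \<alpha> z' = v)) \<and>
        (\<exists>A :: 'm \<Rightarrow> real^'k^'k. \<forall>p. 
           (\<forall>i\<in>lin T. \<forall>j. A p $ i $ j \<noteq> 0 \<longrightarrow> j \<in> lin T \<and> wdim T j = wdim T i) \<and>
           (\<forall>z \<in> fdom T \<alpha> \<inter> fdom T \<beta>. proj T z = p \<longrightarrow>
              (\<forall>i\<in>lin T. fcoord T \<beta> z $ i = (A p *v fcoord T \<alpha> z) $ i))) \<and>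
        (\<forall>z \<in> fdom T \<alpha> \<inter> fdom T \<beta>. \<forall>z' \<in> fdom T \<alpha> \<inter> fdom T \<beta>.
           proj T z = proj T z' \<and> same_nonlinear T (fcoord T \<alpha> z) (fcoord T \<alpha> z') \<longrightarrow>
           same_nonlinear T (fcoord T \<beta> z) (fcoord T \<beta> z'))"
    using fibred unfolding matter_bundle_def by (elim conjE)
  note ** = bspec[OF bspec[OF * assms(1)] assms(2)]
  show ?extend if "z \<in> fdom T \<alpha> \<inter> fdom T \<beta>" "same_nonlinear T (fcoord T \<alpha> z) v"
    using conjunct1[OF conjunct2[OF **]] that by auto
  show ?linear
    using conjunct1[OF conjunct2[OF conjunct2[OF **]]] .
  show ?nonlinear if "z \<in> fdom T \<alpha> \<inter> fdom T \<beta>" "z' \<in> fdom T \<alpha> \<inter> fdom T \<beta>" "proj T z = proj T z'"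
    "same_nonlinear T (fcoord T \<alpha> z) (fcoord T \<alpha> z')"
    using conjunct2[OF conjunct2[OF conjunct2[OF **]]] that by auto
qed

text \<open>Here \<open>s\<close> stands for \<open>t * \<omega> p\<close>: this is the first-order
  rescaling, affine in \<open>s\<close>, and not the finite factor
  \<open>\<lambda>^(-w)\<close>.\<close>

definition weyl_scale :: "real \<Rightarrow> real^'k \<Rightarrow> real^'k" where
  "weyl_scale s u = (\<chi> i. u $ i + s * (- wdim T i * u $ i))"

definition weyl_fibre :: "real \<Rightarrow> 'e \<Rightarrow> 'c \<Rightarrow> 'e \<Rightarrow> bool" where
  "weyl_fibre s z \<alpha> z' \<longleftrightarrow> z' \<in> fdom T \<alpha> \<and> proj T z' = proj T z \<and> fcoord T \<alpha> z' = weyl_scale s (fcoord T \<alpha> z)"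

lemma same_nonlinear_weyl_scale: "same_nonlinear T u (weyl_scale s u)"
  by (simp add: same_nonlinear_def weyl_scale_def wdim_nonlinear)

text \<open>On linear components the transition matrix mixes only equal Weyl dimensions, so the
  factor \<open>1 - s * wdim T i\<close> can be taken out of row \<open>i\<close>. Nonlinear
  components have Weyl dimension 0 and stay fixed, which the transition preserves. Hence the
  rescaling commutes with changes of chart.\<close>

lemma weyl_fibre_transition:
  assumes \<alpha>: "\<alpha> \<in> atlas T" and \<beta>: "\<beta> \<in> atlas T" and z: "z \<in> fdom T \<alpha>" "z \<in> fdom T \<beta>"
    and z': "weyl_fibre s z \<alpha> z'"
  shows "weyl_fibre s z \<beta> z'"
proof -
  \<comment> \<open>A point with the rescaled components exists in the overlap of the two charts;
    injectivity of the fibred chart identifies it with \<open>z'\<close>, which therefore lies in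
    both charts.\<close>
  from fibred_transition(1)[OF \<alpha> \<beta> _ same_nonlinear_weyl_scale, of z s] z
  obtain z'' where z'': "z'' \<in> fdom T \<alpha> \<inter> fdom T \<beta>" "proj T z'' = proj T z"
    "fcoord T \<alpha> z'' = weyl_scale s (fcoord T \<alpha> z)" by blast
  have "z'' = z'"
    by (rule fibre_eqI[OF \<alpha>]) (use z'' z' in \<open>auto simp: weyl_fibre_def\<close>)
  with z'' have z'\<beta>: "z' \<in> fdom T \<alpha> \<inter> fdom T \<beta>" and p: "proj T z' = proj T z" by auto
  have "same_nonlinear T (fcoord T \<beta> z) (fcoord T \<beta> z')"
    by (rule fibred_transition(3)[OF \<alpha> \<beta>]) 
      (use z z'\<beta> p z' same_nonlinear_weyl_scale in \<open>auto simp: weyl_fibre_def\<close>)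
  then have nonlin: "fcoord T \<beta> z' $ i = weyl_scale s (fcoord T \<beta> z) $ i" if "i \<notin> lin T" for i
    using that by (simp add: same_nonlinear_def weyl_scale_def wdim_nonlinear)
  obtain A :: "real^'k^'k" where
    A0: "\<And>i j. i \<in> lin T \<Longrightarrow> A $ i $ j \<noteq> 0 \<Longrightarrow> wdim T j = wdim T i" and
    A: "\<And>y i. y \<in> fdom T \<alpha> \<inter> fdom T \<beta> \<Longrightarrow> proj T y = proj T z \<Longrightarrow> i \<in> lin T \<Longrightarrow> 
      fcoord T \<beta> y $ i = (A *v fcoord T \<alpha> y) $ i"
    using fibred_transition(2)[OF \<alpha> \<beta>] by metis
  have lin: "fcoord T \<beta> z' $ i = weyl_scale s (fcoord T \<beta> z) $ i" if i: "i \<in> lin T" for i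
  proof -
    have "fcoord T \<beta> z' $ i = (A *v fcoord T \<alpha> z') $ i" by (rule A[OF z'\<beta> p i])
    also have "\<dots> = (\<Sum>j\<in>UNIV. A $ i $ j * weyl_scale s (fcoord T \<alpha> z) $ j)"
      using z' by (simp add: matrix_vector_mult_def weyl_fibre_def)
    also have "\<dots> = (\<Sum>j\<in>UNIV. (1 - s * wdim T i) * (A $ i $ j * fcoord T \<alpha> z $ j))"
    proof (rule sum.cong[OF refl])
      fix j
      show "A $ i $ j * weyl_scale s (fcoord T \<alpha> z) $ j = (1 - s * wdim T i) * (A $ i $ j * fcoord T \<alpha> z $ j)"
        using A0[OF i, of j] by (cases "A $ i $ j = 0") (auto simp: weyl_scale_def algebra_simps)
    qed
    also have "\<dots> = (1 - s * wdim T i) * (A *v fcoord T \<alpha> z) $ i"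
      by (simp add: matrix_vector_mult_def sum_distrib_left)
    also have "(A *v fcoord T \<alpha> z) $ i = fcoord T \<beta> z $ i"
      by (rule A[symmetric]) (use z i in auto)
    finally show ?thesis by (simp add: weyl_scale_def algebra_simps)
  qed
  have "fcoord T \<beta> z' = weyl_scale s (fcoord T \<beta> z)"
    unfolding vec_eq_iff using lin nonlin by blast
  then show ?thesis using z'\<beta> p by (simp add: weyl_fibre_def)
qed

lemma ex_weyl_fibre:
  assumes "\<alpha> \<in> atlas T" "z \<in> fdom T \<alpha>"
  shows "\<exists>z'. weyl_fibre s z \<alpha> z'"
  using fibred_transition(1)[OF assms(1,1) _ same_nonlinear_weyl_scale, of z s] assms(2)
  unfolding weyl_fibre_def by blast

text \<open>Overlaps of charts contain, with a point, all points of the fibre that differ only in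
  the linear components. For the converse the components of \<open>z\<close> are prescribed directly
  rather than by inverting the scaling, so a vanishing scale factor does no harm.\<close>

lemma weyl_fibre_in_fdom_iff:
  assumes \<alpha>: "\<alpha> \<in> atlas T" and \<beta>: "\<beta> \<in> atlas T" and z: "z \<in> fdom T \<alpha>" "weyl_fibre s z \<alpha> z'"
  shows "z' \<in> fdom T \<beta> \<longleftrightarrow> z \<in> fdom T \<beta>"
proof
  assume "z \<in> fdom T \<beta>"
  then show "z' \<in> fdom T \<beta>"
    using weyl_fibre_transition[OF \<alpha> \<beta> z(1) _ z(2)] by (simp add: weyl_fibre_def)
next
  assume "z' \<in> fdom T \<beta>"
  moreover have "same_nonlinear T (fcoord T \<alpha> z') (fcoord T \<alpha> z)"
    using z(2) same_nonlinear_weyl_scale[of "fcoord T \<alpha> z" s]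
    by (simp add: weyl_fibre_def same_nonlinear_def)
  ultimately obtain z'' where "z'' \<in> fdom T \<alpha> \<inter> fdom T \<beta>" "proj T z'' = proj T z'" "fcoord T \<alpha> z'' = fcoord T \<alpha> z"
    using fibred_transition(1)[OF \<alpha> \<beta>, of z' "fcoord T \<alpha> z"] z(2) by (auto simp: weyl_fibre_def)
  moreover from this have "z'' = z"
    by (intro fibre_eqI[OF \<alpha>]) (use z in \<open>auto simp: weyl_fibre_def\<close>)
  ultimately show "z \<in> fdom T \<beta>" by auto
qed

section \<open>The Weyl variation of a section\<close>

context
  fixes \<phi> assumes \<phi>: "matter_field T \<phi>"
begin

lemma continuous_matter: "continuous_on UNIV \<phi>" and proj_matter: "proj T (\<phi> p) = p"
  using \<phi> by (auto simp: matter_field_def)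

text \<open>This can be smaller than \<open>cdom T \<alpha>\<close>, since a fibred chart need not
  contain whole fibres.\<close>

definition udom :: "'c \<Rightarrow> 'm set" where
  "udom \<alpha> = {p. \<phi> p \<in> fdom T \<alpha>}"

lemma udom_iff: "p \<in> udom \<alpha> \<longleftrightarrow> \<phi> p \<in> fdom T \<alpha>"
  by (simp add: udom_def)

lemma ex_udom: "\<exists>\<alpha>\<in>atlas T. p \<in> udom \<alpha>"
  using ex_fibred_chart by (simp add: udom_iff)

text \<open>In the chart chosen by the definition the rescaled point is unique, so the description
  denotes it; \<open>weyl_fibre_transition\<close> transfers the result to any chart around
  \<open>\<phi> p\<close>.\<close>

lemma weyl_vary_matter_fibre:
  assumes \<alpha>: "\<alpha> \<in> atlas T" "\<phi> p \<in> fdom T \<alpha>"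
  shows "weyl_fibre (t * \<omega> p) (\<phi> p) \<alpha> (weyl_vary_matter T \<omega> t \<phi> p)"
proof -
  define \<beta> where "\<beta> = (SOME \<beta>. \<beta> \<in> atlas T \<and> \<phi> p \<in> fdom T \<beta>)"
  have "\<exists>\<beta>. \<beta> \<in> atlas T \<and> \<phi> p \<in> fdom T \<beta>" using \<alpha> by blast
  then have \<beta>: "\<beta> \<in> atlas T" "\<phi> p \<in> fdom T \<beta>"
    unfolding \<beta>_def by (rule someI2_ex, blast)+
  have sc: "(\<chi> i. u $ i + t * (- wdim T i * \<omega> p * u $ i)) = weyl_scale (t * \<omega> p) u" for u
    by (simp add: weyl_scale_def vec_eq_iff)
  have "weyl_vary_matter T \<omega> t \<phi> p = (THE z. weyl_fibre (t * \<omega> p) (\<phi> p) \<beta> z)"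
    unfolding weyl_vary_matter_def Let_def \<beta>_def[symmetric] sc weyl_fibre_def proj_matter ..
  moreover have "\<exists>!z. weyl_fibre (t * \<omega> p) (\<phi> p) \<beta> z"
    using ex_weyl_fibre[OF \<beta>] fibre_eqI[OF \<beta>(1)] by (metis weyl_fibre_def)
  ultimately have "weyl_fibre (t * \<omega> p) (\<phi> p) \<beta> (weyl_vary_matter T \<omega> t \<phi> p)"
    using theI' by metis
  then show ?thesis
    by (rule weyl_fibre_transition[OF \<beta>(1) \<alpha>(1) \<beta>(2) \<alpha>(2)])
qed

lemma weyl_vary_matter_proj: "proj T (weyl_vary_matter T \<omega> t \<phi> p) = p"
proof -
  obtain \<beta> where \<beta>: "\<beta> \<in> atlas T" "\<phi> p \<in> fdom T \<beta>" using ex_fibred_chart by blast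
  show ?thesis
    using weyl_vary_matter_fibre[OF \<beta>, of t \<omega>] by (simp add: weyl_fibre_def proj_matter)
qed

lemma weyl_vary_matter_fdom_iff:
  assumes "\<alpha> \<in> atlas T"
  shows "weyl_vary_matter T \<omega> t \<phi> p \<in> fdom T \<alpha> \<longleftrightarrow> \<phi> p \<in> fdom T \<alpha>"
proof -
  obtain \<beta> where \<beta>: "\<beta> \<in> atlas T" "\<phi> p \<in> fdom T \<beta>" using ex_fibred_chart by blast
  show ?thesis
    by (rule weyl_fibre_in_fdom_iff[OF \<beta>(1) assms \<beta>(2) weyl_vary_matter_fibre[OF \<beta>]])
qed

lemma weyl_vary_matter_0: "weyl_vary_matter T \<omega> 0 \<phi> = \<phi>"
proof
  fix p
  obtain \<beta> where \<beta>: "\<beta> \<in> atlas T" "\<phi> p \<in> fdom T \<beta>" using ex_fibred_chart by blast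
  have "weyl_scale 0 u = u" for u by (simp add: weyl_scale_def vec_eq_iff)
  then show "weyl_vary_matter T \<omega> 0 \<phi> p = \<phi> p"
    using weyl_vary_matter_fibre[OF \<beta>, where t = 0 and \<omega> = \<omega>] \<beta>
    by (intro fibre_eqI[OF \<beta>(1)]) (auto simp: weyl_fibre_def)
qed

context
  fixes \<alpha> assumes \<alpha>: "\<alpha> \<in> atlas T"
begin

lemma open_udom: "open (udom \<alpha>)"
  unfolding udom_def using open_vimage[OF open_fdom[OF \<alpha>] continuous_matter] by (simp add: vimage_def)

lemma udom_subset: "udom \<alpha> \<subseteq> cdom T \<alpha>"
proof
  fix p assume "p \<in> udom \<alpha>"
  then show "p \<in> cdom T \<alpha>"
    using proj_in_cdom[OF \<alpha>, of "\<phi> p"] by (simp add: udom_iff proj_matter)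
qed

definition uX :: "(real^'n) set" where "uX = coord T \<alpha> ` udom \<alpha>"

lemma open_uX: "open uX"
  unfolding uX_def by (rule open_coord_image[OF \<alpha> open_udom udom_subset])

lemma uX_subset: "uX \<subseteq> crange \<alpha>"
  using udom_subset by (auto simp: uX_def crange_def)

lemma cinv_in_udom: "x \<in> uX \<Longrightarrow> cinv T \<alpha> x \<in> udom \<alpha>"
  using udom_subset cinv_coord[OF \<alpha>] by (auto simp: uX_def subset_iff)

definition ucomp :: "real^'n \<Rightarrow> real^'k" where
  "ucomp x = fcoord T \<alpha> (\<phi> (cinv T \<alpha> x))"

lemma smooth_ucomp: "smooth_on uX ucomp"
  using \<phi> \<alpha> unfolding matter_field_def uX_def udom_def ucomp_def[abs_def] o_def by auto

definition weyl_du :: "('m \<Rightarrow> real) \<Rightarrow> real^'n \<Rightarrow> real^'k" where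
  "weyl_du \<omega> x = (\<chi> i. (- wdim T i * \<omega> (cinv T \<alpha> x)) * ucomp x $ i)"

lemma smooth_on_omega: "smooth_function T \<omega> \<Longrightarrow> smooth_on uX (\<lambda>x. \<omega> (cinv T \<alpha> x))"
  by (rule smooth_on_subset[OF smooth_functionD[OF _ \<alpha>] uX_subset])

lemma smooth_weyl_du:
  assumes "smooth_function T \<omega>"
  shows "smooth_on uX (weyl_du \<omega>)"
  unfolding weyl_du_def[abs_def]
  by (intro smooth_on_vec_lambda smooth_on_mult smooth_on_nth smooth_on_const smooth_ucomp open_uX
      smooth_on_omega assms)

lemma fcoord_weyl_vary_matter:
  assumes "x \<in> uX"
  shows "fcoord T \<alpha> (weyl_vary_matter T \<omega> t \<phi> (cinv T \<alpha> x)) = ucomp x + t *\<^sub>R weyl_du \<omega> x"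
  using weyl_vary_matter_fibre[OF \<alpha> cinv_in_udom[OF assms, unfolded udom_iff], of t \<omega>]
  by (simp add: weyl_fibre_def weyl_scale_def weyl_du_def ucomp_def vec_eq_iff)

lemma smooth_on_fcoord_weyl_vary_matter:
  assumes "smooth_function T \<omega>"
  shows "smooth_on uX (\<lambda>x. fcoord T \<alpha> (weyl_vary_matter T \<omega> t \<phi> (cinv T \<alpha> x)))"
proof (rule smooth_on_cong[OF open_uX])
  show "smooth_on uX (\<lambda>x. ucomp x + t *\<^sub>R weyl_du \<omega> x)"
    by (intro smooth_on_add smooth_on_scaleR smooth_on_const open_uX smooth_ucomp smooth_weyl_du assms)
qed (simp add: fcoord_weyl_vary_matter)

text \<open>The chart components are continuous, and continuity into the total space follows by
  composing with the inverse of the fibred chart.\<close>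

lemma continuous_on_weyl_vary_matter:
  assumes "smooth_function T \<omega>"
  shows "continuous_on (udom \<alpha>) (weyl_vary_matter T \<omega> t \<phi>)"
proof -
  let ?\<psi> = "weyl_vary_matter T \<omega> t \<phi>"
  let ?i = "inv_into (fdom T \<alpha>) (bcoord T \<alpha>)"
  have \<psi>: "?\<psi> p \<in> fdom T \<alpha>" if "p \<in> udom \<alpha>" for p
    using that weyl_vary_matter_fdom_iff[OF \<alpha>] by (simp add: udom_iff)
  have "continuous_on (udom \<alpha>) (\<lambda>p. fcoord T \<alpha> (?\<psi> p))"
    by (rule continuous_on_chart_pullback[OF \<alpha> udom_subset,
          where F = "\<lambda>x. fcoord T \<alpha> (weyl_vary_matter T \<omega> t \<phi> (cinv T \<alpha> x))"])
      (use smooth_on_imp_continuous_on[OF smooth_on_fcoord_weyl_vary_matter[OF assms]] udom_subset in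
        \<open>auto simp: uX_def cinv_coord[OF \<alpha>] subset_iff\<close>)
  then have c: "continuous_on (udom \<alpha>) (\<lambda>p. bcoord T \<alpha> (?\<psi> p))"
    unfolding bcoord_def weyl_vary_matter_proj
    by (intro continuous_on_Pair continuous_on_subset[OF continuous_on_coord[OF \<alpha>] udom_subset])
  have "continuous_on (bcoord T \<alpha> ` fdom T \<alpha>) ?i"
    using fibred_chart_homeomorphism[OF \<alpha>] by (auto simp: homeomorphism_def)
  from continuous_on_compose2[OF this c]
  have "continuous_on (udom \<alpha>) (\<lambda>p. ?i (bcoord T \<alpha> (?\<psi> p)))" using \<psi> by blast
  moreover have "?i (bcoord T \<alpha> (?\<psi> p)) = ?\<psi> p" if "p \<in> udom \<alpha>" for p
    using fibred_chart_homeomorphism[OF \<alpha>] \<psi>[OF that] by (auto simp: homeomorphism_def)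
  ultimately show ?thesis by (simp cong: continuous_on_cong)
qed

end

lemma matter_field_weyl_vary:
  assumes "smooth_function T \<omega>"
  shows "matter_field T (weyl_vary_matter T \<omega> t \<phi>)"
  unfolding matter_field_def
proof (intro conjI ballI allI)
  show "continuous_on UNIV (weyl_vary_matter T \<omega> t \<phi>)"
  proof (rule continuous_on_UNIV_local)
    fix p
    obtain \<alpha> where \<alpha>: "\<alpha> \<in> atlas T" "p \<in> udom \<alpha>" using ex_udom by blast
    show "\<exists>U. open U \<and> p \<in> U \<and> continuous_on U (weyl_vary_matter T \<omega> t \<phi>)"
      by (intro exI[of _ "udom \<alpha>"] conjI open_udom continuous_on_weyl_vary_matter \<alpha> assms)
  qed
  show "proj T (weyl_vary_matter T \<omega> t \<phi> p) = p" for p by (rule weyl_vary_matter_proj)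
  show "smooth_on (coord T \<alpha> ` {p. weyl_vary_matter T \<omega> t \<phi> p \<in> fdom T \<alpha>})
      (fcoord T \<alpha> \<circ> weyl_vary_matter T \<omega> t \<phi> \<circ> cinv T \<alpha>)" if "\<alpha> \<in> atlas T" for \<alpha>
    using smooth_on_fcoord_weyl_vary_matter[OF that assms, of t]
    by (simp add: weyl_vary_matter_fdom_iff[OF that] uX_def[OF that] udom_def o_def)
qed

end


section \<open>Weyl variations of the gravitational field\<close>

text \<open>The weight of \<open>h\<close> itself: 2 for a metric, 1 for a frame, of which the
  metric is a quadratic expression.\<close>

definition grav_weight :: real where
  "grav_weight = (case grav T of Metric \<Rightarrow> 2 | Frame \<eta> \<Lambda> \<Rightarrow> 1)"

text \<open>The degree of homogeneity of the metric as a function of \<open>h\<close>.\<close>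

definition metric_power :: nat where
  "metric_power = (case grav T of Metric \<Rightarrow> 1 | Frame \<eta> \<Lambda> \<Rightarrow> 2)"

lemma metric_comp_scaleR: "metric_comp (grav T) (s *\<^sub>R H) = s ^ metric_power *\<^sub>R metric_comp (grav T) H"
  by (cases "grav T") (simp_all add: metric_comp_def metric_power_def power2_eq_square transpose_scalar
      scaleR_matrix_mult)

text \<open>The factor multiplies \<open>h\<close>, not the metric; for frames the varied metric
  carries its square and is quadratic in \<open>t\<close>.\<close>

definition weyl_factor :: "('m \<Rightarrow> real) \<Rightarrow> real \<Rightarrow> 'm \<Rightarrow> real" where
  "weyl_factor \<omega> t p = 1 + t * (grav_weight * \<omega> p)"

lemma smooth_weyl_factor: "smooth_function T \<omega> \<Longrightarrow> smooth_function T (weyl_factor \<omega> t)"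
proof -
  assume \<omega>: "smooth_function T \<omega>"
  have "smooth_function T (\<lambda>p. \<Sum>i\<in>{0, 1 :: nat}. if i = 0 then 1 else t * (grav_weight * \<omega> p))"
    using smooth_function_const[of 1]
      smooth_function_mult[OF smooth_function_const smooth_function_mult[OF smooth_function_const \<omega>]]
    by (intro smooth_function_sum) auto
  then show ?thesis by (simp add: weyl_factor_def[abs_def])
qed

lemma smooth_function_power: "smooth_function T f \<Longrightarrow> smooth_function T (\<lambda>p. f p ^ k)"
  by (induction k) (simp_all add: smooth_function_const smooth_function_mult)

lemma smooth_on_scale_components:
  assumes s: "smooth_function T s" and \<alpha>: "\<alpha> \<in> atlas T"
    and F: "smooth_on (crange \<alpha>) (\<lambda>x. F (cinv T \<alpha> x))"
    and eq: "\<And>p. p \<in> cdom T \<alpha> \<Longrightarrow> F' p = s p *\<^sub>R F p"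
  shows "smooth_on (coord T \<alpha> ` cdom T \<alpha>) (F' \<circ> cinv T \<alpha>)"
proof -
  have "smooth_on (crange \<alpha>) (\<lambda>x. s (cinv T \<alpha> x) *\<^sub>R F (cinv T \<alpha> x))"
    by (intro smooth_on_scaleR open_crange \<alpha> smooth_functionD s F)
  then have "smooth_on (crange \<alpha>) (F' \<circ> cinv T \<alpha>)"
    by (rule smooth_on_cong[OF open_crange[OF \<alpha>], rotated]) (simp add: eq cinv_in_cdom[OF \<alpha>])
  then show ?thesis by (simp add: crange_def)
qed

lemma covariant_tensor2_scale:
  assumes s: "smooth_function T s" and f: "covariant_tensor2 T f"
    and eq: "\<And>\<alpha> p. \<alpha> \<in> atlas T \<Longrightarrow> p \<in> cdom T \<alpha> \<Longrightarrow> f' \<alpha> p = s p *\<^sub>R f \<alpha> p"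
  shows "covariant_tensor2 T f'"
  unfolding covariant_tensor2_def
proof (intro conjI ballI)
  show "f' \<alpha> p = transpose (jac T \<beta> \<alpha> p) ** f' \<beta> p ** jac T \<beta> \<alpha> p"
    if \<alpha>: "\<alpha> \<in> atlas T" and \<beta>: "\<beta> \<in> atlas T" and p: "p \<in> cdom T \<alpha> \<inter> cdom T \<beta>" for \<alpha> \<beta> p
  proof -
    have "f \<alpha> p = transpose (jac T \<beta> \<alpha> p) ** f \<beta> p ** jac T \<beta> \<alpha> p"
      using f \<alpha> \<beta> p unfolding covariant_tensor2_def by blast
    then show ?thesis using \<alpha> \<beta> p by (simp add: eq scaleR_matrix_mult)
  qed
  show "smooth_components T f'"
    unfolding smooth_components_def
  proof
    fix \<alpha> assume \<alpha>: "\<alpha> \<in> atlas T"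
    have "smooth_on (crange \<alpha>) (\<lambda>x. f \<alpha> (cinv T \<alpha> x))"
      using f \<alpha> by (simp add: covariant_tensor2_def smooth_components_def crange_def o_def)
    then show "smooth_on (coord T \<alpha> ` cdom T \<alpha>) (f' \<alpha> \<circ> cinv T \<alpha>)"
      by (rule smooth_on_scale_components[OF s \<alpha>]) (rule eq[OF \<alpha>])
  qed
qed

context
  fixes h assumes h: "gravitational_field T h"
begin

lemma pseudo_riemannian_metric_of: "pseudo_riemannian_metric T (metric_of T h)"
  using h by (simp add: gravitational_field_def)

lemma det_grav_nonzero:
  assumes "\<alpha> \<in> atlas T" "p \<in> cdom T \<alpha>"
  shows "det (h \<alpha> p) \<noteq> 0"
proof -
  have "det (metric_of T h \<alpha> p) \<noteq> 0"
    using pseudo_riemannian_metric_of assms by (auto simp: pseudo_riemannian_metric_def)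
  then show ?thesis
    by (cases "grav T") (auto simp: metric_of_def metric_comp_def det_mul)
qed

lemma smooth_grav:
  assumes "\<alpha> \<in> atlas T"
  shows "smooth_on (crange \<alpha>) (\<lambda>x. h \<alpha> (cinv T \<alpha> x))"
proof (cases "grav T")
  case Metric
  then show ?thesis
    using smooth_on_metric[OF pseudo_riemannian_metric_of assms] by (simp add: metric_of_def metric_comp_def)
next
  case (Frame \<eta> \<Lambda>)
  then have "smooth_components T h" using h by (simp add: gravitational_field_def)
  then show ?thesis using assms by (simp add: smooth_components_def crange_def o_def)
qed

text \<open>For a frame \<open>e\<close>, inserting
  \<open>\<delta>g = 2 \<omega> e^T \<eta> e\<close> into
  \<open>1/2 \<eta>^-1 e^-T \<delta>g\<close> cancels everything but \<open>\<omega> e\<close>. The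
  matrix \<open>\<eta>\<close> is invertible because it is diagonal with entries of absolute value 1
  and so squares to the identity.\<close>

lemma vary_grav_weyl:
  assumes "\<alpha> \<in> atlas T" "p \<in> cdom T \<alpha>"
  shows "vary_grav T (weyl_metric_variation T \<omega> h) t h \<alpha> p = (1 + t * (grav_weight * \<omega> p)) *\<^sub>R h \<alpha> p"
proof (cases "grav T")
  case Metric
  then show ?thesis
    by (simp add: vary_grav_def grav_variation_def weyl_metric_variation_def metric_of_def metric_comp_def
        grav_weight_def algebra_simps)
next
  case (Frame \<eta> \<Lambda>)
  have inv: "invertible (h \<alpha> p)" using det_grav_nonzero[OF assms] by (simp add: invertible_det_nz)
  have hi: "h \<alpha> p ** matrix_inv (h \<alpha> p) = mat 1"
    by (rule matrix_inv_cancel(1)[OF inv])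
  have eta: "(\<forall>a b. (a \<noteq> b \<longrightarrow> \<eta> $ a $ b = 0) \<and> \<bar>\<eta> $ a $ a\<bar> = 1)"
    using frame Frame by (simp add: frame_structure_def)
  have "\<eta> ** \<eta> = mat 1"
  proof -
    have "(\<Sum>k\<in>UNIV. \<eta> $ i $ k * \<eta> $ k $ j) = (if i = j then 1 else 0)" for i j
    proof -
      have "(\<Sum>k\<in>UNIV. \<eta> $ i $ k * \<eta> $ k $ j) = (\<Sum>k\<in>UNIV. if k = i then \<eta> $ i $ i * \<eta> $ i $ j else 0)"
        using eta by (intro sum.cong) auto
      also have "\<dots> = \<eta> $ i $ i * \<eta> $ i $ j" by simp
      also have "\<dots> = (if i = j then 1 else 0)"
        using eta by (auto simp: power2_eq_square[symmetric] abs_square_eq_1)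
      finally show ?thesis .
    qed
    then show ?thesis by (simp add: matrix_matrix_mult_def mat_def vec_eq_iff)
  qed
  then have "invertible \<eta>" by (auto simp: invertible_def)
  then have ei: "matrix_inv \<eta> ** \<eta> = mat 1" by (rule matrix_inv_cancel(2))
  have "transpose (matrix_inv (h \<alpha> p)) ** transpose (h \<alpha> p) = transpose (h \<alpha> p ** matrix_inv (h \<alpha> p))"
    by (simp add: matrix_transpose_mul)
  then have ht: "transpose (matrix_inv (h \<alpha> p)) ** transpose (h \<alpha> p) = mat 1"
    by (simp add: hi)
  have "matrix_inv \<eta> ** transpose (matrix_inv (h \<alpha> p)) ** (transpose (h \<alpha> p) ** \<eta> ** h \<alpha> p) =
      matrix_inv \<eta> ** (transpose (matrix_inv (h \<alpha> p)) ** transpose (h \<alpha> p)) ** \<eta> ** h \<alpha> p"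
    by (simp add: matrix_mul_assoc)
  also have "\<dots> = h \<alpha> p" by (simp add: ht ei)
  finally have *: "matrix_inv \<eta> ** transpose (matrix_inv (h \<alpha> p)) ** (transpose (h \<alpha> p) ** \<eta> ** h \<alpha> p) = h \<alpha> p" .
  show ?thesis
    using Frame by (simp add: vary_grav_def grav_variation_def weyl_metric_variation_def metric_of_def metric_comp_def
        grav_weight_def scaleR_matrix_mult * algebra_simps)
qed

lemma metric_of_vary_grav_weyl:
  assumes "\<alpha> \<in> atlas T" "p \<in> cdom T \<alpha>"
  shows "metric_of T (vary_grav T (weyl_metric_variation T \<omega> h) t h) \<alpha> p =
    weyl_factor \<omega> t p ^ metric_power *\<^sub>R metric_of T h \<alpha> p"
  by (simp add: metric_of_def vary_grav_weyl[OF assms] metric_comp_scaleR weyl_factor_def)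

text \<open>The transformation laws of metric and frame are linear, so they survive a pointwise
  factor, and positivity of the factor keeps the metric nondegenerate.\<close>

lemma gravitational_field_vary_weyl:
  assumes \<omega>: "smooth_function T \<omega>" and pos: "\<And>p. 0 < weyl_factor \<omega> t p"
  shows "gravitational_field T (vary_grav T (weyl_metric_variation T \<omega> h) t h)" (is "gravitational_field T ?h")
proof -
  note g = pseudo_riemannian_metric_of[unfolded pseudo_riemannian_metric_def]
  have "covariant_tensor2 T (metric_of T ?h)"
    by (rule covariant_tensor2_scale[OF smooth_function_power[OF smooth_weyl_factor[OF \<omega>]] _ metric_of_vary_grav_weyl])
      (use g in auto)
  moreover have "symmetric_components T (metric_of T ?h)"
    using g by (simp add: symmetric_components_def metric_of_vary_grav_weyl transpose_scalar)
  moreover have "det (metric_of T ?h \<alpha> p) \<noteq> 0" if "\<alpha> \<in> atlas T" "p \<in> cdom T \<alpha>" for \<alpha> p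
    using that g pos[of p] by (simp add: metric_of_vary_grav_weyl det_scaleR)
  moreover have "case grav T of Metric \<Rightarrow> True | Frame \<eta> \<Lambda> \<Rightarrow> smooth_components T ?h \<and>
        (\<forall>\<alpha>\<in>atlas T. \<forall>\<beta>\<in>atlas T. \<forall>p \<in> cdom T \<alpha> \<inter> cdom T \<beta>.
           ?h \<alpha> p = \<Lambda> \<alpha> \<beta> p ** ?h \<beta> p ** jac T \<beta> \<alpha> p)"
  proof (cases "grav T")
    case (Frame \<eta> \<Lambda>)
    have "smooth_components T ?h"
      unfolding smooth_components_def
    proof
      fix \<alpha> assume \<alpha>: "\<alpha> \<in> atlas T"
      show "smooth_on (coord T \<alpha> ` cdom T \<alpha>) (?h \<alpha> \<circ> cinv T \<alpha>)"
        by (rule smooth_on_scale_components[OF smooth_weyl_factor[OF \<omega>, where t = t] \<alpha> smooth_grav[OF \<alpha>]])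
          (simp add: vary_grav_weyl[OF \<alpha>] weyl_factor_def)
    qed
    moreover have "?h \<alpha> p = \<Lambda> \<alpha> \<beta> p ** ?h \<beta> p ** jac T \<beta> \<alpha> p"
      if \<alpha>: "\<alpha> \<in> atlas T" and \<beta>: "\<beta> \<in> atlas T" and p: "p \<in> cdom T \<alpha> \<inter> cdom T \<beta>" for \<alpha> \<beta> p
    proof -
      have "h \<alpha> p = \<Lambda> \<alpha> \<beta> p ** h \<beta> p ** jac T \<beta> \<alpha> p"
        using conjunct2[OF conjunct2[OF h[unfolded gravitational_field_def Frame gravity.case]]] \<alpha> \<beta> p by blast
      then show ?thesis
        unfolding vary_grav_weyl[OF \<alpha> IntD1[OF p]] vary_grav_weyl[OF \<beta> IntD2[OF p]] scaleR_matrix_mult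
        by (rule arg_cong)
    qed
    ultimately show ?thesis unfolding Frame gravity.case by (intro conjI ballI)
  qed simp
  ultimately show ?thesis
    unfolding gravitational_field_def pseudo_riemannian_metric_def by (intro conjI ballI)
qed

end

end


section \<open>The first variation of the action\<close>

text \<open>The directional derivatives along \<open>Basis\<close> are bounded on a compact ball,
  their sum bounds the operator norm, and the mean value inequality on the convex open ball gives
  the constant.\<close>

lemma C1_locally_Lipschitz:
  fixes f :: "'a::euclidean_space \<Rightarrow> real"
  assumes W: "open W" and f: "Ck_on 1 W f" and y: "y \<in> W"
  shows "\<exists>r C. 0 < r \<and> 0 \<le> C \<and> ball y r \<subseteq> W \<and>
    (\<forall>a\<in>ball y r. \<forall>b\<in>ball y r. \<bar>f a - f b\<bar> \<le> C * norm (a - b))"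
proof -
  have f1: "Ck_on (Suc 0) W f" using f by simp
  obtain r where r: "0 < r" "cball y r \<subseteq> W"
    using W y open_contains_cball by blast
  have "\<exists>B. \<forall>x\<in>cball y r. \<bar>frechet_derivative f (at x) b\<bar> \<le> B" for b
  proof -
    have "continuous_on (cball y r) (\<lambda>x. frechet_derivative f (at x) b)"
      by (rule continuous_on_subset[OF Ck_on_imp_continuous_on[OF Ck_on_SucD(2)[OF f1]] r(2)])
    from compact_imp_bounded[OF compact_continuous_image[OF this compact_cball]]
    show ?thesis by (auto simp: bounded_iff)
  qed
  then have "\<forall>b. \<exists>B. \<forall>x\<in>cball y r. \<bar>frechet_derivative f (at x) b\<bar> \<le> B" by blast
  from choice[OF this] obtain B where "\<forall>b. \<forall>x\<in>cball y r. \<bar>frechet_derivative f (at x) b\<bar> \<le> B b" ..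
  then have B: "\<bar>frechet_derivative f (at x) b\<bar> \<le> B b" if "x \<in> cball y r" for b x
    using that by blast
  define C where "C = (\<Sum>b\<in>Basis. \<bar>B b\<bar>)"
  have C: "onorm (frechet_derivative f (at x)) \<le> C" if x: "x \<in> ball y r" for x
  proof (rule onorm_le)
    fix v :: 'a
    have xc: "x \<in> cball y r" using x by auto
    have lin: "linear (frechet_derivative f (at x))"
      using has_derivative_linear[OF Ck_on_SucD(1)[OF f1]] xc r by blast
    have "frechet_derivative f (at x) v = (\<Sum>b\<in>Basis. (v \<bullet> b) * frechet_derivative f (at x) b)"
      by (rule linear_eq_sum_Basis[OF lin, unfolded real_scaleR_def])
    then have "norm (frechet_derivative f (at x) v) \<le> (\<Sum>b\<in>Basis. \<bar>(v \<bullet> b) * frechet_derivative f (at x) b\<bar>)"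
      by (simp add: sum_abs)
    also have "\<dots> \<le> (\<Sum>b\<in>Basis. \<bar>B b\<bar> * norm v)"
    proof (rule sum_mono)
      fix b :: 'a assume "b \<in> Basis"
      then have "\<bar>v \<bullet> b\<bar> \<le> norm v" by (rule Basis_le_norm)
      moreover have "\<bar>frechet_derivative f (at x) b\<bar> \<le> \<bar>B b\<bar>" using B[OF xc, of b] by linarith
      ultimately show "\<bar>(v \<bullet> b) * frechet_derivative f (at x) b\<bar> \<le> \<bar>B b\<bar> * norm v"
        unfolding abs_mult by (subst mult.commute) (intro mult_mono, auto)
    qed
    finally show "norm (frechet_derivative f (at x) v) \<le> C * norm v"
      by (simp add: C_def sum_distrib_right)
  qed
  have sub: "ball y r \<subseteq> W" using r ball_subset_cball by blast
  have "\<bar>f a - f b\<bar> \<le> C * norm (a - b)" if "a \<in> ball y r" "b \<in> ball y r" for a b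
  proof -
    have "norm (f a - f b) \<le> C * norm (a - b)"
      by (rule differentiable_bound[OF convex_ball _ C that])
        (use Ck_on_SucD(1)[OF f1] sub in \<open>blast intro: has_derivative_at_withinI\<close>)
    then show ?thesis by simp
  qed
  moreover have "0 \<le> C" by (simp add: C_def sum_nonneg)
  ultimately show ?thesis
    by (intro exI[of _ r] exI[of _ C] conjI ballI r(1) sub)
qed

lemma has_real_derivative_along_line:
  fixes f :: "'a::real_normed_vector \<Rightarrow> real"
  assumes "(f has_derivative f') (at y)"
  shows "((\<lambda>t. f (y + t *\<^sub>R v)) has_real_derivative f' v) (at 0)"
proof -
  have "((\<lambda>t. y + t *\<^sub>R v) has_derivative (\<lambda>h. h *\<^sub>R v)) (at 0)"
    by (auto intro!: derivative_eq_intros)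
  from has_derivative_compose[OF this, of f f'] assms
  have "((\<lambda>t. f (y + t *\<^sub>R v)) has_derivative (\<lambda>h. f' (h *\<^sub>R v))) (at 0)" by simp
  moreover have "f' (h *\<^sub>R v) = f' v * h" for h
    using linear_cmul[OF has_derivative_linear[OF assms]] by (simp add: mult.commute)
  ultimately show ?thesis by (simp add: has_field_derivative_def)
qed

lemma jet_var_0: "jet_var (\<lambda>_. 0) (\<lambda>_. 0) x = 0"
  by (simp add: jet_var_def frechet_derivative_const vec_eq_iff zero_prod_def)

context matter_theory
begin

lemma open_jets: "\<alpha> \<in> atlas T \<Longrightarrow> open (jet_domain T \<alpha>)"
  by (rule open_jet_domain[OF open_bcoord_image])

lemma smooth_lagr: "\<alpha> \<in> atlas T \<Longrightarrow> smooth_on (jet_domain T \<alpha>) (lagr T \<alpha>)"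
  using conjunct1[OF lagrangian[unfolded matter_lagrangian_def]] by blast

text \<open>The jet as a map on coordinate space, whose smoothness can be read off slot by
  slot.\<close>

definition chart_jet :: "('c \<Rightarrow> 'm \<Rightarrow> real^'n^'n) \<Rightarrow> ('m \<Rightarrow> 'e) \<Rightarrow> 'c \<Rightarrow> real^'n \<Rightarrow> ('n, 'k) jet" where
  "chart_jet h \<phi> \<alpha> x = base_jet x + jet_var (ucomp \<phi> \<alpha>) (\<lambda>x. h \<alpha> (cinv T \<alpha> x)) x"

text \<open>The delicate slot is the second derivative of \<open>h\<close>: between the two
  derivatives \<open>pdiff\<close> passes to the manifold and back, which is the identity on the
  chart range. Since the range is open, this is enough for a derivative.\<close>

lemma jet_of_eq:
  assumes \<phi>: "matter_field T \<phi>" and \<alpha>: "\<alpha> \<in> atlas T" and p: "p \<in> udom \<phi> \<alpha>"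
  shows "jet_of T h \<phi> \<alpha> p = chart_jet h \<phi> \<alpha> (coord T \<alpha> p)"
proof -
  have pc: "p \<in> cdom T \<alpha>" using udom_subset[OF \<phi> \<alpha>] p by blast
  have u: "fcoord T \<alpha> \<circ> \<phi> \<circ> cinv T \<alpha> = ucomp \<phi> \<alpha>"
    by (simp add: fun_eq_iff ucomp_def[OF \<phi> \<alpha>])
  have hh: "h \<alpha> \<circ> cinv T \<alpha> = (\<lambda>x. h \<alpha> (cinv T \<alpha> x))" by (simp add: o_def)
  have "frechet_derivative ((\<lambda>q. frechet_derivative (\<lambda>x. h \<alpha> (cinv T \<alpha> x)) (at (coord T \<alpha> q)) v) \<circ> cinv T \<alpha>) (at (coord T \<alpha> p)) =
     frechet_derivative (\<lambda>y. frechet_derivative (\<lambda>x. h \<alpha> (cinv T \<alpha> x)) (at y) v) (at (coord T \<alpha> p))" for v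
    by (rule frechet_derivative_cong_open[OF open_crange[OF \<alpha>] coord_in_crange[OF \<alpha> pc]])
      (simp add: coord_cinv[OF \<alpha>])
  then show ?thesis
    by (simp add: jet_of_def chart_jet_def base_jet_def jet_var_def pdiff_def[abs_def] u hh cinv_coord[OF \<alpha> pc]
        ucomp_def[OF \<phi> \<alpha>])
qed

lemma jet_of_in_jet_domain:
  assumes h: "gravitational_field T h" and \<phi>: "matter_field T \<phi>" and \<alpha>: "\<alpha> \<in> atlas T" and p: "p \<in> udom \<phi> \<alpha>"
  shows "jet_of T h \<phi> \<alpha> p \<in> jet_domain T \<alpha>"
proof -
  have "det (h \<alpha> p) \<noteq> 0"
    using det_grav_nonzero[OF h \<alpha>] udom_subset[OF \<phi> \<alpha>] p by blast
  moreover have "(coord T \<alpha> p, fcoord T \<alpha> (\<phi> p)) = bcoord T \<alpha> (\<phi> p)"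
    by (simp add: bcoord_def proj_matter[OF \<phi>])
  ultimately show ?thesis
    using p by (auto simp: jet_domain_def jet_of_def udom_iff[OF \<phi>])
qed

lemma smooth_grav_uX:
  "gravitational_field T h \<Longrightarrow> matter_field T \<phi> \<Longrightarrow> \<alpha> \<in> atlas T \<Longrightarrow> smooth_on (uX \<phi> \<alpha>) (\<lambda>x. h \<alpha> (cinv T \<alpha> x))"
  by (rule smooth_on_subset[OF smooth_grav uX_subset])

lemma smooth_chart_jet:
  assumes "gravitational_field T h" "matter_field T \<phi>" "\<alpha> \<in> atlas T"
  shows "smooth_on (uX \<phi> \<alpha>) (chart_jet h \<phi> \<alpha>)"
  unfolding chart_jet_def[abs_def]
  by (intro smooth_on_add smooth_on_base_jet smooth_on_jet_var open_uX smooth_ucomp smooth_grav_uX assms)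

lemma chart_jet_in_jet_domain:
  assumes h: "gravitational_field T h" and \<phi>: "matter_field T \<phi>" and \<alpha>: "\<alpha> \<in> atlas T"
  shows "chart_jet h \<phi> \<alpha> ` uX \<phi> \<alpha> \<subseteq> jet_domain T \<alpha>"
  using jet_of_in_jet_domain[OF assms] jet_of_eq[OF \<phi> \<alpha>] by (auto simp: uX_def[OF \<phi> \<alpha>])

lemma continuous_on_udom_chart:
  assumes \<phi>: "matter_field T \<phi>" and \<alpha>: "\<alpha> \<in> atlas T" and F: "continuous_on (uX \<phi> \<alpha>) F"
  shows "continuous_on (udom \<phi> \<alpha>) (\<lambda>p. F (coord T \<alpha> p))"
  by (rule continuous_on_chart_pullback[OF \<alpha> udom_subset[OF \<phi> \<alpha>] F[unfolded uX_def[OF \<phi> \<alpha>]]]) simp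

lemma continuous_on_udom_UNIV:
  assumes \<phi>: "matter_field T \<phi>" and F: "\<And>\<alpha>. \<alpha> \<in> atlas T \<Longrightarrow> continuous_on (udom \<phi> \<alpha>) F"
  shows "continuous_on UNIV F"
proof (rule continuous_on_UNIV_local)
  fix p
  obtain \<alpha> where \<alpha>: "\<alpha> \<in> atlas T" "p \<in> udom \<phi> \<alpha>" using ex_udom[OF \<phi>] by blast
  show "\<exists>U. open U \<and> p \<in> U \<and> continuous_on U F"
    by (intro exI[of _ "udom \<phi> \<alpha>"] conjI open_udom \<phi> F \<alpha>)
qed

text \<open>The compatibility condition in \<open>matter_lagrangian\<close> makes the chart chosen
  in the definition immaterial.\<close>

lemma lagrangian_function_chart:
  assumes h: "gravitational_field T h" and \<phi>: "matter_field T \<phi>" and \<alpha>: "\<alpha> \<in> atlas T" and p: "p \<in> udom \<phi> \<alpha>"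
  shows "lagrangian_function T h \<phi> p = lagr T \<alpha> (jet_of T h \<phi> \<alpha> p)"
proof -
  define \<beta> where "\<beta> = (SOME \<beta>. \<beta> \<in> atlas T \<and> \<phi> p \<in> fdom T \<beta>)"
  have p': "\<phi> p \<in> fdom T \<alpha>" using p by (simp add: udom_iff[OF \<phi>])
  then have "\<exists>\<beta>. \<beta> \<in> atlas T \<and> \<phi> p \<in> fdom T \<beta>" using \<alpha> by blast
  then have \<beta>: "\<beta> \<in> atlas T" "\<phi> p \<in> fdom T \<beta>"
    unfolding \<beta>_def by (rule someI2_ex, blast)+
  have "lagr T \<beta> (jet_of T h \<phi> \<beta> p) = lagr T \<alpha> (jet_of T h \<phi> \<alpha> p)"
    using conjunct2[OF lagrangian[unfolded matter_lagrangian_def]] h \<phi> \<alpha> \<beta> p' by blast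
  then show ?thesis
    unfolding lagrangian_function_def Let_def \<beta>_def[symmetric] .
qed

lemma continuous_lagrangian_function:
  assumes h: "gravitational_field T h" and \<phi>: "matter_field T \<phi>"
  shows "continuous_on UNIV (lagrangian_function T h \<phi>)"
proof (rule continuous_on_udom_UNIV[OF \<phi>])
  fix \<alpha> assume \<alpha>: "\<alpha> \<in> atlas T"
  have "continuous_on (uX \<phi> \<alpha>) (\<lambda>x. lagr T \<alpha> (chart_jet h \<phi> \<alpha> x))"
    by (rule continuous_on_compose2[OF smooth_on_imp_continuous_on[OF smooth_lagr[OF \<alpha>]]
          smooth_on_imp_continuous_on[OF smooth_chart_jet[OF h \<phi> \<alpha>]] chart_jet_in_jet_domain[OF h \<phi> \<alpha>]])
  from continuous_on_udom_chart[OF \<phi> \<alpha> this]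
  show "continuous_on (udom \<phi> \<alpha>) (lagrangian_function T h \<phi>)"
    by (simp add: lagrangian_function_chart[OF h \<phi> \<alpha>] jet_of_eq[OF \<phi> \<alpha>] cong: continuous_on_cong)
qed

lemma udom_weyl_vary:
  assumes "matter_field T \<phi>" "smooth_function T \<omega>" "\<alpha> \<in> atlas T"
  shows "udom (weyl_vary_matter T \<omega> t \<phi>) \<alpha> = udom \<phi> \<alpha>"
  unfolding udom_def[OF assms(1)] udom_def[OF matter_field_weyl_vary[OF assms(1,2)]]
    weyl_vary_matter_fdom_iff[OF assms(1,3)] ..

section \<open>The matter variation of the Lagrangian\<close>

context
  fixes h \<phi> \<omega>
  assumes h: "gravitational_field T h" and \<phi>: "matter_field T \<phi>" and \<omega>: "smooth_function T \<omega>"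
begin

definition weyl_dh :: "'c \<Rightarrow> real^'n \<Rightarrow> real^'n^'n" where
  "weyl_dh \<alpha> x = (grav_weight * \<omega> (cinv T \<alpha> x)) *\<^sub>R h \<alpha> (cinv T \<alpha> x)"

abbreviation "h_vary t \<equiv> vary_grav T (weyl_metric_variation T \<omega> h) t h"
abbreviation "\<phi>_vary t \<equiv> weyl_vary_matter T \<omega> t \<phi>"

lemma smooth_weyl_dh: 
  assumes "\<alpha> \<in> atlas T"
  shows "smooth_on (uX \<phi> \<alpha>) (weyl_dh \<alpha>)"
  unfolding weyl_dh_def[abs_def]
  by (intro smooth_on_scaleR smooth_on_mult smooth_on_const smooth_grav_uX smooth_on_omega open_uX assms h \<phi> \<omega>)

text \<open>In a chart the varied components are affine in \<open>t\<close>, and jets are linear in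
  the components apart from the coordinate slot. So every varied jet runs along a straight line in
  jet space, and derivatives in \<open>t\<close> are directional derivatives of
  \<open>lagr\<close>.\<close>

lemma jet_of_vary:
  assumes \<alpha>: "\<alpha> \<in> atlas T" and p: "p \<in> udom \<phi> \<alpha>"
  shows "jet_of T (h_vary t) (\<phi>_vary t) \<alpha> p =
      jet_of T h \<phi> \<alpha> p + t *\<^sub>R jet_var (weyl_du \<phi> \<alpha> \<omega>) (weyl_dh \<alpha>) (coord T \<alpha> p)" (is ?both)
    and "jet_of T (h_vary t) \<phi> \<alpha> p = jet_of T h \<phi> \<alpha> p + t *\<^sub>R jet_var (\<lambda>_. 0) (weyl_dh \<alpha>) (coord T \<alpha> p)" (is ?grav)
    and "jet_of T h (\<phi>_vary t) \<alpha> p = jet_of T h \<phi> \<alpha> p + t *\<^sub>R jet_var (weyl_du \<phi> \<alpha> \<omega>) (\<lambda>_. 0) (coord T \<alpha> p)" (is ?matter)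
proof -
  note X = open_uX[OF \<phi> \<alpha>]
  have x: "coord T \<alpha> p \<in> uX \<phi> \<alpha>" using p by (simp add: uX_def[OF \<phi> \<alpha>])
  note \<phi>' = matter_field_weyl_vary[OF \<phi> \<omega>, of t]
  have p': "p \<in> udom (\<phi>_vary t) \<alpha>" using p udom_weyl_vary[OF \<phi> \<omega> \<alpha>] by simp
  note su = smooth_ucomp[OF \<phi> \<alpha>] and sh = smooth_grav_uX[OF h \<phi> \<alpha>]
  note sdu = smooth_weyl_du[OF \<phi> \<alpha> \<omega>] and sdh = smooth_weyl_dh[OF \<alpha>]
  have u: "ucomp (\<phi>_vary t) \<alpha> y = ucomp \<phi> \<alpha> y + t *\<^sub>R weyl_du \<phi> \<alpha> \<omega> y" if "y \<in> uX \<phi> \<alpha>" for y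
    using fcoord_weyl_vary_matter[OF \<phi> \<alpha> that] by (simp add: ucomp_def[OF \<phi>' \<alpha>])
  have hh: "h_vary t \<alpha> (cinv T \<alpha> y) = h \<alpha> (cinv T \<alpha> y) + t *\<^sub>R weyl_dh \<alpha> y" if "y \<in> uX \<phi> \<alpha>" for y
    using that uX_subset[OF \<phi> \<alpha>] cinv_in_cdom[OF \<alpha>]
    by (simp add: vary_grav_weyl[OF h \<alpha>] weyl_dh_def subset_iff algebra_simps)
  have "jet_var (ucomp (\<phi>_vary t) \<alpha>) (\<lambda>x. h_vary t \<alpha> (cinv T \<alpha> x)) (coord T \<alpha> p) =
      jet_var (\<lambda>y. ucomp \<phi> \<alpha> y + t *\<^sub>R weyl_du \<phi> \<alpha> \<omega> y) (\<lambda>y. h \<alpha> (cinv T \<alpha> y) + t *\<^sub>R weyl_dh \<alpha> y) (coord T \<alpha> p)"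
    by (rule jet_var_cong[OF X x u hh])
  with jet_var_add_scaleR[OF X x su sdu sh sdh] show ?both
    by (simp add: jet_of_eq[OF \<phi>' \<alpha> p'] jet_of_eq[OF \<phi> \<alpha> p] chart_jet_def)
  have "jet_var (ucomp \<phi> \<alpha>) (\<lambda>x. h_vary t \<alpha> (cinv T \<alpha> x)) (coord T \<alpha> p) =
      jet_var (\<lambda>y. ucomp \<phi> \<alpha> y + t *\<^sub>R 0) (\<lambda>y. h \<alpha> (cinv T \<alpha> y) + t *\<^sub>R weyl_dh \<alpha> y) (coord T \<alpha> p)"
    by (rule jet_var_cong[OF X x _ hh]) auto
  with jet_var_add_scaleR[OF X x su smooth_on_const[of _ 0] sh sdh] show ?grav
    by (simp add: jet_of_eq[OF \<phi> \<alpha> p] chart_jet_def)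
  have "jet_var (ucomp (\<phi>_vary t) \<alpha>) (\<lambda>x. h \<alpha> (cinv T \<alpha> x)) (coord T \<alpha> p) =
      jet_var (\<lambda>y. ucomp \<phi> \<alpha> y + t *\<^sub>R weyl_du \<phi> \<alpha> \<omega> y) (\<lambda>y. h \<alpha> (cinv T \<alpha> y) + t *\<^sub>R 0) (coord T \<alpha> p)"
    by (rule jet_var_cong[OF X x u]) auto
  with jet_var_add_scaleR[OF X x su sdu sh smooth_on_const[of _ 0]] show ?matter
    by (simp add: jet_of_eq[OF \<phi>' \<alpha> p'] jet_of_eq[OF \<phi> \<alpha> p] chart_jet_def)
qed

text \<open>The gravitational parts of the two directions cancel, which removes the variation of
  \<open>h\<close> from the derivative of the difference of Lagrangians.\<close>

lemma jet_var_matter_eq: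
  assumes \<alpha>: "\<alpha> \<in> atlas T" and x: "x \<in> uX \<phi> \<alpha>"
  shows "jet_var (weyl_du \<phi> \<alpha> \<omega>) (weyl_dh \<alpha>) x - jet_var (\<lambda>_. 0) (weyl_dh \<alpha>) x =
    jet_var (weyl_du \<phi> \<alpha> \<omega>) (\<lambda>_. 0) x"
  using jet_var_add_scaleR[OF open_uX[OF \<phi> \<alpha>] x smooth_on_const smooth_weyl_du[OF \<phi> \<alpha> \<omega>] smooth_weyl_dh[OF \<alpha>] smooth_on_const,
      of 0 1 0] by simp

text \<open>Differentiating the scalar Lagrangian, with \<open>h\<close> held fixed, gives a
  function on space-time without reference to a chart; chart formulas are derived from it.\<close>

definition matter_variation :: "'m \<Rightarrow> real" where
  "matter_variation p = deriv (\<lambda>t. lagrangian_function T h (\<phi>_vary t) p) 0"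

lemma matter_variation_chart:
  assumes \<alpha>: "\<alpha> \<in> atlas T" and p: "p \<in> udom \<phi> \<alpha>"
  shows "matter_variation p = frechet_derivative (lagr T \<alpha>) (at (jet_of T h \<phi> \<alpha> p))
    (jet_var (weyl_du \<phi> \<alpha> \<omega>) (\<lambda>_. 0) (coord T \<alpha> p))"
proof -
  have "lagrangian_function T h (\<phi>_vary t) p =
      lagr T \<alpha> (jet_of T h \<phi> \<alpha> p + t *\<^sub>R jet_var (weyl_du \<phi> \<alpha> \<omega>) (\<lambda>_. 0) (coord T \<alpha> p))" for t
    using lagrangian_function_chart[OF h matter_field_weyl_vary[OF \<phi> \<omega>] \<alpha>, of p t] p
      udom_weyl_vary[OF \<phi> \<omega> \<alpha>] jet_of_vary(3)[OF \<alpha> p] by simp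
  moreover have "((\<lambda>t. lagr T \<alpha> (jet_of T h \<phi> \<alpha> p + t *\<^sub>R jet_var (weyl_du \<phi> \<alpha> \<omega>) (\<lambda>_. 0) (coord T \<alpha> p)))
      has_real_derivative frechet_derivative (lagr T \<alpha>) (at (jet_of T h \<phi> \<alpha> p))
    (jet_var (weyl_du \<phi> \<alpha> \<omega>) (\<lambda>_. 0) (coord T \<alpha> p))) (at 0)"
    by (rule has_real_derivative_along_line[OF smooth_on_has_derivative[OF smooth_lagr[OF \<alpha>] jet_of_in_jet_domain[OF h \<phi> \<alpha> p]]])
  ultimately show ?thesis
    unfolding matter_variation_def by (simp add: DERIV_imp_deriv)
qed

text \<open>As in the chain rule, the direction of differentiation moves with the point, so the
  derivative is expanded over \<open>Basis\<close>.\<close>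

lemma continuous_matter_variation: "continuous_on UNIV matter_variation"
proof (rule continuous_on_udom_UNIV[OF \<phi>])
  fix \<alpha> assume \<alpha>: "\<alpha> \<in> atlas T"
  let ?N = "jet_var (weyl_du \<phi> \<alpha> \<omega>) (\<lambda>_. 0)"
  let ?G = "\<lambda>x. \<Sum>b\<in>Basis. (?N x \<bullet> b) *\<^sub>R frechet_derivative (lagr T \<alpha>) (at (chart_jet h \<phi> \<alpha> x)) b"
  have "continuous_on (uX \<phi> \<alpha>) ?G"
  proof (intro continuous_on_sum continuous_on_scaleR continuous_on_inner continuous_on_const)
    show "continuous_on (uX \<phi> \<alpha>) ?N"
      by (intro smooth_on_imp_continuous_on smooth_on_jet_var open_uX smooth_weyl_du smooth_on_const \<phi> \<alpha> \<omega>)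
    show "continuous_on (uX \<phi> \<alpha>) (\<lambda>x. frechet_derivative (lagr T \<alpha>) (at (chart_jet h \<phi> \<alpha> x)) b)" for b
      by (rule continuous_on_compose2[OF smooth_on_imp_continuous_on[OF smooth_on_frechet_derivative[OF smooth_lagr[OF \<alpha>]]]
          smooth_on_imp_continuous_on[OF smooth_chart_jet[OF h \<phi> \<alpha>]] chart_jet_in_jet_domain[OF h \<phi> \<alpha>]])
  qed
  from continuous_on_udom_chart[OF \<phi> \<alpha> this]
  have c: "continuous_on (udom \<phi> \<alpha>) (\<lambda>p. ?G (coord T \<alpha> p))" .
  have "?G (coord T \<alpha> p) = matter_variation p" if p: "p \<in> udom \<phi> \<alpha>" for p
    unfolding matter_variation_chart[OF \<alpha> p] jet_of_eq[OF \<phi> \<alpha> p, symmetric]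
    by (rule linear_eq_sum_Basis[symmetric]) 
      (rule has_derivative_linear[OF smooth_on_has_derivative[OF smooth_lagr[OF \<alpha>] jet_of_in_jet_domain[OF h \<phi> \<alpha> p]]])
  with c show "continuous_on (udom \<phi> \<alpha>) matter_variation"
    by (rule continuous_on_eq)
qed

text \<open>Derivatives of \<open>\<omega>\<close> enter through the jet, so it is the vanishing on
  a whole neighbourhood that makes the direction 0.\<close>

lemma matter_variation_eq_0:
  assumes U: "open U" "p \<in> U" "\<And>q. q \<in> U \<Longrightarrow> \<omega> q = 0"
  shows "matter_variation p = 0"
proof -
  obtain \<alpha> where \<alpha>: "\<alpha> \<in> atlas T" and p: "p \<in> udom \<phi> \<alpha>" using ex_udom[OF \<phi>] by blast
  let ?V = "coord T \<alpha> ` (U \<inter> udom \<phi> \<alpha>)"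
  have V: "open ?V" by (rule open_coord_image[OF \<alpha>]) (use U open_udom[OF \<phi> \<alpha>] udom_subset[OF \<phi> \<alpha>] in auto)
  have "jet_var (weyl_du \<phi> \<alpha> \<omega>) (\<lambda>_. 0 :: real^'n^'n) (coord T \<alpha> p) = jet_var (\<lambda>_. 0) (\<lambda>_. 0) (coord T \<alpha> p)"
  proof (rule jet_var_cong[OF V])
    show "coord T \<alpha> p \<in> ?V" using U p by blast
    fix y assume "y \<in> ?V"
    then obtain q where q: "q \<in> U" "q \<in> udom \<phi> \<alpha>" "y = coord T \<alpha> q" by blast
    then have "cinv T \<alpha> y = q" using cinv_coord[OF \<alpha>] udom_subset[OF \<phi> \<alpha>] by blast
    then show "weyl_du \<phi> \<alpha> \<omega> y = 0"
      using U(3)[OF q(1)] by (simp add: weyl_du_def[OF \<phi> \<alpha>] vec_eq_iff)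
  qed simp
  then show ?thesis
    unfolding matter_variation_chart[OF \<alpha> p] jet_var_0
    using linear_0[OF has_derivative_linear[OF smooth_on_has_derivative[OF smooth_lagr[OF \<alpha>] jet_of_in_jet_domain[OF h \<phi> \<alpha> p]]]]
    by simp
qed

end

end


section \<open>Differentiation under the integral\<close>

context matter_theory
begin

context
  fixes h \<phi> \<omega> K
  assumes h: "gravitational_field T h" and \<phi>: "matter_field T \<phi>" and \<omega>: "smooth_function T \<omega>"
    and K: "compact K" and supp: "closure {p. \<omega> p \<noteq> 0} \<subseteq> K"
begin

private abbreviation "h_var t \<equiv> vary_grav T (weyl_metric_variation T \<omega> h) t h"
private abbreviation "\<phi>_var t \<equiv> weyl_vary_matter T \<omega> t \<phi>"
private abbreviation "vol \<equiv> volume T (metric_of T h)"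

text \<open>Outside \<open>K\<close> the function \<open>\<omega>\<close> vanishes and on
  \<open>K\<close> it is bounded, so one \<open>\<epsilon>\<close> serves all points. The bound 1/2
  keeps the factor positive and below 3/2, the value used later for the majorant.\<close>

lemma weyl_factor_near_1: "\<exists>\<epsilon>>0. \<forall>t p. \<bar>t\<bar> < \<epsilon> \<longrightarrow> \<bar>weyl_factor \<omega> t p - 1\<bar> < 1 / 2"
proof -
  obtain B where B: "\<forall>y\<in>\<omega> ` K. norm y \<le> B"
    using compact_imp_bounded[OF compact_continuous_image[OF continuous_on_subset[OF smooth_function_continuous[OF \<omega>] subset_UNIV] K]]
    unfolding bounded_iff by blast
  have B': "\<bar>\<omega> p\<bar> \<le> \<bar>B\<bar>" for p
  proof (cases "p \<in> K")
    case False
    then have "\<omega> p = 0" using supp closure_subset[of "{p. \<omega> p \<noteq> 0}"] by blast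
    then show ?thesis by simp
  next
    case True
    then have "norm (\<omega> p) \<le> B" using B by blast
    then show ?thesis by simp
  qed
  have c: "0 \<le> grav_weight" "grav_weight \<le> 2" by (simp_all add: grav_weight_def split: gravity.split)
  \<comment> \<open>The deviation from 1 is at most
    \<open>\<bar>t\<bar> * (2 * (\<bar>B\<bar> + 1))\<close>, hence the 4; the added 1 covers
    \<open>B = 0\<close>.\<close>
  define \<epsilon> where "\<epsilon> = 1 / (4 * (\<bar>B\<bar> + 1))"
  have "\<bar>weyl_factor \<omega> t p - 1\<bar> < 1 / 2" if "\<bar>t\<bar> < \<epsilon>" for t p
  proof -
    have "\<bar>weyl_factor \<omega> t p - 1\<bar> = \<bar>t\<bar> * (grav_weight * \<bar>\<omega> p\<bar>)"
      using c by (simp add: weyl_factor_def abs_mult)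
    also have "\<dots> \<le> \<bar>t\<bar> * (2 * (\<bar>B\<bar> + 1))"
      using c B'[of p] by (intro mult_left_mono mult_mono) auto
    also have "\<dots> < \<epsilon> * (2 * (\<bar>B\<bar> + 1))"
      using that by (intro mult_strict_right_mono) auto
    also have "\<dots> = 1 / 2" by (simp add: \<epsilon>_def field_simps)
    finally show ?thesis .
  qed
  moreover have "0 < \<epsilon>" by (simp add: \<epsilon>_def)
  ultimately show ?thesis by blast
qed

lemma lagrangian_function_vary:
  assumes grav: "gravitational_field T (h_var t)" and \<alpha>: "\<alpha> \<in> atlas T" and p: "p \<in> udom \<phi> \<alpha>"
  shows "lagrangian_function T (h_var t) (\<phi>_var t) p = lagr T \<alpha> (jet_of T h \<phi> \<alpha> p +
      t *\<^sub>R jet_var (weyl_du \<phi> \<alpha> \<omega>) (weyl_dh h \<omega> \<alpha>) (coord T \<alpha> p))"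
    and "lagrangian_function T (h_var t) \<phi> p = lagr T \<alpha> (jet_of T h \<phi> \<alpha> p +
      t *\<^sub>R jet_var (\<lambda>_. 0) (weyl_dh h \<omega> \<alpha>) (coord T \<alpha> p))"
proof -
  have "p \<in> udom (\<phi>_var t) \<alpha>" using p udom_weyl_vary[OF \<phi> \<omega> \<alpha>] by simp
  from lagrangian_function_chart[OF grav matter_field_weyl_vary[OF \<phi> \<omega>] \<alpha> this]
  show "lagrangian_function T (h_var t) (\<phi>_var t) p = lagr T \<alpha> (jet_of T h \<phi> \<alpha> p +
      t *\<^sub>R jet_var (weyl_du \<phi> \<alpha> \<omega>) (weyl_dh h \<omega> \<alpha>) (coord T \<alpha> p))"
    by (simp add: jet_of_vary(1)[OF h \<phi> \<omega> \<alpha> p])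
  from lagrangian_function_chart[OF grav \<phi> \<alpha> p]
  show "lagrangian_function T (h_var t) \<phi> p = lagr T \<alpha> (jet_of T h \<phi> \<alpha> p +
      t *\<^sub>R jet_var (\<lambda>_. 0) (weyl_dh h \<omega> \<alpha>) (coord T \<alpha> p))"
    by (simp add: jet_of_vary(2)[OF h \<phi> \<omega> \<alpha> p])
qed

text \<open>For \<open>p\<close> near \<open>p0\<close> and small \<open>t\<close> both varied jets
  lie in one ball on which \<open>lagr\<close> is Lipschitz. They differ by \<open>t\<close> times
  the difference of two locally bounded directions, which gives a bound linear in
  \<open>t\<close>.\<close>

lemma lagrangian_difference_locally_bounded:
  "\<exists>U \<epsilon> C. open U \<and> p0 \<in> U \<and> 0 < \<epsilon> \<and> (\<forall>p\<in>U. \<forall>t. \<bar>t\<bar> < \<epsilon> \<longrightarrow> gravitational_field T (h_var t) \<longrightarrow>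
      \<bar>lagrangian_function T (h_var t) (\<phi>_var t) p - lagrangian_function T (h_var t) \<phi> p\<bar> \<le> C * \<bar>t\<bar>)"
proof -
  obtain \<alpha> where \<alpha>: "\<alpha> \<in> atlas T" and p0: "p0 \<in> udom \<phi> \<alpha>" using ex_udom[OF \<phi>] by blast
  let ?J = "\<lambda>p. jet_of T h \<phi> \<alpha> p"
  let ?V = "\<lambda>p. jet_var (weyl_du \<phi> \<alpha> \<omega>) (weyl_dh h \<omega> \<alpha>) (coord T \<alpha> p)"
  let ?W = "\<lambda>p. jet_var (\<lambda>_. 0 :: real^'k) (weyl_dh h \<omega> \<alpha>) (coord T \<alpha> p)"
  obtain r C where r: "0 < r" "0 \<le> C" and
    lip: "\<forall>a\<in>ball (?J p0) r. \<forall>b\<in>ball (?J p0) r. \<bar>lagr T \<alpha> a - lagr T \<alpha> b\<bar> \<le> C * norm (a - b)"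
    using C1_locally_Lipschitz[OF open_jets[OF \<alpha>] smooth_onD[OF smooth_lagr[OF \<alpha>]]
          jet_of_in_jet_domain[OF h \<phi> \<alpha> p0]] by (elim exE conjE)
  have cJ: "continuous_on (udom \<phi> \<alpha>) ?J"
    using continuous_on_udom_chart[OF \<phi> \<alpha> smooth_on_imp_continuous_on[OF smooth_chart_jet[OF h \<phi> \<alpha>]]]
    by (rule continuous_on_eq) (simp add: jet_of_eq[OF \<phi> \<alpha>])
  have cV: "continuous_on (udom \<phi> \<alpha>) ?V"
    by (rule continuous_on_udom_chart[OF \<phi> \<alpha> smooth_on_imp_continuous_on[OF smooth_on_jet_var[OF open_uX[OF \<phi> \<alpha>]
      smooth_weyl_du[OF \<phi> \<alpha> \<omega>] smooth_weyl_dh[OF h \<phi> \<omega> \<alpha>]]]])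
  have cW: "continuous_on (udom \<phi> \<alpha>) ?W"
    by (rule continuous_on_udom_chart[OF \<phi> \<alpha> smooth_on_imp_continuous_on[OF smooth_on_jet_var[OF open_uX[OF \<phi> \<alpha>]
      smooth_on_const smooth_weyl_dh[OF h \<phi> \<omega> \<alpha>]]]])
  define m where "m = norm (?V p0) + norm (?W p0) + 1"
  have m: "0 < m" unfolding m_def by (intro add_nonneg_pos add_nonneg_nonneg norm_ge_zero zero_less_one)
  \<comment> \<open>Half of the radius is spent on moving from \<open>p0\<close> to
    \<open>p\<close>, the other half on the variation, whence \<open>r / (2 * m)\<close> as the
    bound for \<open>t\<close>. The 1 in \<open>m\<close> makes the second inequality strict at
    \<open>p0\<close>.\<close>
  define U where "U = {p \<in> udom \<phi> \<alpha>. dist (?J p0) (?J p) < r / 2 \<and> norm (?V p) + norm (?W p) < m}"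
  have "open U"
  proof -
    have "continuous_on (udom \<phi> \<alpha>) (\<lambda>p. dist (?J p0) (?J p))"
      "continuous_on (udom \<phi> \<alpha>) (\<lambda>p. norm (?V p) + norm (?W p))"
      by (intro continuous_on_dist continuous_on_const cJ continuous_on_add continuous_on_norm cV cW)+
    from continuous_openin_preimage_gen[OF this(1) open_lessThan[of "r / 2"]]
      continuous_openin_preimage_gen[OF this(2) open_lessThan[of m]]
    have "open (udom \<phi> \<alpha> \<inter> (\<lambda>p. dist (?J p0) (?J p)) -` {..<r / 2})"
      "open (udom \<phi> \<alpha> \<inter> (\<lambda>p. norm (?V p) + norm (?W p)) -` {..<m})"
      using open_udom[OF \<phi> \<alpha>] openin_open_eq by blast+
    then have "open ((udom \<phi> \<alpha> \<inter> (\<lambda>p. dist (?J p0) (?J p)) -` {..<r / 2}) \<inter>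
        (udom \<phi> \<alpha> \<inter> (\<lambda>p. norm (?V p) + norm (?W p)) -` {..<m}))" by (rule open_Int)
    moreover have "U = (udom \<phi> \<alpha> \<inter> (\<lambda>p. dist (?J p0) (?J p)) -` {..<r / 2}) \<inter>
        (udom \<phi> \<alpha> \<inter> (\<lambda>p. norm (?V p) + norm (?W p)) -` {..<m})" by (auto simp: U_def)
    ultimately show ?thesis by simp
  qed
  moreover have "p0 \<in> U" using p0 r by (simp add: U_def m_def)
  moreover have "0 < r / (2 * m)" using r m by simp
  moreover have "\<bar>lagrangian_function T (h_var t) (\<phi>_var t) p - lagrangian_function T (h_var t) \<phi> p\<bar> \<le> (C * m) * \<bar>t\<bar>"
    if p: "p \<in> U" and t: "\<bar>t\<bar> < r / (2 * m)" and grav: "gravitational_field T (h_var t)" for p t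
  proof -
    have pu: "p \<in> udom \<phi> \<alpha>" and d: "dist (?J p0) (?J p) < r / 2" and vw: "norm (?V p) + norm (?W p) < m"
      using p by (auto simp: U_def)
    have inb: "?J p + t *\<^sub>R v \<in> ball (?J p0) r" if "norm v < m" for v
    proof -
      have "\<bar>t\<bar> * norm v \<le> r / (2 * m) * m"
        using t that m by (intro mult_mono) auto
      also have "\<dots> = r / 2" using m by simp
      finally have "norm (t *\<^sub>R v) \<le> r / 2" by simp
      then have "dist (?J p) (?J p + t *\<^sub>R v) \<le> r / 2" by (simp add: dist_norm)
      then show ?thesis using d dist_triangle[of "?J p0" "?J p + t *\<^sub>R v" "?J p"] by simp
    qed
    have "norm (?V p) < m" "norm (?W p) < m"
      using vw norm_ge_zero[of "?V p"] norm_ge_zero[of "?W p"] by linarith+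
    from bspec[OF bspec[OF lip inb[OF this(1)]] inb[OF this(2)]]
    have "\<bar>lagrangian_function T (h_var t) (\<phi>_var t) p - lagrangian_function T (h_var t) \<phi> p\<bar> \<le>
        C * norm (t *\<^sub>R ?V p - t *\<^sub>R ?W p)"
      by (simp add: lagrangian_function_vary[OF grav \<alpha> pu])
    also have "norm (t *\<^sub>R ?V p - t *\<^sub>R ?W p) = \<bar>t\<bar> * norm (?V p - ?W p)"
      by (simp add: scaleR_diff_right[symmetric])
    also have "C * (\<bar>t\<bar> * norm (?V p - ?W p)) \<le> C * (\<bar>t\<bar> * m)"
      using vw norm_triangle_ineq4[of "?V p" "?W p"] r by (intro mult_left_mono) auto
    finally show ?thesis by (simp add: mult_ac)
  qed
  ultimately show ?thesis by blast
qed

text \<open>Finitely many of the local neighbourhoods cover the compact \<open>K\<close>; the least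
  \<open>\<epsilon>\<close> and the sum of the absolute constants work for all of them.\<close>

lemma lagrangian_difference_bounded:
  "\<exists>\<epsilon> C. 0 < \<epsilon> \<and> (\<forall>p\<in>K. \<forall>t. \<bar>t\<bar> < \<epsilon> \<longrightarrow> gravitational_field T (h_var t) \<longrightarrow>
      \<bar>lagrangian_function T (h_var t) (\<phi>_var t) p - lagrangian_function T (h_var t) \<phi> p\<bar> \<le> C * \<bar>t\<bar>)"
proof -
  let ?D = "\<lambda>p t. \<bar>lagrangian_function T (h_var t) (\<phi>_var t) p - lagrangian_function T (h_var t) \<phi> p\<bar>"
  \<comment> \<open>Neighbourhood, \<open>\<epsilon>\<close> and constant are packed into a triple
    so that one choice function supplies all three.\<close>
  have "\<forall>q. \<exists>z. open (fst z) \<and> q \<in> fst z \<and> 0 < fst (snd z) \<and> (\<forall>p\<in>fst z. \<forall>t. \<bar>t\<bar> < fst (snd z) \<longrightarrow>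
      gravitational_field T (h_var t) \<longrightarrow> ?D p t \<le> snd (snd z) * \<bar>t\<bar>)"
  proof
    fix q
    obtain U \<epsilon> C where "open U \<and> q \<in> U \<and> 0 < \<epsilon> \<and> (\<forall>p\<in>U. \<forall>t. \<bar>t\<bar> < \<epsilon> \<longrightarrow>
      gravitational_field T (h_var t) \<longrightarrow> ?D p t \<le> C * \<bar>t\<bar>)"
      using lagrangian_difference_locally_bounded[of q] by (elim exE)
    then show "\<exists>z. open (fst z) \<and> q \<in> fst z \<and> 0 < fst (snd z) \<and> (\<forall>p\<in>fst z. \<forall>t. \<bar>t\<bar> < fst (snd z) \<longrightarrow>
      gravitational_field T (h_var t) \<longrightarrow> ?D p t \<le> snd (snd z) * \<bar>t\<bar>)"
      by (intro exI[of _ "(U, \<epsilon>, C)"]) simp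
  qed
  from choice[OF this] obtain Z where Z: "\<forall>q. open (fst (Z q)) \<and> q \<in> fst (Z q) \<and> 0 < fst (snd (Z q)) \<and>
      (\<forall>p\<in>fst (Z q). \<forall>t. \<bar>t\<bar> < fst (snd (Z q)) \<longrightarrow> gravitational_field T (h_var t) \<longrightarrow>
        ?D p t \<le> snd (snd (Z q)) * \<bar>t\<bar>)" ..
  have cov: "K \<subseteq> (\<Union>q\<in>UNIV. fst (Z q))" using Z by blast
  obtain Q where Q: "finite Q" "K \<subseteq> (\<Union>q\<in>Q. fst (Z q))"
    by (rule compactE_image[OF K _ cov]) (use Z in auto)
  \<comment> \<open>The inserted 1 keeps the minimum meaningful when \<open>Q\<close> is
    empty.\<close>
  define \<epsilon> where "\<epsilon> = Min (insert 1 ((\<lambda>q. fst (snd (Z q))) ` Q))"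
  define C where "C = (\<Sum>q\<in>Q. \<bar>snd (snd (Z q))\<bar>)"
  have \<epsilon>: "0 < \<epsilon>" using Q(1) Z by (simp add: \<epsilon>_def)
  have "?D p t \<le> C * \<bar>t\<bar>" if p: "p \<in> K" and t: "\<bar>t\<bar> < \<epsilon>" and grav: "gravitational_field T (h_var t)" for p t
  proof -
    obtain q where q: "q \<in> Q" "p \<in> fst (Z q)" using p Q by blast
    have "\<epsilon> \<le> fst (snd (Z q))" unfolding \<epsilon>_def using Q(1) q(1) by (intro Min_le) auto
    then have "?D p t \<le> snd (snd (Z q)) * \<bar>t\<bar>" using Z q(2) t grav by auto
    also have "\<dots> \<le> C * \<bar>t\<bar>"
    proof (rule mult_right_mono)
      have "\<bar>snd (snd (Z q))\<bar> \<le> C"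
        unfolding C_def using Q(1) q(1) by (intro member_le_sum) auto
      then show "snd (snd (Z q)) \<le> C" by linarith
    qed simp
    finally show ?thesis .
  qed
  with \<epsilon> show ?thesis by blast
qed

text \<open>Both jets start at the same point for \<open>t = 0\<close>, so the derivative of the
  difference is the derivative of \<open>lagr\<close> along the difference of the two directions,
  where only the matter part remains.\<close>

lemma lagrangian_difference_quotient:
  assumes "\<forall>\<^sub>F t in at 0. gravitational_field T (h_var t)"
  shows "((\<lambda>t. (lagrangian_function T (h_var t) (\<phi>_var t) p - lagrangian_function T (h_var t) \<phi> p) / t)
    \<longlongrightarrow> matter_variation h \<phi> \<omega> p) (at 0)"
proof -
  obtain \<alpha> where \<alpha>: "\<alpha> \<in> atlas T" and p: "p \<in> udom \<phi> \<alpha>" using ex_udom[OF \<phi>] by blast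
  have x: "coord T \<alpha> p \<in> uX \<phi> \<alpha>" using p by (simp add: uX_def[OF \<phi> \<alpha>])
  let ?J = "jet_of T h \<phi> \<alpha> p"
  let ?V = "jet_var (weyl_du \<phi> \<alpha> \<omega>) (weyl_dh h \<omega> \<alpha>) (coord T \<alpha> p)"
  let ?W = "jet_var (\<lambda>_. 0 :: real^'k) (weyl_dh h \<omega> \<alpha>) (coord T \<alpha> p)"
  let ?L = "frechet_derivative (lagr T \<alpha>) (at ?J)"
  note der = smooth_on_has_derivative[OF smooth_lagr[OF \<alpha>] jet_of_in_jet_domain[OF h \<phi> \<alpha> p]]
  have "((\<lambda>t. lagr T \<alpha> (?J + t *\<^sub>R ?V) - lagr T \<alpha> (?J + t *\<^sub>R ?W)) has_real_derivative ?L ?V - ?L ?W) (at 0)"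
    by (intro DERIV_diff has_real_derivative_along_line der)
  moreover have "?L ?V - ?L ?W = matter_variation h \<phi> \<omega> p"
    unfolding matter_variation_chart[OF h \<phi> \<omega> \<alpha> p] jet_var_matter_eq[OF h \<phi> \<omega> \<alpha> x, symmetric]
    by (rule linear_diff[OF has_derivative_linear[OF der], symmetric])
  ultimately have "((\<lambda>t. (lagr T \<alpha> (?J + t *\<^sub>R ?V) - lagr T \<alpha> (?J + t *\<^sub>R ?W)) / t) \<longlongrightarrow> matter_variation h \<phi> \<omega> p) (at 0)"
    by (simp add: has_field_derivative_iff)
  then show ?thesis
    by (rule Lim_transform_eventually)
      (use assms in \<open>eventually_elim, simp add: lagrangian_function_vary[OF _ \<alpha> p]\<close>)
qed

text \<open>Both actions use the same varied metric, hence the same conformal factor over the fixed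
  \<open>vol\<close>. Continuity on the compact \<open>K\<close> makes the integrands integrable, so
  the integrals may be subtracted.\<close>

lemma action_vary_difference:
  assumes grav: "gravitational_field T (h_var t)" and pos: "\<And>p. 0 < weyl_factor \<omega> t p"
  shows "action T K (h_var t) (\<phi>_var t) - action T K (h_var t) \<phi> =
    (LINT p|vol. indicator K p * (sqrt ((weyl_factor \<omega> t p ^ metric_power) ^ CARD('n)) *
      (lagrangian_function T (h_var t) (\<phi>_var t) p - lagrangian_function T (h_var t) \<phi> p)))"
proof -
  let ?r = "\<lambda>p. sqrt ((weyl_factor \<omega> t p ^ metric_power) ^ CARD('n))"
  note g = pseudo_riemannian_metric_of[OF h] and g' = pseudo_riemannian_metric_of[OF grav]
  have [measurable]: "K \<in> sets borel" using compact_imp_closed[OF K] by auto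
  have cw: "continuous_on UNIV (weyl_factor \<omega> t)"
    by (rule smooth_function_continuous[OF smooth_weyl_factor[OF \<omega>]])
  have cr: "continuous_on UNIV ?r"
    by (intro continuous_on_real_sqrt continuous_on_power cw)
  have r0: "0 \<le> ?r p" for p using pos[of p] by simp
  have vol: "volume T (metric_of T (h_var t)) = density vol (\<lambda>p. ennreal (?r p))"
    by (rule volume_scale[OF g g' continuous_on_power[OF cw] _ metric_of_vary_grav_weyl[OF h]]) (use pos in auto)
  have [measurable_cong]: "sets vol = sets borel" by (rule sets_volume[OF g])
  have act: "action T K (h_var t) \<psi> = (LINT p|vol. indicator K p * (?r p * lagrangian_function T (h_var t) \<psi> p))"
    and int: "integrable vol (\<lambda>p. indicator K p * (?r p * lagrangian_function T (h_var t) \<psi> p))"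
    if \<psi>: "matter_field T \<psi>" for \<psi>
  proof -
    note cL = continuous_lagrangian_function[OF grav \<psi>]
    have [measurable]: "lagrangian_function T (h_var t) \<psi> \<in> borel_measurable borel" "?r \<in> borel_measurable borel"
      by (intro borel_measurable_continuous_onI cL cr)+
    have "action T K (h_var t) \<psi> = (LINT p|vol. ?r p *\<^sub>R (indicator K p *\<^sub>R lagrangian_function T (h_var t) \<psi> p))"
      unfolding action_def set_lebesgue_integral_def vol
      by (rule integral_density) (use r0 in auto)
    also have "\<dots> = (LINT p|vol. indicator K p * (?r p * lagrangian_function T (h_var t) \<psi> p))"
      by (simp add: mult_ac)
    finally show "action T K (h_var t) \<psi> = (LINT p|vol. indicator K p * (?r p * lagrangian_function T (h_var t) \<psi> p))" .
    have c: "continuous_on K (\<lambda>p. ?r p * lagrangian_function T (h_var t) \<psi> p)"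
      by (intro continuous_on_mult continuous_on_subset[OF cr] continuous_on_subset[OF cL] subset_UNIV)
    obtain B where "\<forall>y\<in>(\<lambda>p. ?r p * lagrangian_function T (h_var t) \<psi> p) ` K. norm y \<le> B"
      using compact_imp_bounded[OF compact_continuous_image[OF c K]] unfolding bounded_iff by blast
    then show "integrable vol (\<lambda>p. indicator K p * (?r p * lagrangian_function T (h_var t) \<psi> p))"
      by (intro integrable_volume_compact[OF g K, where B = B]) auto
  qed
  note \<phi>' = matter_field_weyl_vary[OF \<phi> \<omega>, of t]
  show ?thesis
    unfolding act[OF \<phi>] act[OF \<phi>'] Bochner_Integration.integral_diff[OF int[OF \<phi>'] int[OF \<phi>], symmetric]
    by (simp add: algebra_simps)
qed

text \<open>The quotients converge pointwise to \<open>matter_variation\<close>, the conformal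
  factor tends to 1, and the uniform linear bound provides a constant multiple of the indicator of
  \<open>K\<close> as majorant.\<close>

lemma action_difference_derivative:
  "((\<lambda>t. action T K (h_var t) (\<phi>_var t) - action T K (h_var t) \<phi>) has_real_derivative
    (LINT p|vol. indicator K p * matter_variation h \<phi> \<omega> p)) (at 0)"
proof -
  let ?D = "\<lambda>t p. lagrangian_function T (h_var t) (\<phi>_var t) p - lagrangian_function T (h_var t) \<phi> p"
  let ?r = "\<lambda>t p. sqrt ((weyl_factor \<omega> t p ^ metric_power) ^ CARD('n))"
  note g = pseudo_riemannian_metric_of[OF h]
  have [measurable_cong]: "sets vol = sets borel" by (rule sets_volume[OF g])
  have [measurable]: "K \<in> sets borel" using compact_imp_closed[OF K] by auto
  obtain \<epsilon>1 where \<epsilon>1: "0 < \<epsilon>1" "\<And>t p. \<bar>t\<bar> < \<epsilon>1 \<Longrightarrow> \<bar>weyl_factor \<omega> t p - 1\<bar> < 1 / 2"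
    using weyl_factor_near_1 by blast
  have pos: "0 < weyl_factor \<omega> t p" if "\<bar>t\<bar> < \<epsilon>1" for t p using \<epsilon>1(2)[OF that, of p] by linarith
  have grav: "gravitational_field T (h_var t)" if "\<bar>t\<bar> < \<epsilon>1" for t
    by (rule gravitational_field_vary_weyl[OF h \<omega> pos[OF that]])
  have near0: "\<forall>\<^sub>F t in at 0. \<bar>t\<bar> < \<epsilon>1"
    using \<epsilon>1(1) by (auto simp: eventually_at dist_real_def)
  then have ev: "\<forall>\<^sub>F t in at 0. gravitational_field T (h_var t)"
    by (rule eventually_mono) (rule grav)
  obtain \<epsilon>2 C where \<epsilon>2: "0 < \<epsilon>2" and
    bnd: "\<And>p t. p \<in> K \<Longrightarrow> \<bar>t\<bar> < \<epsilon>2 \<Longrightarrow> gravitational_field T (h_var t) \<Longrightarrow> \<bar>?D t p\<bar> \<le> C * \<bar>t\<bar>"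
    using lagrangian_difference_bounded by blast
  define \<epsilon> where "\<epsilon> = min \<epsilon>1 \<epsilon>2"
  have \<epsilon>: "0 < \<epsilon>" using \<epsilon>1 \<epsilon>2 by (simp add: \<epsilon>_def)
  define R where "R = sqrt (((3 / 2) ^ metric_power) ^ CARD('n))"
  have rR: "0 \<le> ?r t p" "?r t p \<le> R" if "\<bar>t\<bar> < \<epsilon>1" for t p
  proof -
    have "weyl_factor \<omega> t p \<le> 3 / 2" using \<epsilon>1(2)[OF that, of p] by linarith
    then show "?r t p \<le> R"
      unfolding R_def using pos[OF that, of p] by (intro real_sqrt_le_mono power_mono) auto
    show "0 \<le> ?r t p" using pos[OF that, of p] by simp
  qed
  have "((\<lambda>t. (LINT p|vol. indicator K p * (?r t p * ?D t p)) / t) \<longlongrightarrow>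
      (LINT p|vol. indicator K p * matter_variation h \<phi> \<omega> p)) (at 0)"
    unfolding tendsto_at_iff_sequentially comp_def
  proof (intro allI impI)
    fix X :: "nat \<Rightarrow> real"
    assume X0: "\<forall>n. X n \<in> UNIV - {0}" and X: "X \<longlonglongrightarrow> 0"
    obtain N where N: "\<And>n. n \<ge> N \<Longrightarrow> \<bar>X n\<bar> < \<epsilon>"
      using LIMSEQ_D[OF X \<epsilon>] by auto
    \<comment> \<open>The tail of the sequence satisfies all smallness conditions, so that each
      varied \<open>h\<close> is a gravitational field and the bounds apply;
      \<open>LIMSEQ_offset\<close> returns to the whole sequence.\<close>
    define Y where "Y n = X (n + N)" for n
    have Y: "\<bar>Y n\<bar> < \<epsilon>1" "\<bar>Y n\<bar> < \<epsilon>2" "Y n \<noteq> 0" for n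
      using N[of "n + N"] X0 by (auto simp: Y_def \<epsilon>_def)
    have Y0: "Y \<longlonglongrightarrow> 0" unfolding Y_def using LIMSEQ_ignore_initial_segment[OF X] .
    have YF: "filterlim Y (at 0) sequentially"
      unfolding filterlim_at using Y0 Y(3) by auto
    have m1[measurable]: "?D (Y n) \<in> borel_measurable borel" for n
      by (intro borel_measurable_diff borel_measurable_continuous_onI continuous_lagrangian_function grav Y \<phi>
          matter_field_weyl_vary \<omega>)
    have m2[measurable]: "?r (Y n) \<in> borel_measurable borel" for n
      by (intro borel_measurable_continuous_onI continuous_on_real_sqrt continuous_on_power
          smooth_function_continuous[OF smooth_weyl_factor[OF \<omega>]])
    have m3[measurable]: "matter_variation h \<phi> \<omega> \<in> borel_measurable borel"
      by (intro borel_measurable_continuous_onI continuous_matter_variation h \<phi> \<omega>)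
    have "(\<lambda>n. LINT p|vol. indicator K p * (?r (Y n) p * (?D (Y n) p / Y n))) \<longlonglongrightarrow>
        (LINT p|vol. indicator K p * matter_variation h \<phi> \<omega> p)"
    proof (rule integral_dominated_convergence[where w = "\<lambda>p. indicator K p * (R * \<bar>C\<bar>)"])
      show "integrable vol (\<lambda>p. indicator K p * (R * \<bar>C\<bar>))"
        by (rule integrable_volume_compact[OF g K, where B = "R * \<bar>C\<bar>"])
          (auto simp: R_def abs_mult)
      show "AE p in vol. (\<lambda>n. indicator K p * (?r (Y n) p * (?D (Y n) p / Y n))) \<longlonglongrightarrow> indicator K p * matter_variation h \<phi> \<omega> p"
      proof (rule AE_I2)
        fix p
        have "(\<lambda>n. ?D (Y n) p / Y n) \<longlonglongrightarrow> matter_variation h \<phi> \<omega> p"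
          by (rule filterlim_compose[OF lagrangian_difference_quotient[OF ev] YF])
        moreover have "(\<lambda>n. ?r (Y n) p) \<longlonglongrightarrow> sqrt (((1 + 0 * (grav_weight * \<omega> p)) ^ metric_power) ^ CARD('n))"
          unfolding weyl_factor_def by (intro tendsto_intros Y0)
        ultimately have "(\<lambda>n. ?r (Y n) p * (?D (Y n) p / Y n)) \<longlonglongrightarrow> 1 * matter_variation h \<phi> \<omega> p"
          by (intro tendsto_mult) simp_all
        then show "(\<lambda>n. indicator K p * (?r (Y n) p * (?D (Y n) p / Y n))) \<longlonglongrightarrow> indicator K p * matter_variation h \<phi> \<omega> p"
          by (intro tendsto_mult tendsto_const) simp
      qed
      show "AE p in vol. norm (indicator K p * (?r (Y n) p * (?D (Y n) p / Y n))) \<le> indicator K p * (R * \<bar>C\<bar>)" for n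
      proof (rule AE_I2)
        fix p
        show "norm (indicator K p * (?r (Y n) p * (?D (Y n) p / Y n))) \<le> indicator K p * (R * \<bar>C\<bar>)"
        proof (cases "p \<in> K")
          case True
          have "\<bar>?D (Y n) p\<bar> \<le> C * \<bar>Y n\<bar>" by (rule bnd[OF True Y(2) grav[OF Y(1)]])
          also have "\<dots> \<le> \<bar>C\<bar> * \<bar>Y n\<bar>" by (intro mult_right_mono) auto
          finally have "\<bar>?D (Y n) p / Y n\<bar> \<le> \<bar>C\<bar>"
            using Y(3)[of n] by (simp add: abs_divide pos_divide_le_eq)
          then have "?r (Y n) p * \<bar>?D (Y n) p / Y n\<bar> \<le> R * \<bar>C\<bar>"
            using rR[OF Y(1)[of n], of p] by (intro mult_mono) (auto simp: R_def)
          then show ?thesis using True rR(1)[OF Y(1)[of n], of p] by (simp only: indicator_simps real_norm_def abs_mult abs_of_nonneg mult_1_left abs_1 if_True)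
        qed simp
      qed
    qed measurable
    moreover have "(\<lambda>n. LINT p|vol. indicator K p * (?r (Y n) p * (?D (Y n) p / Y n))) =
        (\<lambda>n. (LINT p|vol. indicator K p * (?r (Y n) p * ?D (Y n) p)) / Y n)"
    proof
      fix n
      have "(LINT p|vol. indicator K p * (?r (Y n) p * (?D (Y n) p / Y n))) =
          (LINT p|vol. indicator K p * (?r (Y n) p * ?D (Y n) p) / Y n)"
        by (simp only: times_divide_eq_right)
      then show "(LINT p|vol. indicator K p * (?r (Y n) p * (?D (Y n) p / Y n))) =
        (LINT p|vol. indicator K p * (?r (Y n) p * ?D (Y n) p)) / Y n"
        by (simp only: Bochner_Integration.integral_divide_zero)
    qed
    ultimately have "(\<lambda>n. (LINT p|vol. indicator K p * (?r (Y n) p * ?D (Y n) p)) / Y n) \<longlonglongrightarrow>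
        (LINT p|vol. indicator K p * matter_variation h \<phi> \<omega> p)" by simp
    then show "(\<lambda>n. (LINT p|vol. indicator K p * (?r (X n) p * ?D (X n) p)) / X n) \<longlonglongrightarrow>
        (LINT p|vol. indicator K p * matter_variation h \<phi> \<omega> p)"
      unfolding Y_def by (rule LIMSEQ_offset)
  qed
  \<comment> \<open>At \<open>t = 0\<close> the matter field is unchanged, so the subtracted value
    of the difference of actions is 0.\<close>
  moreover have "\<forall>\<^sub>F t in at 0. (LINT p|vol. indicator K p * (?r t p * ?D t p)) / t =
      (action T K (h_var t) (\<phi>_var t) - action T K (h_var t) \<phi> - (action T K (h_var 0) (\<phi>_var 0) - action T K (h_var 0) \<phi>)) / (t - 0)"
    using near0
  proof eventually_elim
    case (elim t)
    show ?case
      unfolding action_vary_difference[OF grav[OF elim] pos[OF elim]] weyl_vary_matter_0[OF \<phi>] by simp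
  qed
  ultimately show ?thesis
    unfolding has_field_derivative_iff by (rule Lim_transform_eventually)
qed

end

end


section \<open>Matter variations on shell\<close>

lemma Ck_on_matrix_mult:
  fixes f g :: "'a::euclidean_space \<Rightarrow> real^'n^'n::finite"
  assumes "open S" "Ck_on k S f" "Ck_on k S g"
  shows "Ck_on k S (\<lambda>x. f x ** g x)"
  unfolding matrix_matrix_mult_def
  by (intro Ck_on_vec_lambda Ck_on_sum Ck_on_mult Ck_on_nth assms)

lemma Ck_on_transpose:
  fixes f :: "'a::euclidean_space \<Rightarrow> real^'n^'n::finite"
  assumes "open S" "Ck_on k S f"
  shows "Ck_on k S (\<lambda>x. transpose (f x))"
  unfolding transpose_def
  by (intro Ck_on_vec_lambda Ck_on_nth assms)

lemma Ck_on_metric_comp: "Ck_on k UNIV (\<lambda>H :: real^'n::finite^'n. metric_comp G H)"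
proof (cases G)
  case Metric
  then show ?thesis
    by (simp add: metric_comp_def Ck_on_bounded_linear bounded_linear_ident)
next
  case (Frame \<eta> \<Lambda>)
  have "Ck_on k UNIV (\<lambda>H :: real^'n^'n. transpose H ** \<eta> ** H)"
    by (intro Ck_on_matrix_mult Ck_on_transpose Ck_on_const Ck_on_bounded_linear bounded_linear_ident open_UNIV)
  then show ?thesis using Frame by (simp add: metric_comp_def)
qed

text \<open>Splits a matter direction into the unit directions in which
  \<open>euler_lagrange\<close> differentiates.\<close>

lemma jet_matter_expansion:
  fixes u :: "real^'k::finite" and A :: "real^'n::finite^'k"
  shows "(0, u, A, 0, 0, 0) = (\<Sum>i\<in>UNIV. u $ i *\<^sub>R (0, axis i 1, 0, 0, 0, 0)) +
    (\<Sum>i\<in>UNIV. \<Sum>\<mu>\<in>UNIV. A $ i $ \<mu> *\<^sub>R ((0, 0, axis i (axis \<mu> 1), 0, 0, 0) :: ('n, 'k) jet))"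
proof -
  have u: "(\<Sum>i\<in>UNIV. u $ i *\<^sub>R axis i 1) = u"
    by (simp add: vec_eq_iff axis_def if_distrib sum.delta cong: if_cong)
  have A: "(\<Sum>i\<in>UNIV. \<Sum>\<mu>\<in>UNIV. A $ i $ \<mu> *\<^sub>R axis i (axis \<mu> 1)) = A"
  proof -
    have "(\<Sum>\<mu>\<in>UNIV. (A $ i $ \<mu> *\<^sub>R axis i (axis \<mu> 1 :: real^'n)) $ j $ \<nu>) = (if i = j then A $ j $ \<nu> else 0)" for i j \<nu>
      by (auto simp: axis_def if_distrib sum.delta cong: if_cong)
    then show ?thesis by (simp add: vec_eq_iff)
  qed
  show ?thesis
    by (simp add: prod_eq_iff fst_sum snd_sum u A)
qed

context matter_theory
begin

text \<open>The root of the determinant depends on the \<open>h\<close> slot only, so in a direction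
  whose \<open>h\<close> slot is 0 the Leibniz rule keeps a single term. Both directions occurring
  in \<open>euler_lagrange\<close> are of this kind.\<close>

lemma lagrangian_density_derivative:
  assumes h: "gravitational_field T h" and \<phi>: "matter_field T \<phi>" and \<alpha>: "\<alpha> \<in> atlas T" and p: "p \<in> udom \<phi> \<alpha>"
    and e: "fst (snd (snd (snd e))) = 0"
  shows "frechet_derivative (lagrangian_density T \<alpha>) (at (jet_of T h \<phi> \<alpha> p)) e =
    chart_density (metric_of T h) \<alpha> (coord T \<alpha> p) * frechet_derivative (lagr T \<alpha>) (at (jet_of T h \<phi> \<alpha> p)) e"
proof -
  let ?J = "jet_of T h \<phi> \<alpha> p"
  let ?\<pi> = "\<lambda>j :: ('n, 'k) jet. fst (snd (snd (snd j)))"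
  define s where "s H = sqrt \<bar>det (metric_comp (grav T) H)\<bar>" for H :: "real^'n^'n"
  define W where "W = {H :: real^'n^'n. det (metric_comp (grav T) H) \<noteq> 0}"
  have pc: "p \<in> cdom T \<alpha>" using udom_subset[OF \<phi> \<alpha>] p by blast
  have J: "?\<pi> ?J = h \<alpha> p" by (simp add: jet_of_def)
  have hW: "h \<alpha> p \<in> W"
    using pseudo_riemannian_metric_of[OF h] \<alpha> pc
    by (auto simp: W_def pseudo_riemannian_metric_def metric_of_def)
  have Cd: "Ck_on k UNIV (\<lambda>H. det (metric_comp (grav T) H))" for k
    by (intro Ck_on_det Ck_on_metric_comp open_UNIV)
  have W: "open W"
  proof -
    have "open ((\<lambda>H. det (metric_comp (grav T) H)) -` (- {0}))"
      by (rule open_vimage[OF _ Ck_on_imp_continuous_on[OF Cd]]) auto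
    then show ?thesis by (simp add: W_def vimage_def)
  qed
  have "Ck_on 1 W s"
    unfolding s_def[abs_def]
    by (rule Ck_on_compose[OF W _ _ C1_sqrt_abs Ck_on_subset[OF Cd]]) (auto simp: W_def)
  then have "Ck_on (Suc 0) W s" by simp
  from Ck_on_SucD(1)[OF this hW] have s: "(s has_derivative frechet_derivative s (at (h \<alpha> p))) (at (h \<alpha> p))" .
  have "(?\<pi> has_derivative ?\<pi>) (at ?J)"
    by (intro bounded_linear_imp_has_derivative bounded_linear_intros)
  from has_derivative_compose[OF this, of s "frechet_derivative s (at (h \<alpha> p))"] s
  have sJ: "((\<lambda>j. s (?\<pi> j)) has_derivative (\<lambda>j. frechet_derivative s (at (h \<alpha> p)) (?\<pi> j))) (at ?J)"
    by (simp add: J)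
  note L = smooth_on_has_derivative[OF smooth_lagr[OF \<alpha>] jet_of_in_jet_domain[OF h \<phi> \<alpha> p]]
  have eq: "lagrangian_density T \<alpha> = (\<lambda>j. s (?\<pi> j) * lagr T \<alpha> j)"
    by (auto simp: lagrangian_density_def s_def fun_eq_iff)
  have "frechet_derivative (lagrangian_density T \<alpha>) (at ?J) =
      (\<lambda>v. s (?\<pi> ?J) * frechet_derivative (lagr T \<alpha>) (at ?J) v + frechet_derivative s (at (h \<alpha> p)) (?\<pi> v) * lagr T \<alpha> ?J)"
    unfolding eq by (rule frechet_derivative_at[symmetric, OF has_derivative_mult[OF sJ L]])
  then show ?thesis
    using e linear_0[OF has_derivative_linear[OF s]]
    by (simp add: J s_def chart_density_def metric_of_def cinv_coord[OF \<alpha> pc])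
qed

context
  fixes h \<phi> \<alpha>
  assumes h: "gravitational_field T h" and \<phi>: "matter_field T \<phi>" and \<alpha>: "\<alpha> \<in> atlas T"
begin

private abbreviation "dens \<equiv> chart_density (metric_of T h) \<alpha>"
private abbreviation "L' x \<equiv> frechet_derivative (lagr T \<alpha>) (at (chart_jet h \<phi> \<alpha> x))"

text \<open>The canonical momentum density, i.e. the derivative of the Lagrangian density with
  respect to \<open>\<partial>\<^sub>\<mu> \<phi>\<^sup>i\<close>, evaluated along the
  fields.\<close>

definition momentum :: "'k \<Rightarrow> 'n \<Rightarrow> real^'n \<Rightarrow> real" where
  "momentum i \<mu> x = dens x * L' x (0, 0, axis i (axis \<mu> 1), 0, 0, 0)"

lemma C1_momentum: "Ck_on 1 (uX \<phi> \<alpha>) (momentum i \<mu>)"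
proof -
  have "smooth_on (uX \<phi> \<alpha>) (\<lambda>x. L' x e)" for e
    by (rule smooth_on_compose[OF open_uX[OF \<phi> \<alpha>] open_jets[OF \<alpha>] chart_jet_in_jet_domain[OF h \<phi> \<alpha>]
          smooth_on_frechet_derivative[OF smooth_lagr[OF \<alpha>]] smooth_chart_jet[OF h \<phi> \<alpha>]])
  from smooth_onD[OF this]
  have "Ck_on 1 (uX \<phi> \<alpha>) (\<lambda>x. L' x e)" for e .
  moreover have "Ck_on 1 (uX \<phi> \<alpha>) dens"
    by (rule Ck_on_subset[OF C1_chart_density[OF pseudo_riemannian_metric_of[OF h] \<alpha>] uX_subset[OF \<phi> \<alpha>]])
  ultimately show ?thesis
    unfolding momentum_def[abs_def] by (intro Ck_on_mult[OF open_uX[OF \<phi> \<alpha>]])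
qed

lemma momentum_has_derivative:
  "x \<in> uX \<phi> \<alpha> \<Longrightarrow> (momentum i \<mu> has_derivative frechet_derivative (momentum i \<mu>) (at x)) (at x)"
  by (rule Ck_on_SucD(1)[of 0]) (use C1_momentum in simp_all)

text \<open>The nonzero prefactor of the Euler-Lagrange derivative cancels, and the density
  derivative inside \<open>pdiff\<close> agrees with \<open>momentum\<close> on the open set
  \<open>uX\<close>, so their derivatives agree as well.\<close>

lemma on_shell_chart:
  assumes on: "on_shell T h \<phi>" and x: "x \<in> uX \<phi> \<alpha>"
  shows "dens x * L' x (0, axis i 1, 0, 0, 0, 0) =
    (\<Sum>\<mu>\<in>UNIV. frechet_derivative (momentum i \<mu>) (at x) (axis \<mu> 1))"
proof -
  obtain p where p: "p \<in> udom \<phi> \<alpha>" "x = coord T \<alpha> p" using x by (auto simp: uX_def[OF \<phi> \<alpha>])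
  have pc: "p \<in> cdom T \<alpha>" using udom_subset[OF \<phi> \<alpha>] p(1) by blast
  let ?D = "\<lambda>q. frechet_derivative (lagrangian_density T \<alpha>) (at (jet_of T h \<phi> \<alpha> q))"
  have Deq: "?D q e = dens (coord T \<alpha> q) * L' (coord T \<alpha> q) e"
    if "q \<in> udom \<phi> \<alpha>" "fst (snd (snd (snd e))) = 0" for q e
    using lagrangian_density_derivative[OF h \<phi> \<alpha> that] by (simp add: jet_of_eq[OF \<phi> \<alpha> that(1)])
  have pd: "pdiff T \<alpha> \<mu> (\<lambda>q. ?D q (0, 0, axis i (axis \<mu> 1), 0, 0, 0)) p =
      frechet_derivative (momentum i \<mu>) (at x) (axis \<mu> 1)" for \<mu>
  proof -
    have "frechet_derivative ((\<lambda>q. ?D q (0, 0, axis i (axis \<mu> 1), 0, 0, 0)) \<circ> cinv T \<alpha>) (at x) =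
        frechet_derivative (momentum i \<mu>) (at x)"
    proof (rule frechet_derivative_cong_open[OF open_uX[OF \<phi> \<alpha>] x])
      fix y assume y: "y \<in> uX \<phi> \<alpha>"
      have "coord T \<alpha> (cinv T \<alpha> y) = y" using coord_cinv[OF \<alpha>] uX_subset[OF \<phi> \<alpha>] y by blast
      then show "((\<lambda>q. ?D q (0, 0, axis i (axis \<mu> 1), 0, 0, 0)) \<circ> cinv T \<alpha>) y = momentum i \<mu> y"
        using Deq[OF cinv_in_udom[OF \<phi> \<alpha> y], of "(0, 0, axis i (axis \<mu> 1), 0, 0, 0)"]
        by (simp add: momentum_def)
    qed
    then show ?thesis by (simp add: pdiff_def p(2))
  qed
  have nz: "sqrt \<bar>det (metric_of T h \<alpha> p)\<bar> \<noteq> 0"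
    using pseudo_riemannian_metric_of[OF h] \<alpha> pc by (auto simp: pseudo_riemannian_metric_def)
  have "euler_lagrange T h \<phi> \<alpha> i p = 0"
    using on \<alpha> p(1) by (auto simp: on_shell_def udom_iff[OF \<phi>])
  then have "?D p (0, axis i 1, 0, 0, 0, 0) = (\<Sum>\<mu>\<in>UNIV. pdiff T \<alpha> \<mu> (\<lambda>q. ?D q (0, 0, axis i (axis \<mu> 1), 0, 0, 0)) p)"
    using nz unfolding euler_lagrange_def by simp
  then show ?thesis
    using Deq[OF p(1), of "(0, axis i 1, 0, 0, 0, 0)"] by (simp add: pd p(2))
qed

text \<open>The pointwise form of integration by parts. The equations of motion replace the
  \<open>\<phi>\<close> derivative of the density by the divergence of the momenta, and the product
  rule merges this term with the one containing the derivative of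
  \<open>\<delta>\<phi>\<close>.\<close>

lemma matter_variation_divergence:
  assumes on: "on_shell T h \<phi>" and x: "x \<in> uX \<phi> \<alpha>" and \<omega>: "smooth_function T \<omega>"
  shows "dens x * matter_variation h \<phi> \<omega> (cinv T \<alpha> x) =
    (\<Sum>\<mu>\<in>UNIV. frechet_derivative (\<lambda>y. \<Sum>i\<in>UNIV. weyl_du \<phi> \<alpha> \<omega> y $ i * momentum i \<mu> y) (at x) (axis \<mu> 1))"
proof -
  let ?du = "weyl_du \<phi> \<alpha> \<omega>"
  have p: "cinv T \<alpha> x \<in> udom \<phi> \<alpha>" by (rule cinv_in_udom[OF \<phi> \<alpha> x])
  have cx: "coord T \<alpha> (cinv T \<alpha> x) = x" using coord_cinv[OF \<alpha>] uX_subset[OF \<phi> \<alpha>] x by blast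
  have J: "chart_jet h \<phi> \<alpha> x = jet_of T h \<phi> \<alpha> (cinv T \<alpha> x)"
    using jet_of_eq[OF \<phi> \<alpha> p] cx by simp
  have lin: "linear (L' x)"
    unfolding J by (rule has_derivative_linear[OF smooth_on_has_derivative[OF smooth_lagr[OF \<alpha>] jet_of_in_jet_domain[OF h \<phi> \<alpha> p]]])
  let ?A = "(\<chi> i \<mu>. frechet_derivative ?du (at x) (axis \<mu> 1) $ i) :: real^'n^'k"
  have jv: "jet_var ?du (\<lambda>_. 0) x = (0, ?du x, ?A, 0, 0, 0)"
    by (simp add: jet_var_def frechet_derivative_const vec_eq_iff)
  have "matter_variation h \<phi> \<omega> (cinv T \<alpha> x) = L' x (0, ?du x, ?A, 0, 0, 0)"
    using matter_variation_chart[OF h \<phi> \<omega> \<alpha> p] unfolding cx J[symmetric] jv .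
  also have "\<dots> = (\<Sum>i\<in>UNIV. ?du x $ i * L' x (0, axis i 1, 0, 0, 0, 0)) +
      (\<Sum>i\<in>UNIV. \<Sum>\<mu>\<in>UNIV. ?A $ i $ \<mu> * L' x (0, 0, axis i (axis \<mu> 1), 0, 0, 0))"
    by (subst jet_matter_expansion) (simp only: linear_add[OF lin] linear_sum[OF lin] linear_cmul[OF lin] real_scaleR_def)
  finally have "dens x * matter_variation h \<phi> \<omega> (cinv T \<alpha> x) =
      (\<Sum>i\<in>UNIV. ?du x $ i * (dens x * L' x (0, axis i 1, 0, 0, 0, 0))) +
      (\<Sum>i\<in>UNIV. \<Sum>\<mu>\<in>UNIV. ?A $ i $ \<mu> * momentum i \<mu> x)"
    by (simp add: distrib_left sum_distrib_left momentum_def mult_ac)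
  also have "\<dots> = (\<Sum>i\<in>UNIV. \<Sum>\<mu>\<in>UNIV. ?du x $ i * frechet_derivative (momentum i \<mu>) (at x) (axis \<mu> 1)) +
      (\<Sum>i\<in>UNIV. \<Sum>\<mu>\<in>UNIV. frechet_derivative ?du (at x) (axis \<mu> 1) $ i * momentum i \<mu> x)"
    by (simp add: on_shell_chart[OF on x] sum_distrib_left)
  also have "\<dots> = (\<Sum>\<mu>\<in>UNIV. \<Sum>i\<in>UNIV. ?du x $ i * frechet_derivative (momentum i \<mu>) (at x) (axis \<mu> 1) +
      frechet_derivative ?du (at x) (axis \<mu> 1) $ i * momentum i \<mu> x)"
    by (subst (1 2) sum.swap) (simp add: sum.distrib)
  also have "\<dots> = (\<Sum>\<mu>\<in>UNIV. frechet_derivative (\<lambda>y. \<Sum>i\<in>UNIV. ?du y $ i * momentum i \<mu> y) (at x) (axis \<mu> 1))"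
  proof (rule sum.cong[OF refl])
    fix \<mu>
    have "((\<lambda>y. \<Sum>i\<in>UNIV. ?du y $ i * momentum i \<mu> y) has_derivative
        (\<lambda>v. \<Sum>i\<in>UNIV. ?du x $ i * frechet_derivative (momentum i \<mu>) (at x) v +
          frechet_derivative ?du (at x) v $ i * momentum i \<mu> x)) (at x)"
      by (intro has_derivative_sum has_derivative_mult momentum_has_derivative x
          bounded_linear.has_derivative[OF bounded_linear_vec_nth] smooth_on_has_derivative[OF smooth_weyl_du[OF \<phi> \<alpha> \<omega>]])
    from fun_cong[OF frechet_derivative_at[OF this]]
    show "(\<Sum>i\<in>UNIV. ?du x $ i * frechet_derivative (momentum i \<mu>) (at x) (axis \<mu> 1) +
      frechet_derivative ?du (at x) (axis \<mu> 1) $ i * momentum i \<mu> x) =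
      frechet_derivative (\<lambda>y. \<Sum>i\<in>UNIV. ?du y $ i * momentum i \<mu> y) (at x) (axis \<mu> 1)" .
  qed
  finally show ?thesis .
qed

text \<open>A current supported compactly inside one chart extends by 0 to a C^1 field on the whole
  coordinate space, and each term of its divergence then has Lebesgue integral 0.\<close>

lemma integral_matter_variation_chart:
  assumes on: "on_shell T h \<phi>" and \<omega>: "smooth_function T \<omega>"
    and C: "compact C" "C \<subseteq> udom \<phi> \<alpha>" "\<And>p. p \<notin> C \<Longrightarrow> \<omega> p = 0"
  shows "(LINT p|volume T (metric_of T h). matter_variation h \<phi> \<omega> p) = 0"
proof -
  let ?mv = "matter_variation h \<phi> \<omega>"
  note g = pseudo_riemannian_metric_of[OF h]
  note X = open_uX[OF \<phi> \<alpha>]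
  define Cx where "Cx = coord T \<alpha> ` C"
  have Cc: "C \<subseteq> cdom T \<alpha>" using C(2) udom_subset[OF \<phi> \<alpha>] by blast
  have Cx: "compact Cx"
    unfolding Cx_def by (rule compact_continuous_image[OF continuous_on_subset[OF continuous_on_coord[OF \<alpha>] Cc] C(1)])
  have CxX: "Cx \<subseteq> uX \<phi> \<alpha>" using C(2) by (auto simp: Cx_def uX_def[OF \<phi> \<alpha>])
  have du0: "weyl_du \<phi> \<alpha> \<omega> y = 0" if y: "y \<in> uX \<phi> \<alpha>" "y \<notin> Cx" for y
  proof -
    have "coord T \<alpha> (cinv T \<alpha> y) = y" using coord_cinv[OF \<alpha>] uX_subset[OF \<phi> \<alpha>] y by blast
    then have "cinv T \<alpha> y \<notin> C" using y(2) unfolding Cx_def by (metis image_eqI)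
    then show ?thesis using C(3) by (simp add: weyl_du_def[OF \<phi> \<alpha>] vec_eq_iff)
  qed
  \<comment> \<open>The extension by 0 is C^1 because \<open>uX\<close> and the complement of the
    compact \<open>Cx\<close> are open, cover the space, and \<open>V\<close> is 0 on the
    latter.\<close>
  define V where "V \<mu> y = (if y \<in> uX \<phi> \<alpha> then \<Sum>i\<in>UNIV. weyl_du \<phi> \<alpha> \<omega> y $ i * momentum i \<mu> y else 0)" for \<mu> y
  have V0: "V \<mu> y = 0" if "y \<notin> Cx" for \<mu> y
    using du0[OF _ that] by (simp add: V_def)
  have CV: "Ck_on 1 UNIV (V \<mu>)" for \<mu>
  proof (rule Ck_on_local)
    fix y :: "real^'n"
    show "\<exists>U. open U \<and> y \<in> U \<and> Ck_on 1 U (V \<mu>)"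
    proof (cases "y \<in> uX \<phi> \<alpha>")
      case True
      have "Ck_on 1 (uX \<phi> \<alpha>) (\<lambda>y. \<Sum>i\<in>UNIV. weyl_du \<phi> \<alpha> \<omega> y $ i * momentum i \<mu> y)"
        by (intro Ck_on_sum Ck_on_mult Ck_on_nth X C1_momentum smooth_onD[OF smooth_weyl_du[OF \<phi> \<alpha> \<omega>]])
      then have "Ck_on 1 (uX \<phi> \<alpha>) (V \<mu>)"
        by (rule Ck_on_cong[OF X, rotated]) (simp add: V_def)
      then show ?thesis using X True by blast
    next
      case False
      have "Ck_on 1 (- Cx) (V \<mu>)"
        by (rule Ck_on_cong[OF open_Compl[OF compact_imp_closed[OF Cx]] _ Ck_on_const[of _ _ 0]]) (simp add: V0)
      moreover have "y \<in> - Cx" using False CxX by blast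
      ultimately show ?thesis using open_Compl[OF compact_imp_closed[OF Cx]] by blast
    qed
  qed
  have CV': "Ck_on (Suc 0) UNIV (V \<mu>)" for \<mu> using CV[of \<mu>] by simp
  have int: "has_bochner_integral lborel (\<lambda>x. frechet_derivative (V \<mu>) (at x) (axis \<mu> 1)) 0" for \<mu>
  proof (rule integral_directional_derivative_eq_0[OF Cx _ _ V0])
    show "(V \<mu> has_derivative frechet_derivative (V \<mu>) (at x)) (at x)" for x
      by (rule Ck_on_SucD(1)[OF CV']) simp
    show "continuous_on UNIV (\<lambda>x. frechet_derivative (V \<mu>) (at x) (axis \<mu> 1))"
      by (rule Ck_on_imp_continuous_on[OF Ck_on_SucD(2)[OF CV']])
  qed
  have "has_bochner_integral lborel (\<lambda>x. \<Sum>\<mu>\<in>UNIV. frechet_derivative (V \<mu>) (at x) (axis \<mu> 1)) (\<Sum>\<mu>\<in>(UNIV :: 'n set). 0)"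
    by (rule has_bochner_integral_sum) (rule int)
  then have sum0: "(LINT x|lborel. (\<Sum>\<mu>\<in>UNIV. frechet_derivative (V \<mu>) (at x) (axis \<mu> 1))) = 0"
    by (simp add: has_bochner_integral_iff)
  have eq: "indicator (coord T \<alpha> ` udom \<phi> \<alpha>) x * dens x * ?mv (cinv T \<alpha> x) =
      (\<Sum>\<mu>\<in>UNIV. frechet_derivative (V \<mu>) (at x) (axis \<mu> 1))" for x
  proof (cases "x \<in> uX \<phi> \<alpha>")
    case True
    have "frechet_derivative (V \<mu>) (at x) =
        frechet_derivative (\<lambda>y. \<Sum>i\<in>UNIV. weyl_du \<phi> \<alpha> \<omega> y $ i * momentum i \<mu> y) (at x)" for \<mu>
      by (rule frechet_derivative_cong_open[OF X True]) (simp add: V_def)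
    then show ?thesis
      using matter_variation_divergence[OF on True \<omega>] True by (simp add: uX_def[OF \<phi> \<alpha>, symmetric])
  next
    case False
    then have "x \<in> - Cx" using CxX by blast
    then have "frechet_derivative (V \<mu>) (at x) = frechet_derivative (\<lambda>_. 0) (at x)" for \<mu>
      by (rule frechet_derivative_cong_open[OF open_Compl[OF compact_imp_closed[OF Cx]]]) (simp add: V0)
    then show ?thesis
      using False by (simp add: uX_def[OF \<phi> \<alpha>, symmetric] frechet_derivative_const)
  qed
  have mv0: "?mv p = 0" if "p \<notin> C" for p
    by (rule matter_variation_eq_0[OF h \<phi> \<omega> open_Compl[OF compact_imp_closed[OF C(1)]]]) (use that C(3) in auto)
  have "(LINT p|volume T (metric_of T h). ?mv p) = (LINT p|volume T (metric_of T h). indicator (udom \<phi> \<alpha>) p * ?mv p)"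
    using C(2) mv0 by (intro Bochner_Integration.integral_cong) (auto simp: indicator_def)
  also have "\<dots> = (LINT x|lborel. indicator (coord T \<alpha> ` udom \<phi> \<alpha>) x * dens x * ?mv (cinv T \<alpha> x))"
    by (rule integral_volume_chart[OF g \<alpha> _ udom_subset[OF \<phi> \<alpha>]])
      (use open_udom[OF \<phi> \<alpha>] in \<open>auto intro!: borel_measurable_continuous_onI continuous_matter_variation h \<phi> \<omega>\<close>)
  also have "\<dots> = 0" unfolding eq by (rule sum0)
  finally show ?thesis .
qed

end

section \<open>Additivity of the matter variation and its localization\<close>

lemma smooth_function_add:
  assumes "smooth_function T f" "smooth_function T g"
  shows "smooth_function T (\<lambda>p. f p + g p)"
  unfolding smooth_function_def crange_def[symmetric] o_def
  by (intro ballI smooth_on_add open_crange smooth_functionD assms)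

context
  fixes h \<phi>
  assumes h: "gravitational_field T h" and \<phi>: "matter_field T \<phi>"
begin

text \<open>In a chart \<open>weyl_du\<close> is linear in \<open>\<omega>\<close>, its jet is
  linear in \<open>weyl_du\<close>, and the derivative of \<open>lagr\<close> is linear in the
  direction.\<close>

lemma matter_variation_add:
  assumes \<omega>: "smooth_function T \<omega>" and \<omega>': "smooth_function T \<omega>'"
  shows "matter_variation h \<phi> (\<lambda>p. \<omega> p + \<omega>' p) p = matter_variation h \<phi> \<omega> p + matter_variation h \<phi> \<omega>' p"
proof -
  obtain \<alpha> where \<alpha>: "\<alpha> \<in> atlas T" and p: "p \<in> udom \<phi> \<alpha>" using ex_udom[OF \<phi>] by blast
  have x: "coord T \<alpha> p \<in> uX \<phi> \<alpha>" using p by (simp add: uX_def[OF \<phi> \<alpha>])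
  have "jet_var (weyl_du \<phi> \<alpha> (\<lambda>p. \<omega> p + \<omega>' p)) (\<lambda>_. 0 :: real^'n^'n) (coord T \<alpha> p) =
      jet_var (\<lambda>y. weyl_du \<phi> \<alpha> \<omega> y + 1 *\<^sub>R weyl_du \<phi> \<alpha> \<omega>' y) (\<lambda>y. 0 + 1 *\<^sub>R 0) (coord T \<alpha> p)"
    by (rule jet_var_cong[OF open_uX[OF \<phi> \<alpha>] x]) (auto simp: weyl_du_def[OF \<phi> \<alpha>] vec_eq_iff algebra_simps)
  also have "\<dots> = jet_var (weyl_du \<phi> \<alpha> \<omega>) (\<lambda>_. 0) (coord T \<alpha> p) + 1 *\<^sub>R jet_var (weyl_du \<phi> \<alpha> \<omega>') (\<lambda>_. 0) (coord T \<alpha> p)"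
    by (rule jet_var_add_scaleR[OF open_uX[OF \<phi> \<alpha>] x smooth_weyl_du[OF \<phi> \<alpha> \<omega>] smooth_weyl_du[OF \<phi> \<alpha> \<omega>']
          smooth_on_const smooth_on_const])
  finally have jv: "jet_var (weyl_du \<phi> \<alpha> (\<lambda>p. \<omega> p + \<omega>' p)) (\<lambda>_. 0 :: real^'n^'n) (coord T \<alpha> p) =
      jet_var (weyl_du \<phi> \<alpha> \<omega>) (\<lambda>_. 0) (coord T \<alpha> p) + jet_var (weyl_du \<phi> \<alpha> \<omega>') (\<lambda>_. 0) (coord T \<alpha> p)"
    by simp
  show ?thesis
    unfolding matter_variation_chart[OF h \<phi> smooth_function_add[OF \<omega> \<omega>'] \<alpha> p]
      matter_variation_chart[OF h \<phi> \<omega> \<alpha> p] matter_variation_chart[OF h \<phi> \<omega>' \<alpha> p] jv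
    by (rule linear_add[OF has_derivative_linear[OF smooth_on_has_derivative[OF smooth_lagr[OF \<alpha>]
          jet_of_in_jet_domain[OF h \<phi> \<alpha> p]]]])
qed

lemma matter_variation_sum:
  assumes "finite I" "\<And>i. i \<in> I \<Longrightarrow> smooth_function T (f i)"
  shows "matter_variation h \<phi> (\<lambda>p. \<Sum>i\<in>I. f i p) p = (\<Sum>i\<in>I. matter_variation h \<phi> (f i) p)"
  using assms
proof (induction I)
  case empty
  show ?case
    using matter_variation_eq_0[OF h \<phi> smooth_function_const open_UNIV] by simp
next
  case (insert i I)
  have "matter_variation h \<phi> (\<lambda>p. f i p + (\<Sum>i\<in>I. f i p)) p =
      matter_variation h \<phi> (f i) p + matter_variation h \<phi> (\<lambda>p. \<Sum>i\<in>I. f i p) p"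
    by (rule matter_variation_add[OF _ smooth_function_sum]) (use insert.prems in auto)
  then show ?case using insert by simp
qed

text \<open>
  On shell the variation is a total divergence in every chart; it is localized with a partition of
  unity.
\<close>
lemma integral_matter_variation:
  assumes on: "on_shell T h \<phi>" and \<omega>: "smooth_function T \<omega>"
    and K: "compact K" and supp: "closure {p. \<omega> p \<noteq> 0} \<subseteq> K"
  shows "(LINT p|volume T (metric_of T h). indicator K p * matter_variation h \<phi> \<omega> p) = 0"
proof -
  let ?vol = "volume T (metric_of T h)"
  let ?S = "closure {p. \<omega> p \<noteq> 0}"
  note g = pseudo_riemannian_metric_of[OF h]
  have S: "compact ?S" using compact_Int_closed[OF K closed_closure, of "{p. \<omega> p \<noteq> 0}"] supp
    by (simp add: Int_absorb1)
  have \<omega>0: "\<omega> p = 0" if "p \<notin> ?S" for p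
    using that closure_subset[of "{p. \<omega> p \<noteq> 0}"] by blast
  have "\<forall>q. \<exists>z. fst z \<in> atlas T \<and> smooth_function T (fst (snd z)) \<and> (\<forall>p. 0 \<le> fst (snd z) p) \<and> 0 < fst (snd z) q \<and>
      compact (snd (snd z)) \<and> snd (snd z) \<subseteq> udom \<phi> (fst z) \<and> (\<forall>p. p \<notin> snd (snd z) \<longrightarrow> fst (snd z) p = 0)"
  proof
    fix q
    obtain \<alpha> where \<alpha>: "\<alpha> \<in> atlas T" "q \<in> udom \<phi> \<alpha>" using ex_udom[OF \<phi>] by blast
    obtain \<psi> C where "smooth_function T \<psi>" "\<And>p. 0 \<le> \<psi> p" "0 < \<psi> q" "compact C" "C \<subseteq> udom \<phi> \<alpha>"
      "\<And>p. p \<notin> C \<Longrightarrow> \<psi> p = 0"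
      using ex_bump_function[OF open_udom[OF \<phi> \<alpha>(1)] \<alpha>(2)] by blast
    then show "\<exists>z. fst z \<in> atlas T \<and> smooth_function T (fst (snd z)) \<and> (\<forall>p. 0 \<le> fst (snd z) p) \<and> 0 < fst (snd z) q \<and>
      compact (snd (snd z)) \<and> snd (snd z) \<subseteq> udom \<phi> (fst z) \<and> (\<forall>p. p \<notin> snd (snd z) \<longrightarrow> fst (snd z) p = 0)"
      using \<alpha>(1) by (intro exI[of _ "(\<alpha>, \<psi>, C)"]) simp
  qed
  from choice[OF this] obtain Z where Z: "\<forall>q. fst (Z q) \<in> atlas T \<and> smooth_function T (fst (snd (Z q))) \<and>
      (\<forall>p. 0 \<le> fst (snd (Z q)) p) \<and> 0 < fst (snd (Z q)) q \<and>
      compact (snd (snd (Z q))) \<and> snd (snd (Z q)) \<subseteq> udom \<phi> (fst (Z q)) \<and>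
      (\<forall>p. p \<notin> snd (snd (Z q)) \<longrightarrow> fst (snd (Z q)) p = 0)" ..
  define \<psi> where "\<psi> q = fst (snd (Z q))" for q
  define C where "C q = snd (snd (Z q))" for q
  have \<psi>: "smooth_function T (\<psi> q)" "0 \<le> \<psi> q p" "0 < \<psi> q q" "compact (C q)" "p \<notin> C q \<Longrightarrow> \<psi> q p = 0"
    and a: "fst (Z q) \<in> atlas T" "C q \<subseteq> udom \<phi> (fst (Z q))" for q p
    using Z by (auto simp: \<psi>_def C_def)
  have op: "open {p. 0 < \<psi> q p}" for q
    by (intro open_Collect_less continuous_on_const smooth_function_continuous \<psi>)
  obtain Q where Q: "finite Q" "?S \<subseteq> (\<Union>q\<in>Q. {p. 0 < \<psi> q p})"
    by (rule compactE_image[OF S, of UNIV "\<lambda>q. {p. 0 < \<psi> q p}"]) (use op in \<open>auto intro: \<psi>(3)\<close>)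
  define B where "B p = (\<Sum>q\<in>Q. \<psi> q p)" for p
  have B: "smooth_function T B"
    unfolding B_def[abs_def] by (intro smooth_function_sum \<psi>)
  have Bpos: "0 < B p" if p: "p \<in> ?S" for p
  proof -
    obtain q where q: "q \<in> Q" "0 < \<psi> q p" using Q(2) p by blast
    have "\<psi> q p \<le> B p" unfolding B_def using Q(1) q(1) \<psi>(2) by (intro member_le_sum) auto
    then show ?thesis using q(2) by linarith
  qed
  \<comment> \<open>The quotient is formed with \<open>\<omega>\<close> rather than with
    \<open>\<psi> q\<close>: \<open>B\<close> may vanish away from the support of
    \<open>\<omega>\<close>, but there \<open>\<omega>\<close> is 0 and the quotient stays
    smooth.\<close>
  define f where "f q p = \<psi> q p * (\<omega> p / B p)" for q p
  have f: "smooth_function T (f q)" for q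
    unfolding f_def[abs_def]
    by (intro smooth_function_mult \<psi> smooth_function_divide[OF \<omega> B closed_closure \<omega>0 Bpos])
  have "\<omega> p = (\<Sum>q\<in>Q. f q p)" for p
  proof (cases "p \<in> ?S")
    case True
    have "(\<Sum>q\<in>Q. f q p) = (\<Sum>q\<in>Q. \<psi> q p) * (\<omega> p / B p)"
      unfolding f_def by (rule sum_distrib_right[symmetric])
    also have "\<dots> = B p * (\<omega> p / B p)" by (simp only: B_def)
    finally have "(\<Sum>q\<in>Q. f q p) = B p * (\<omega> p / B p)" .
    then show ?thesis using Bpos[OF True] by simp
  next
    case False
    then have "\<omega> p = 0" by (rule \<omega>0)
    then show ?thesis by (simp add: f_def)
  qed
  then have \<omega>_eq: "\<omega> = (\<lambda>p. \<Sum>q\<in>Q. f q p)" by blast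
  have mf0: "matter_variation h \<phi> (f q) p = 0" if "p \<notin> C q" for q p
    by (rule matter_variation_eq_0[OF h \<phi> f, where U = "- C q"])
      (use that \<psi>(5) compact_imp_closed[OF \<psi>(4)] in \<open>auto simp: f_def\<close>)
  have int: "integrable ?vol (matter_variation h \<phi> (f q))" for q
  proof -
    have c: "continuous_on UNIV (matter_variation h \<phi> (f q))"
      by (rule continuous_matter_variation[OF h \<phi> f])
    obtain M where "\<forall>y\<in>matter_variation h \<phi> (f q) ` C q. norm y \<le> M"
      using compact_imp_bounded[OF compact_continuous_image[OF continuous_on_subset[OF c subset_UNIV] \<psi>(4)]]
      unfolding bounded_iff by blast
    then have "integrable ?vol (\<lambda>p. indicator (C q) p * matter_variation h \<phi> (f q) p)"
      by (intro integrable_volume_compact[OF g \<psi>(4), where B = M] borel_measurable_continuous_onI c) auto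
    moreover have "(\<lambda>p. indicator (C q) p * matter_variation h \<phi> (f q) p) = matter_variation h \<phi> (f q)"
      using mf0 by (auto simp: indicator_def fun_eq_iff)
    ultimately show ?thesis by simp
  qed
  have "indicator K p * matter_variation h \<phi> \<omega> p = (\<Sum>q\<in>Q. matter_variation h \<phi> (f q) p)" for p
  proof -
    have "matter_variation h \<phi> \<omega> p = 0" if "p \<notin> K"
    proof (rule matter_variation_eq_0[OF h \<phi> \<omega>, where U = "- ?S"])
      show "open (- ?S)" by (intro open_Compl closed_closure)
      show "p \<in> - ?S" using that supp by blast
      show "\<omega> q = 0" if "q \<in> - ?S" for q using \<omega>0[of q] that by blast
    qed
    then have "indicator K p * matter_variation h \<phi> \<omega> p = matter_variation h \<phi> \<omega> p"
      by (auto simp: indicator_def)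
    also have "\<dots> = (\<Sum>q\<in>Q. matter_variation h \<phi> (f q) p)"
      by (subst \<omega>_eq) (rule matter_variation_sum[OF Q(1) f])
    finally show ?thesis .
  qed
  then have "(LINT p|?vol. indicator K p * matter_variation h \<phi> \<omega> p) = (LINT p|?vol. (\<Sum>q\<in>Q. matter_variation h \<phi> (f q) p))"
    by simp
  also have "\<dots> = (\<Sum>q\<in>Q. LINT p|?vol. matter_variation h \<phi> (f q) p)"
    by (rule Bochner_Integration.integral_sum) (rule int)
  also have "\<dots> = 0"
  proof (rule sum.neutral, rule ballI)
    fix q
    show "(LINT p|?vol. matter_variation h \<phi> (f q) p) = 0"
      by (rule integral_matter_variation_chart[OF h \<phi> a(1) on f \<psi>(4)[of q] a(2)]) (simp add: f_def \<psi>(5))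
  qed
  finally show ?thesis .
qed

end

end


section \<open>The trace of the energy-momentum tensor\<close>

text \<open>In this form chart independence of the contraction becomes cyclicity of the
  trace.\<close>

lemma trace_mult_transpose: "(\<Sum>\<mu>\<in>UNIV. \<Sum>\<nu>\<in>UNIV. A $ \<mu> $ \<nu> * B $ \<mu> $ \<nu>) = trace (A ** transpose B)"
  for A B :: "real^'n::finite^'n"
  by (simp add: trace_def matrix_matrix_mult_def transpose_def)

context spacetime
begin

text \<open>The Jacobians of the contravariant and the covariant transformation laws meet under the
  trace; cyclicity moves them onto one tensor, so the chart chosen in \<open>contraction\<close> can
  be replaced by any other.\<close>

lemma contraction_chart:
  assumes s: "contravariant_tensor2 T s" and t: "covariant_tensor2 T t"
    and \<alpha>: "\<alpha> \<in> atlas T" and p: "p \<in> cdom T \<alpha>"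
  shows "contraction T s t p = (\<Sum>\<mu>\<in>UNIV. \<Sum>\<nu>\<in>UNIV. s \<alpha> p $ \<mu> $ \<nu> * t \<alpha> p $ \<mu> $ \<nu>)"
proof -
  define \<beta> where "\<beta> = (SOME \<beta>. \<beta> \<in> atlas T \<and> p \<in> cdom T \<beta>)"
  have "\<exists>\<beta>. \<beta> \<in> atlas T \<and> p \<in> cdom T \<beta>" using \<alpha> p by blast
  then have \<beta>: "\<beta> \<in> atlas T" "p \<in> cdom T \<beta>"
    unfolding \<beta>_def by (rule someI2_ex, blast)+
  let ?J = "jac T \<beta> \<alpha> p"
  have t\<alpha>: "t \<alpha> p = transpose ?J ** t \<beta> p ** ?J"
    using t \<alpha> \<beta> p unfolding covariant_tensor2_def by blast
  have s\<beta>: "s \<beta> p = ?J ** s \<alpha> p ** transpose ?J"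
    using s \<alpha> \<beta> p unfolding contravariant_tensor2_def by blast
  have "trace (s \<beta> p ** transpose (t \<beta> p)) = trace (?J ** (s \<alpha> p ** transpose ?J ** transpose (t \<beta> p)))"
    unfolding s\<beta> by (simp only: matrix_mul_assoc)
  also have "\<dots> = trace (s \<alpha> p ** transpose ?J ** transpose (t \<beta> p) ** ?J)"
    by (rule trace_mul_sym)
  also have "\<dots> = trace (s \<alpha> p ** transpose (t \<alpha> p))"
    unfolding t\<alpha> by (simp only: matrix_transpose_mul transpose_transpose matrix_mul_assoc)
  finally show ?thesis
    unfolding contraction_def Let_def \<beta>_def[symmetric] trace_mult_transpose .
qed

lemma continuous_contraction:
  assumes s: "contravariant_tensor2 T s" and t: "covariant_tensor2 T t"
  shows "continuous_on UNIV (contraction T s t)"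
proof (rule continuous_on_UNIV_local)
  fix p
  obtain \<alpha> where \<alpha>: "\<alpha> \<in> atlas T" "p \<in> cdom T \<alpha>" using ex_chart by blast
  have "continuous_on (crange \<alpha>) (\<lambda>x. s \<alpha> (cinv T \<alpha> x))" "continuous_on (crange \<alpha>) (\<lambda>x. t \<alpha> (cinv T \<alpha> x))"
    using s t \<alpha>(1) unfolding contravariant_tensor2_def covariant_tensor2_def smooth_components_def crange_def o_def
    by (auto intro: smooth_on_imp_continuous_on)
  then have "continuous_on (crange \<alpha>) (\<lambda>x. \<Sum>\<mu>\<in>UNIV. \<Sum>\<nu>\<in>UNIV. s \<alpha> (cinv T \<alpha> x) $ \<mu> $ \<nu> * t \<alpha> (cinv T \<alpha> x) $ \<mu> $ \<nu>)"
    by (intro continuous_intros)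
  then have "continuous_on (cdom T \<alpha>) (contraction T s t)"
    unfolding crange_def
    by (rule continuous_on_chart_pullback[OF \<alpha>(1) subset_refl])
      (simp add: contraction_chart[OF s t \<alpha>(1)] cinv_coord[OF \<alpha>(1)])
  then show "\<exists>U. open U \<and> p \<in> U \<and> continuous_on U (contraction T s t)"
    using open_cdom[OF \<alpha>(1)] \<alpha>(2) by blast
qed

lemma traceless_iff:
  assumes "contravariant_tensor2 T s" "covariant_tensor2 T g"
  shows "traceless T g s \<longleftrightarrow> (\<forall>p. contraction T s g p = 0)"
proof
  assume tl: "traceless T g s"
  show "\<forall>p. contraction T s g p = 0"
  proof
    fix p
    obtain \<alpha> where \<alpha>: "\<alpha> \<in> atlas T" "p \<in> cdom T \<alpha>" using ex_chart by blast
    then show "contraction T s g p = 0"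
      using tl contraction_chart[OF assms \<alpha>] by (simp add: traceless_def mult.commute)
  qed
next
  assume "\<forall>p. contraction T s g p = 0"
  then show "traceless T g s"
    using contraction_chart[OF assms] by (simp add: traceless_def mult.commute)
qed

text \<open>A bump supported where \<open>f\<close> has the sign of \<open>f p\<close> turns the
  hypothesis into a nonnegative integrand with integral 0, which nevertheless is positive on a
  nonempty open set, a set of positive volume.\<close>

lemma fundamental_lemma:
  assumes g: "pseudo_riemannian_metric T g" and f: "continuous_on UNIV f"
    and 0: "\<And>K \<omega>. compact K \<Longrightarrow> smooth_function T \<omega> \<Longrightarrow> closure {p. \<omega> p \<noteq> 0} \<subseteq> K \<Longrightarrow>
      (LINT p|volume T g. indicator K p * (\<omega> p * f p)) = 0"
  shows "f p = 0"
proof (rule ccontr)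
  assume p: "f p \<noteq> 0"
  \<comment> \<open>The factor \<open>sgn (f p)\<close> treats both signs of \<open>f p\<close> at
    once.\<close>
  define U where "U = {q. 0 < sgn (f p) * f q}"
  have U: "open U" "p \<in> U"
    unfolding U_def using p by (auto intro!: open_Collect_less continuous_intros f simp: sgn_if)
  obtain \<psi> C where \<psi>: "smooth_function T \<psi>" "\<And>q. 0 \<le> \<psi> q" "0 < \<psi> p" and C: "compact C" "C \<subseteq> U"
    and \<psi>0: "\<And>q. q \<notin> C \<Longrightarrow> \<psi> q = 0"
    using ex_bump_function[OF U] by blast
  have [measurable]: "C \<in> sets borel" using compact_imp_closed[OF C(1)] by auto
  note c\<psi> = smooth_function_continuous[OF \<psi>(1)]
  have m[measurable]: "f \<in> borel_measurable borel" "\<psi> \<in> borel_measurable borel"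
    by (intro borel_measurable_continuous_onI f c\<psi>)+
  have [measurable_cong]: "sets (volume T g) = sets borel" by (rule sets_volume[OF g])
  let ?F = "\<lambda>q. sgn (f p) * (indicator C q * (\<psi> q * f q))"
  have c: "continuous_on C (\<lambda>q. \<psi> q * f q)"
    by (intro continuous_on_mult continuous_on_subset[OF c\<psi>] continuous_on_subset[OF f] subset_UNIV)
  obtain M where "\<forall>y\<in>(\<lambda>q. \<psi> q * f q) ` C. norm y \<le> M"
    using compact_imp_bounded[OF compact_continuous_image[OF c C(1)]] unfolding bounded_iff by blast
  then have "integrable (volume T g) (\<lambda>q. indicator C q * (\<psi> q * f q))"
    by (intro integrable_volume_compact[OF g C(1), where B = M]) auto
  then have int: "integrable (volume T g) ?F" by (rule integrable_mult_right)
  have supp: "closure {q. \<psi> q \<noteq> 0} \<subseteq> C"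
    by (rule closure_minimal) (use \<psi>0 compact_imp_closed[OF C(1)] in auto)
  have "(LINT q|volume T g. ?F q) = 0"
    using 0[OF C(1) \<psi>(1) supp] by simp
  moreover have nonneg: "0 \<le> ?F q" for q
  proof (cases "q \<in> C")
    case True
    then have "0 < sgn (f p) * f q" using C(2) by (auto simp: U_def)
    then have "0 \<le> \<psi> q * (sgn (f p) * f q)" using \<psi>(2)[of q] by simp
    then show ?thesis using True by (simp add: mult_ac)
  qed simp
  ultimately have AE: "AE q in volume T g. ?F q = 0"
    using integral_nonneg_eq_0_iff_AE[OF int] by simp
  have V: "open {q. 0 < \<psi> q}"
    by (intro open_Collect_less continuous_on_const c\<psi>)
  have "AE q in volume T g. q \<notin> {q. 0 < \<psi> q}"
    using AE
  proof eventually_elim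
    case (elim q)
    have "?F q \<noteq> 0" if "0 < \<psi> q"
    proof -
      have "q \<in> C" using \<psi>0[of q] that by force
      then have "0 < sgn (f p) * f q" using C(2) by (auto simp: U_def)
      then show ?thesis using that \<open>q \<in> C\<close> by auto
    qed
    with elim show ?case by auto
  qed
  then have "emeasure (volume T g) {q. 0 < \<psi> q} = 0"
    using V by (subst (asm) AE_iff_null_sets[symmetric]) (auto simp: sets_volume[OF g])
  moreover have "0 < emeasure (volume T g) {q. 0 < \<psi> q}"
    by (rule emeasure_volume_open_pos[OF g V]) (use \<psi>(3) in simp)
  ultimately show False by simp
qed

end

context matter_theory
begin

text \<open>The 2 in the Weyl variation of the metric cancels the 1/2 in the definition of the
  tensor, so the action has derivative \<open>- ?I K \<omega>\<close> at 0. Uniqueness of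
  derivatives turns invariance into the vanishing of these integrals.\<close>

lemma weyl_invariant_at_iff_traceless:
  assumes h: "gravitational_field T h" and \<phi>: "matter_field T \<phi>" and on: "on_shell T h \<phi>"
    and EM: "energy_momentum_tensor T h \<phi> \<T>"
  shows "weyl_invariant_at T h \<phi> \<longleftrightarrow> traceless T (metric_of T h) \<T>"
proof -
  let ?g = "metric_of T h"
  let ?vol = "volume T ?g"
  let ?tr = "contraction T \<T> ?g"
  let ?\<delta> = "\<lambda>\<omega>. weyl_metric_variation T \<omega> h"
  let ?I = "\<lambda>K \<omega>. LINT p|?vol. indicator K p * (\<omega> p * ?tr p)"
  note g = pseudo_riemannian_metric_of[OF h]
  have gc: "covariant_tensor2 T ?g" and gs: "symmetric_components T ?g"
    using g by (auto simp: pseudo_riemannian_metric_def)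
  have Tc: "contravariant_tensor2 T \<T>" using EM by (simp add: energy_momentum_tensor_def)
  have key: "((\<lambda>t. action T K (vary_grav T (?\<delta> \<omega>) t h) (weyl_vary_matter T \<omega> t \<phi>)) has_real_derivative - ?I K \<omega>) (at 0)"
    if K: "compact K" and \<omega>: "smooth_function T \<omega>" and supp: "closure {p. \<omega> p \<noteq> 0} \<subseteq> K" for K \<omega>
  proof -
    have dc: "covariant_tensor2 T (?\<delta> \<omega>)"
      by (rule covariant_tensor2_scale[OF smooth_function_mult[OF smooth_function_const[of 2] \<omega>] gc])
        (simp add: weyl_metric_variation_def)
    have ds: "symmetric_components T (?\<delta> \<omega>)"
      using gs by (simp add: symmetric_components_def weyl_metric_variation_def transpose_scalar)
    have "{p. \<exists>\<alpha>\<in>atlas T. p \<in> cdom T \<alpha> \<and> ?\<delta> \<omega> \<alpha> p \<noteq> 0} \<subseteq> {p. \<omega> p \<noteq> 0}"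
      by (auto simp: weyl_metric_variation_def)
    then have "tensor_support T (?\<delta> \<omega>) \<subseteq> K"
      unfolding tensor_support_def using closure_mono supp by blast
    then have G: "((\<lambda>t. action T K (vary_grav T (?\<delta> \<omega>) t h) \<phi>) has_real_derivative
          - (1/2) * (LINT p:K|?vol. contraction T \<T> (?\<delta> \<omega>) p)) (at 0)"
      using EM K dc ds unfolding energy_momentum_tensor_def by blast
    have "contraction T \<T> (?\<delta> \<omega>) p = 2 * (\<omega> p * ?tr p)" for p
      by (simp add: contraction_def Let_def weyl_metric_variation_def sum_distrib_left mult_ac)
    then have "(LINT p:K|?vol. contraction T \<T> (?\<delta> \<omega>) p) = (LINT p|?vol. 2 * (indicator K p * (\<omega> p * ?tr p)))"
      unfolding set_lebesgue_integral_def by (simp add: mult_ac)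
    also have "\<dots> = 2 * ?I K \<omega>" by simp
    finally have I: "- (1/2) * (LINT p:K|?vol. contraction T \<T> (?\<delta> \<omega>) p) = - ?I K \<omega>" by simp
    \<comment> \<open>The on-shell matter part has derivative 0; adding it to the purely
      gravitational part \<open>G\<close> recovers the full variation.\<close>
    have "((\<lambda>t. action T K (vary_grav T (?\<delta> \<omega>) t h) (weyl_vary_matter T \<omega> t \<phi>) -
        action T K (vary_grav T (?\<delta> \<omega>) t h) \<phi>) has_real_derivative 0) (at 0)"
      using action_difference_derivative[OF h \<phi> \<omega> K supp]
      by (simp only: integral_matter_variation[OF h \<phi> on \<omega> K supp])
    from DERIV_add[OF this G[unfolded I]] show ?thesis by simp
  qed
  have "weyl_invariant_at T h \<phi> \<longleftrightarrow>
      (\<forall>K \<omega>. compact K \<and> smooth_function T \<omega> \<and> closure {p. \<omega> p \<noteq> 0} \<subseteq> K \<longrightarrow> ?I K \<omega> = 0)"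
    unfolding weyl_invariant_at_def
  proof (intro all_cong1 imp_cong refl)
    fix K \<omega> assume "compact K \<and> smooth_function T \<omega> \<and> closure {p. \<omega> p \<noteq> 0} \<subseteq> K"
    then have k: "((\<lambda>t. action T K (vary_grav T (?\<delta> \<omega>) t h) (weyl_vary_matter T \<omega> t \<phi>)) has_real_derivative - ?I K \<omega>) (at 0)"
      using key by blast
    show "((\<lambda>t. action T K (vary_grav T (?\<delta> \<omega>) t h) (weyl_vary_matter T \<omega> t \<phi>)) has_real_derivative 0) (at 0) \<longleftrightarrow> ?I K \<omega> = 0"
      (is "?D0 \<longleftrightarrow> _")
    proof
      assume ?D0
      from DERIV_unique[OF k this] show "?I K \<omega> = 0" by simp
    next
      assume "?I K \<omega> = 0"
      with k show ?D0 by simp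
    qed
  qed
  also have "\<dots> \<longleftrightarrow> (\<forall>p. ?tr p = 0)"
  proof
    assume "\<forall>K \<omega>. compact K \<and> smooth_function T \<omega> \<and> closure {p. \<omega> p \<noteq> 0} \<subseteq> K \<longrightarrow> ?I K \<omega> = 0"
    then show "\<forall>p. ?tr p = 0"
      by (intro allI fundamental_lemma[OF g continuous_contraction[OF Tc gc]]) blast
  next
    assume "\<forall>p. ?tr p = 0"
    then show "\<forall>K \<omega>. compact K \<and> smooth_function T \<omega> \<and> closure {p. \<omega> p \<noteq> 0} \<subseteq> K \<longrightarrow> ?I K \<omega> = 0"
      by simp
  qed
  also have "\<dots> \<longleftrightarrow> traceless T ?g \<T>"
    by (rule traceless_iff[OF Tc gc, symmetric])
  finally show ?thesis .
qed

end

theorem theorem5p1: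
  fixes T :: "('c, 'm::{t2_space,second_countable_topology}, 'n::finite,
                'e::topological_space, 'k::finite) field_theory"
    and EM :: "('c \<Rightarrow> 'm \<Rightarrow> real^'n^'n) \<Rightarrow> ('m \<Rightarrow> 'e) \<Rightarrow> 'c \<Rightarrow> 'm \<Rightarrow> real^'n^'n"
  assumes "oriented_manifold T"
    and "matter_bundle T"
    and "frame_structure T"
    and "matter_lagrangian T"
    and "\<And>h \<phi>. gravitational_field T h \<Longrightarrow> matter_field T \<phi> \<Longrightarrow>
           energy_momentum_tensor T h \<phi> (EM h \<phi>)"
  shows "(\<forall>h \<phi>. gravitational_field T h \<and> matter_field T \<phi> \<and> on_shell T h \<phi> \<longrightarrow>
            (weyl_invariant_at T h \<phi> \<longleftrightarrow> traceless T (metric_of T h) (EM h \<phi>))) \<and>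
         (on_shell_weyl_invariant T \<longleftrightarrow>
            (\<forall>h \<phi>. gravitational_field T h \<and> matter_field T \<phi> \<and> on_shell T h \<phi> \<longrightarrow>
               traceless T (metric_of T h) (EM h \<phi>)))"
proof -
  interpret matter_theory T
    using assms(1-4) by unfold_locales
  have *: "weyl_invariant_at T h \<phi> \<longleftrightarrow> traceless T (metric_of T h) (EM h \<phi>)"
    if "gravitational_field T h" "matter_field T \<phi>" "on_shell T h \<phi>" for h \<phi>
    by (rule weyl_invariant_at_iff_traceless[OF that assms(5)[OF that(1,2)]])
  \<comment> \<open>The global equivalence is the one for a single configuration, quantified over
    all on-shell configurations.\<close>
  then show ?thesis
    unfolding on_shell_weyl_invariant_def by blast
qed

end
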